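(* Let $I=\{1,\dots,k\}$. For each $i\in I$ let $f_i:\mathbb{R}^n\to\overline{\mathbb{R}}$ be Clarke regular, $\bar{x}\in\operatorname{dom}f_i$, and suppose $f_i$ has a fast track $\bar{x}+(u_i+v_i(u_i))$ at $\bar{x}$, with $\mathcal{U}_i,\mathcal{V}_i$ the $\mathcal{VU}$-decomposition for $f_i$ at $\bar{x}$ and $\mathcal{M}_i=\{\bar{x}+(u_i+v_i(u_i)):u_i\in\mathcal{U}_i\}$. Assume that $$\sum_{i\in I}z_i=0,\ z_i\in N_{\mathcal{M}_i}(\bar{x})\text{ for each }i\in I\quad\Longrightarrow\quad z_i=0\text{ for each }i\in I.$$ Define $\Phi:\mathbb{R}^n\to\mathbb{R}^{nk}$, $\Phi(x)=(x,x,\dots,x)$, and $h(z)=\sum_{i\in I}f_i(z_i)$ for $z=(z_1,\dots,z_k)\in\mathbb{R}^{nk}$, so that $$f(x):=(h\circ\Phi)(x)=\sum_{i=1}^kf_i(x).$$ Then $h$ has a fast track at $\Phi(\bar{x})$ and $\Phi$ is transversal at $\bar{x}$ to the manifold defined by that fast track; moreover, the $\mathcal{U}$-space $\mathcal{U}$ of $f$ at $\bar{x}$, with $\mathcal{U}$-basis matrix $\overline{U}$, satisfies $$\mathcal{U}=\bigcap_{i\in I}\mathcal{U}_i,\qquad \nabla_{\mathcal{U}}f(\bar{x})=\overline{U}\,\overline{U}^\top\sum_{i=1}^k\bar{g}_i=\operatorname{Proj}_{\mathcal{U}}\sum_{i=1}^k\bar{g}_i$$ for any $\bar{g}_i\in\operatorname{ri}\partial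 f_i(\bar{x})$, $i\in I$.
   Context: $\overline{\mathbb{R}}=\mathbb{R}\cup\{+\infty\}$; lsc means lower semicontinuous; $\partial f$ is the limiting (Mordukhovich) subdifferential; $\operatorname{ri}$ is relative interior; $N_S$ is the limiting normal cone and $\widehat N_S$ the regular normal cone; $\operatorname{Proj}_{\mathcal{U}}$ is orthogonal projection onto $\mathcal U$; $\nabla\Phi(\bar x)$ is the Jacobian. $f$ is Clarke regular at $\bar{x}$ if $\widehat N_{\operatorname{epi}f}(\bar{x},f(\bar{x}))=N_{\operatorname{epi}f}(\bar{x},f(\bar{x}))$. A set $\mathcal{M}\subseteq\mathbb{R}^n$ is a $d$-dimensional ($\mathcal{C}^2$) manifold about $\bar{x}\in\mathcal{M}$ if near $\bar{x}$ it is the solution set of $F(x)=0$ for a $\mathcal{C}^2$ map $F$ into $\mathbb{R}^{n-d}$ with surjective Jacobian at $\bar x$. PDG structure: an lsc $f:\mathbb{R}^n\to\overline{\mathbb{R}}$ has primal-dual gradient (PDG) structure at $\bar{x}$ relative to a manifold $\mathcal{M}\subseteq\mathbb{R}^n$ if there are functions $f_0,\dots,f_{m_1},\varphi_1,\dots,\varphi_{m_2}$ that are $\mathcal{C}^2$ on a ball $B_\delta(\bar{x})$ and a closed convex set $\Delta\subseteq\mathbb{R}^{m_1+1+m_2}$ such that: (i) $\bar{x}\in\{x\in B_\delta(\bar{x}):f_i(x)=f(x)\ \forall i,\ \varphi_j(x)=0\ \forall j\}\subseteq\mathcal{M}\cap B_\delta(\bar{x})$; (ii) $(\alpha,\beta)\in\Delta$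 implies $\alpha_i\ge 0$ and $\sum_{i=0}^{m_1}\alpha_i=1$; (iii) for $i=0,\dots,m_1$ the canonical vector with $\alpha_i=1$ and all other entries zero is in $\Delta$; (iv) for each $\bar{j}$ there is $(\alpha,\beta)\in\Delta$ with $\beta_{\bar{j}}\ne0$ and $\beta_j=0$ for $j\neq\bar{j}$; (v) for each $x\in\mathcal{M}\cap B_\delta(\bar{x})$: $f(x)=f_i(x)$ for some $i$, and $g\in\partial f(x)$ iff $g=\sum_i\alpha_i\nabla f_i(x)+\sum_j\beta_j\nabla\varphi_j(x)$ for some $(\alpha,\beta)\in\Delta$ with $\alpha_i=0$ whenever $f_i(x)\ne f(x)$ and $\beta_j=0$ whenever $\varphi_j(x)\neq0$. $\mathcal{VU}$-decomposition: for $f$ lsc with $\partial f(\bar{x})\ne\emptyset$ and any $\bar{g}\in\operatorname{ri}\partial f(\bar{x})$, $\mathcal{V}=\operatorname{span}(\partial f(\bar{x})-\bar{g})$ and $\mathcal{U}=N_{\partial f(\bar{x})}(\bar{g})$ (orthogonally complementary subspaces, independent of $\bar{g}$). $\overline{V}$ denotes a matrix whose columns form a basis of $\mathcal{V}$; a $\mathcal{U}$-basis matrix $\overline{U}$ is a matrix whose columns form an orthonormal basis of $\mathcal{U}$. Vectors of $\mathcal{U},\mathcal{V}$ are identified with their coordinates with respect to $\overline{U},\overline{V}$. $\mathcal{U}$-Lagrangian (for $f$ PDG at $\bar x$): $L_{\mathcal{U}}f(u;\bar{g})=\min_{v\in\mathcal{V}}\{f(\bar{x}+\overline{U}u+\overline{V}v)-\bar{g}^\top\overline{V}v\}$,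 and $W_{\mathcal{U}}f(u;\bar{g})$ is the corresponding set of minimizers $v$. Fast track: let $f$ be PDG at $\bar{x}$ relative to a $d$-dimensional manifold, with $\dim\mathcal{V}=n-d$. The function $\chi(u)=\bar{x}+\overline{U}u+\overline{V}v(u)$ (also written $\bar{x}+(u+v(u))$), $v:\mathcal{U}\to\mathcal{V}$, is a fast track of $f$ at $\bar{x}$ if for every $\bar{g}\in\operatorname{ri}\partial f(\bar{x})$ and for $u$ near $0$: (i) $v$ is $\mathcal{C}^2$ with $v(u)\in W_{\mathcal{U}}f(u;\bar{g})$; (ii) $L_{\mathcal{U}}f(u;\bar{g})$ is $\mathcal{C}^2$ in $u$. The manifold defined by the fast track is $\{\bar{x}+(u+v(u)):u\in\mathcal{U}\}$. $\mathcal{U}$-gradient: $\nabla_{\mathcal{U}}f(\bar{x})=\overline{U}\,\nabla L_{\mathcal{U}}f(\bar{x})\in\mathbb{R}^n$, where $\nabla L_{\mathcal{U}}f(\bar{x})$ is the gradient of $u\mapsto L_{\mathcal{U}}f(u;\bar{g})$ at $u=0$. Transversality: a $\mathcal{C}^2$ map $\Phi:\mathbb{R}^m\to\mathbb{R}^n$ is transversal to a manifold $\mathcal{M}\subseteq\mathbb{R}^n$ at $\bar{x}$, where $\Phi(\bar{x})\in\mathcal{M}$, if $\{z\in N_{\mathcal{M}}(\Phi(\bar{x})):\nabla\Phi(\bar{x})^\top z=0\}=\{0\}$.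
   Formalization: The U-gradient formula for f is proved with the U-Lagrangian's minimum over small v (over all of V only if f has a fast track), as the global version can fail; a fast track is taken to pass through the base point, its manifold being the one of the PDG structure. *)

theory Defs
  imports "HOL-Analysis.Analysis"
begin

text \<open>
  Everything is stated over a Euclidean space \<open>'a\<close>; it is used for \<open>real ^ 'n\<close> and for
  \<open>(real ^ 'n) ^ 'k\<close>, whose inner product is the sum of the inner products of the \<open>k\<close> blocks.
  Extended-valued functions have type \<open>ereal\<close>; that the value \<open>-\<infinity>\<close> is not taken is assumed
  where it is needed.
\<close>

section \<open>Variational analysis\<close>

definition lsc :: "('a::euclidean_space \<Rightarrow> ereal) \<Rightarrow> bool" where
  "lsc f \<longleftrightarrow> (\<forall>x. f x \<le> Liminf (at x) f)"

definition epi :: "('a \<Rightarrow> ereal) \<Rightarrow> ('a \<times> real) set" where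
  "epi f = {(x, a). f x \<le> ereal a}"

definition regular_normal_cone :: "'a::euclidean_space set \<Rightarrow> 'a \<Rightarrow> 'a set" where
  "regular_normal_cone S x =
     {w. x \<in> S \<and> (\<forall>e>0. \<forall>\<^sub>F y in at x within S. w \<bullet> (y - x) \<le> e * norm (y - x))}"

definition normal_cone :: "'a::euclidean_space set \<Rightarrow> 'a \<Rightarrow> 'a set" where
  "normal_cone S x =
     {w. x \<in> S \<and> (\<exists>X W. (\<forall>k::nat. W k \<in> regular_normal_cone S (X k)) \<and>
                        X \<longlonglongrightarrow> x \<and> W \<longlonglongrightarrow> w)}"

definition regular_subdifferential :: "('a::euclidean_space \<Rightarrow> ereal) \<Rightarrow> 'a \<Rightarrow> 'a set" where
  "regular_subdifferential f x =
     {w. \<bar>f x\<bar> \<noteq> \<infinity> \<and>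
         (\<forall>e>0. \<forall>\<^sub>F y in at x. f x + ereal (w \<bullet> (y - x) - e * norm (y - x)) \<le> f y)}"

definition subdifferential :: "('a::euclidean_space \<Rightarrow> ereal) \<Rightarrow> 'a \<Rightarrow> 'a set" where
  "subdifferential f x =
     {w. \<bar>f x\<bar> \<noteq> \<infinity> \<and>
         (\<exists>X W. (\<forall>k::nat. W k \<in> regular_subdifferential f (X k)) \<and>
                X \<longlonglongrightarrow> x \<and> (\<lambda>k. f (X k)) \<longlonglongrightarrow> f x \<and> W \<longlonglongrightarrow> w)}"

definition clarke_regular :: "('a::euclidean_space \<Rightarrow> ereal) \<Rightarrow> 'a \<Rightarrow> bool" where
  "clarke_regular f x \<longleftrightarrow> \<bar>f x\<bar> \<noteq> \<infinity> \<and>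
     regular_normal_cone (epi f) (x, real_of_ereal (f x)) = normal_cone (epi f) (x, real_of_ereal (f x))"

section \<open>Twice continuously differentiable maps and manifolds\<close>

text \<open>
  \<open>C2_on S f\<close> is used only for \<open>S\<close> open, or relatively open in a linear subspace \<open>U\<close>.
  In the second case \<open>f'\<close> and \<open>f''\<close> are determined only on directions in \<open>U\<close>, and the condition
  says that \<open>f\<close>, read in coordinates of \<open>U\<close>, is twice continuously differentiable
  (given derivatives along \<open>U\<close>, compose them with the orthogonal projection onto \<open>U\<close>).
\<close>

definition C2_on :: "'a::euclidean_space set \<Rightarrow> ('a \<Rightarrow> 'b::euclidean_space) \<Rightarrow> bool" where
  "C2_on S f \<longleftrightarrow>
     (\<exists>(f' :: 'a \<Rightarrow> ('a, 'b) blinfun) (f'' :: 'a \<Rightarrow> ('a, ('a, 'b) blinfun) blinfun).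
        (\<forall>x\<in>S. (f has_derivative blinfun_apply (f' x)) (at x within S)) \<and>
        (\<forall>x\<in>S. (f' has_derivative blinfun_apply (f'' x)) (at x within S)) \<and>
        continuous_on S f'')"

definition grad :: "('a::euclidean_space \<Rightarrow> real) \<Rightarrow> 'a \<Rightarrow> 'a" where
  "grad f x = (THE D. GDERIV f x :> D)"

text \<open>
  The dimension \<open>n - d\<close> of the target of the defining map is not a type, so the map is given by
  its components \<open>F 0, \<dots>, F (m - 1)\<close> with \<open>m + d = n\<close>; the last conjunct is surjectivity of the
  Jacobian at \<open>x\<close>.
\<close>

definition manifold_about :: "nat \<Rightarrow> 'a::euclidean_space set \<Rightarrow> 'a \<Rightarrow> bool" where
  "manifold_about d M x \<longleftrightarrow> x \<in> M \<and>
     (\<exists>m r (F :: nat \<Rightarrow> 'a \<Rightarrow> real). m + d = DIM('a) \<and> r > 0 \<and>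
        (\<forall>j<m. C2_on (ball x r) (F j)) \<and>
        M \<inter> ball x r = {y \<in> ball x r. \<forall>j<m. F j y = 0} \<and>
        (\<forall>c :: nat \<Rightarrow> real. \<exists>p. \<forall>j<m. grad (F j) x \<bullet> p = c j))"

definition transversal ::
    "('a::euclidean_space \<Rightarrow> 'b::euclidean_space) \<Rightarrow> 'b set \<Rightarrow> 'a \<Rightarrow> bool" where
  "transversal \<Phi> M x \<longleftrightarrow> C2_on UNIV \<Phi> \<and> (\<exists>d. manifold_about d M (\<Phi> x)) \<and>
     {z \<in> normal_cone M (\<Phi> x). adjoint (frechet_derivative \<Phi> (at x)) z = 0} = {0}"

section \<open>Primal-dual gradient structure\<close>

text \<open>
  A vector of \<open>\<real>\<close> to the power \<open>m1 + 1 + m2\<close> is a pair \<open>(\<alpha>, \<beta>)\<close> of sequences that vanish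
  outside \<open>{0..m1}\<close> and \<open>{1..m2}\<close>, respectively.  On the set of these pairs the product topology
  of the function types is the Euclidean one.  Function types are not real vector spaces in the
  library, so convexity is spelled out.
\<close>

definition coefficient_set ::
    "nat \<Rightarrow> nat \<Rightarrow> ((nat \<Rightarrow> real) \<times> (nat \<Rightarrow> real)) set \<Rightarrow> bool" where
  "coefficient_set m1 m2 \<Delta> \<longleftrightarrow>
     (\<forall>(\<alpha>, \<beta>)\<in>\<Delta>. (\<forall>i. i \<notin> {0..m1} \<longrightarrow> \<alpha> i = 0) \<and> (\<forall>j. j \<notin> {1..m2} \<longrightarrow> \<beta> j = 0)) \<and>
     closed \<Delta> \<and>
     (\<forall>(\<alpha>, \<beta>)\<in>\<Delta>. \<forall>(\<alpha>', \<beta>')\<in>\<Delta>. \<forall>t\<in>{0..1}.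
        ((\<lambda>i. (1 - t) * \<alpha> i + t * \<alpha>' i), (\<lambda>j. (1 - t) * \<beta> j + t * \<beta>' j)) \<in> \<Delta>)"

definition pdg_structure ::
    "('a::euclidean_space \<Rightarrow> ereal) \<Rightarrow> 'a \<Rightarrow> 'a set \<Rightarrow> bool" where
  "pdg_structure f x M \<longleftrightarrow> lsc f \<and>
     (\<exists>m1 m2 (fs :: nat \<Rightarrow> 'a \<Rightarrow> real) (\<phi> :: nat \<Rightarrow> 'a \<Rightarrow> real) \<Delta> \<delta>.
        \<delta> > 0 \<and>
        (\<forall>i\<in>{0..m1}. C2_on (ball x \<delta>) (fs i)) \<and>
        (\<forall>j\<in>{1..m2}. C2_on (ball x \<delta>) (\<phi> j)) \<and>
        coefficient_set m1 m2 \<Delta> \<and>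
        x \<in> {y \<in> ball x \<delta>. (\<forall>i\<in>{0..m1}. ereal (fs i y) = f y) \<and> (\<forall>j\<in>{1..m2}. \<phi> j y = 0)} \<and>
        {y \<in> ball x \<delta>. (\<forall>i\<in>{0..m1}. ereal (fs i y) = f y) \<and> (\<forall>j\<in>{1..m2}. \<phi> j y = 0)}
          \<subseteq> M \<inter> ball x \<delta> \<and>
        (\<forall>(\<alpha>, \<beta>)\<in>\<Delta>. (\<forall>i\<in>{0..m1}. \<alpha> i \<ge> 0) \<and> (\<Sum>i=0..m1. \<alpha> i) = 1) \<and>
        (\<forall>i\<in>{0..m1}. ((\<lambda>k. if k = i then 1 else 0), (\<lambda>_. 0)) \<in> \<Delta>) \<and>
        (\<forall>j'\<in>{1..m2}. \<exists>(\<alpha>, \<beta>)\<in>\<Delta>. \<beta> j' \<noteq> 0 \<and> (\<forall>j\<in>{1..m2}. j \<noteq> j' \<longrightarrow> \<beta> j = 0)) \<and>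
        (\<forall>y \<in> M \<inter> ball x \<delta>.
           (\<exists>i\<in>{0..m1}. f y = ereal (fs i y)) \<and>
           (\<forall>g. g \<in> subdifferential f y \<longleftrightarrow>
              (\<exists>(\<alpha>, \<beta>)\<in>\<Delta>.
                 (\<forall>i\<in>{0..m1}. ereal (fs i y) \<noteq> f y \<longrightarrow> \<alpha> i = 0) \<and>
                 (\<forall>j\<in>{1..m2}. \<phi> j y \<noteq> 0 \<longrightarrow> \<beta> j = 0) \<and>
                 g = (\<Sum>i=0..m1. \<alpha> i *\<^sub>R grad (fs i) y) + (\<Sum>j=1..m2. \<beta> j *\<^sub>R grad (\<phi> j) y)))))"

section \<open>VU-decomposition, U-Lagrangian, fast tracks\<close>

text \<open>
  If the subdifferential is convex (as it is under either primal-dual gradient structure or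
  Clarke regularity), the spaces do not depend on the choice of the relative interior subgradient.
\<close>

definition ri_subgradient :: "('a::euclidean_space \<Rightarrow> ereal) \<Rightarrow> 'a \<Rightarrow> 'a" where
  "ri_subgradient f x = (SOME g. g \<in> rel_interior (subdifferential f x))"

definition V_space :: "('a::euclidean_space \<Rightarrow> ereal) \<Rightarrow> 'a \<Rightarrow> 'a set" where
  "V_space f x = span ((\<lambda>g. g - ri_subgradient f x) ` subdifferential f x)"

definition U_space :: "('a::euclidean_space \<Rightarrow> ereal) \<Rightarrow> 'a \<Rightarrow> 'a set" where
  "U_space f x = normal_cone (subdifferential f x) (ri_subgradient f x)"

text \<open>
  Vectors of the U- and V-space are identified with their coordinates: in \<open>u\<close> and \<open>v\<close> below stand
  the elements of the subspaces themselves, not the coordinate tuples with respect to basis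
  matrices, whose lengths are not types.
  The parameter \<open>D\<close> is the set over which \<open>v\<close> ranges; see \<open>has_local_U_gradient\<close>.
\<close>

definition lagrangian_over ::
    "'a::euclidean_space set \<Rightarrow> ('a \<Rightarrow> ereal) \<Rightarrow> 'a \<Rightarrow> 'a \<Rightarrow> 'a \<Rightarrow> ereal" where
  "lagrangian_over D f x g u = (INF v\<in>D. f (x + u + v) - ereal (g \<bullet> v))"

definition U_lagrangian :: "('a::euclidean_space \<Rightarrow> ereal) \<Rightarrow> 'a \<Rightarrow> 'a \<Rightarrow> 'a \<Rightarrow> ereal" where
  "U_lagrangian f x g u = lagrangian_over (V_space f x) f x g u"

definition U_minimizers :: "('a::euclidean_space \<Rightarrow> ereal) \<Rightarrow> 'a \<Rightarrow> 'a \<Rightarrow> 'a \<Rightarrow> 'a set" where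
  "U_minimizers f x g u =
     {v \<in> V_space f x. f (x + u + v) - ereal (g \<bullet> v) = U_lagrangian f x g u}"

definition track_manifold ::
    "('a::euclidean_space \<Rightarrow> ereal) \<Rightarrow> 'a \<Rightarrow> ('a \<Rightarrow> 'a) \<Rightarrow> 'a set" where
  "track_manifold f x v = {x + (u + v u) | u. u \<in> U_space f x}"

text \<open>
  \<open>fast_track f x v\<close>: the map taking \<open>u\<close> to \<open>x + (u + v u)\<close> is a fast track of \<open>f\<close> at \<open>x\<close>.
  The manifold relative to which \<open>f\<close> has primal-dual gradient structure is the manifold that the
  track parametrizes (both notions depend on the manifold near \<open>x\<close> only).  In particular the track
  passes through \<open>x\<close>, that is, \<open>v 0 = 0\<close>; the conditions on the minimizers alone do not imply this,
  since they involve a global minimum over the V-space.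
\<close>

definition fast_track ::
    "('a::euclidean_space \<Rightarrow> ereal) \<Rightarrow> 'a \<Rightarrow> ('a \<Rightarrow> 'a) \<Rightarrow> bool" where
  "fast_track f x v \<longleftrightarrow>
     subdifferential f x \<noteq> {} \<and>
     (\<exists>d. manifold_about d (track_manifold f x v) x \<and>
          pdg_structure f x (track_manifold f x v) \<and>
          dim (V_space f x) + d = DIM('a)) \<and>
     v \<in> U_space f x \<rightarrow> V_space f x \<and>
     (\<forall>g \<in> rel_interior (subdifferential f x). \<exists>r>0.
        C2_on (U_space f x \<inter> ball 0 r) v \<and>
        (\<forall>u \<in> U_space f x \<inter> ball 0 r. v u \<in> U_minimizers f x g u) \<and>
        (\<forall>u \<in> U_space f x \<inter> ball 0 r. \<bar>U_lagrangian f x g u\<bar> \<noteq> \<infinity>) \<and>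
        C2_on (U_space f x \<inter> ball 0 r) (\<lambda>u. real_of_ereal (U_lagrangian f x g u)))"

section \<open>U-gradient\<close>

definition orthonormal_basis_matrix :: "real ^ 'd ^ 'n \<Rightarrow> (real ^ 'n) set \<Rightarrow> bool" where
  "orthonormal_basis_matrix A U \<longleftrightarrow>
     (\<forall>i j. column i A \<bullet> column j A = (if i = j then 1 else 0)) \<and> span (columns A) = U"

text \<open>
  \<open>gradient_at_0_on U L w\<close>: \<open>L\<close> is finite near 0 on the subspace \<open>U\<close> and differentiable at 0
  along \<open>U\<close>, and \<open>w\<close> is the element of \<open>U\<close> representing the derivative.  If the columns of a matrix
  \<open>A\<close> are an orthonormal basis of \<open>U\<close>, then \<open>w\<close> is \<open>A\<close> times the gradient at 0 of
  \<open>L \<circ> (*v) A\<close>, which is the vector the definition of the U-gradient asks for.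
\<close>

definition gradient_at_0_on :: "'a::euclidean_space set \<Rightarrow> ('a \<Rightarrow> ereal) \<Rightarrow> 'a \<Rightarrow> bool" where
  "gradient_at_0_on U L w \<longleftrightarrow> w \<in> U \<and>
     (\<exists>r>0. \<forall>u \<in> U \<inter> ball 0 r. \<bar>L u\<bar> \<noteq> \<infinity>) \<and>
     ((\<lambda>u. real_of_ereal (L u)) has_derivative (\<lambda>p. w \<bullet> p)) (at 0 within U)"

definition has_U_gradient :: "('a::euclidean_space \<Rightarrow> ereal) \<Rightarrow> 'a \<Rightarrow> 'a \<Rightarrow> bool" where
  "has_U_gradient f x w \<longleftrightarrow>
     (\<forall>g \<in> rel_interior (subdifferential f x). gradient_at_0_on (U_space f x) (U_lagrangian f x g) w)"

text \<open>
  The same with the minimum taken over all sufficiently small \<open>v\<close>.  If \<open>f\<close> has a fast track,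
  the minimizers \<open>v u\<close> tend to 0 with \<open>u\<close>, so the Lagrangian near 0 and its gradient are the same.
  For a sum of functions that have fast tracks, the minimum over the whole V-space may be
  \<open>-\<infinity>\<close> or be attained far away, because the V-space of the sum contains directions of the U-spaces
  of the summands.  An example on \<open>\<real>\<close> to the power 3, at the origin: take \<open>\<bar>y\<bar> + (z - 100) * b x\<close>
  and \<open>\<bar>x\<bar>\<close> with a smooth bump \<open>b\<close> supported in \<open>{4..6}\<close> and of maximum 1.
  The U-space of the sum is the \<open>z\<close>-axis, and the minimum over all \<open>(x, y)\<close> is attained
  in the support of \<open>b\<close> and increases in \<open>z\<close> with positive slope, although every subgradient of
  the sum at the origin has \<open>z\<close>-component 0.
\<close>

definition has_local_U_gradient :: "('a::euclidean_space \<Rightarrow> ereal) \<Rightarrow> 'a \<Rightarrow> 'a \<Rightarrow> bool" where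
  "has_local_U_gradient f x w \<longleftrightarrow>
     (\<forall>g \<in> rel_interior (subdifferential f x). \<forall>\<^sub>F e in at_right 0.
        gradient_at_0_on (U_space f x) (lagrangian_over (V_space f x \<inter> cball 0 e) f x g) w)"

end

(*
  Let L be the U-Lagrangian of f, with subgradient g.  Near x the function
    q (x + u + w) = L u + <g, w> - |w - v u|^2   (u in U, w in V)
  is a C2 minorant of f that touches f exactly along the fast track.

  Primal-dual gradient structure of h: sums of the structure functions f_il of the f_i, taken over
  all multi-indices, do not serve, since the differences f_il - f_i may cancel in such a sum.  With
  the minorants q_i one takes the functions Q = sum_i q_i and Q + (f_il - q_i), and adds the
  differences f_il - q_i to the constraint functions phi_ij.

  Subgradients of F: a quadratic penalty for z = Phi y shows that a subgradient of F at x is a limit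
  of sums of subgradients of the f_i at nearby points.  These remain bounded by the qualification
  condition, because horizon subgradients of Clarke regular functions lie in the V-spaces.  Hence
  the subdifferential of F at x is the sum of those of the f_i, which gives the U-space of F.

  U-gradient of F: the local Lagrangian is estimated from below by finitely many subgradients around
  a relative interior one, and from above by the values of F at points that lie on all tracks; there
  F coincides with Q o Phi.  Such points exist close to x + u, for u in the U-space, by an open mapping
  argument.
*)
theory Submission
  imports Defs
begin

section \<open>Orthogonal projections\<close>

text \<open>Clarke regularity enters in two ways. Regular and limiting subgradients coincide at
  \<open>x\<close>; tested along a track they give the derivative 0 of \<open>v\<close> at 0, so the
  V-space of \<open>f i\<close> consists of normals to its track, and the qualification condition
  says that the V-spaces are independent. Moreover, the normal cone of the epigraph is closed under
  addition, so horizon subgradients can be added to subgradients and are differences of these.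

  In the structure of \<open>h\<close> the weights of a subgradient have sum 1 in every block and do
  not fit into one simplex; as coefficients of constraint functions they are free. The gradient of
  \<open>q i\<close> on the track is itself a subgradient, and a surplus or deficit of weight in a
  block is charged to it.

  The lower bound of the local Lagrangian has an error \<epsilon> times \<open>norm (u + w)\<close>,
  while the ball for \<open>w\<close> must not depend on \<epsilon>. A relative interior subgradient
  provides a gain proportional to \<open>norm w\<close>. Where \<open>w\<close> dominates
  \<open>u\<close>, this gain absorbs the error at one fixed tolerance; elsewhere \<open>u\<close>
  controls \<open>u + w\<close>.\<close>

lemma closest_point_subspace:
  fixes U :: "'a::euclidean_space set"
  assumes "subspace U"
  shows closest_point_in_subspace: "closest_point U y \<in> U"
    and closest_point_orthogonal: "u \<in> U \<Longrightarrow> (y - closest_point U y) \<bullet> u = 0"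
proof -
  let ?p = "closest_point U y"
  have U: "closed U" "convex U" "U \<noteq> {}"
    using assms closed_subspace subspace_imp_convex subspace_0 by blast+
  show p: "?p \<in> U"
    using U closest_point_in_set by blast
  assume "u \<in> U"
  then have "?p + u \<in> U" "?p - u \<in> U"
    using p assms by (auto simp: subspace_add subspace_diff)
  from this[THEN closest_point_dot[OF U(2,1), where a = y]]
  show "(y - ?p) \<bullet> u = 0"
    by (simp add: inner_diff_right)
qed

lemma closest_point_subspace_eqI:
  fixes U :: "'a::euclidean_space set"
  assumes U: "subspace U" and a: "a \<in> U" "\<And>u. u \<in> U \<Longrightarrow> (y - a) \<bullet> u = 0"
  shows "closest_point U y = a"
proof -
  let ?d = "closest_point U y - a"
  have d: "?d \<in> U"
    using U a(1) closest_point_in_subspace subspace_diff by blast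
  have "?d \<bullet> ?d = (y - a) \<bullet> ?d - (y - closest_point U y) \<bullet> ?d"
    by (simp add: algebra_simps)
  also have "\<dots> = 0"
    using d a(2) closest_point_orthogonal[OF U] by simp
  finally show ?thesis by simp
qed

lemma closest_point_subspace_self:
  "subspace U \<Longrightarrow> u \<in> U \<Longrightarrow> closest_point U (u::'a::euclidean_space) = u"
  by (rule closest_point_self)

lemma linear_closest_point:
  fixes U :: "'a::euclidean_space set"
  assumes U: "subspace U"
  shows "linear (closest_point U)"
proof (rule linearI)
  fix y z :: 'a and c :: real
  note cp = closest_point_in_subspace[OF U] closest_point_orthogonal[OF U]
  show "closest_point U (y + z) = closest_point U y + closest_point U z"
  proof (rule closest_point_subspace_eqI[OF U])
    show "closest_point U y + closest_point U z \<in> U"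
      using U cp(1) by (simp add: subspace_add)
    fix u assume "u \<in> U"
    with cp(2)[of u y] cp(2)[of u z]
    show "(y + z - (closest_point U y + closest_point U z)) \<bullet> u = 0"
      by (simp add: algebra_simps)
  qed
  show "closest_point U (c *\<^sub>R y) = c *\<^sub>R closest_point U y"
  proof (rule closest_point_subspace_eqI[OF U])
    show "c *\<^sub>R closest_point U y \<in> U"
      using U cp(1) by (simp add: subspace_scale)
    fix u assume "u \<in> U"
    with cp(2)[of u y] show "(c *\<^sub>R y - c *\<^sub>R closest_point U y) \<bullet> u = 0"
      by (metis inner_scaleR_left mult_zero_right scaleR_diff_right)
  qed
qed

lemma closest_point_inner_left:
  fixes U :: "'a::euclidean_space set"
  assumes "subspace U" "u \<in> U"
  shows "closest_point U y \<bullet> u = y \<bullet> u"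
  using closest_point_orthogonal[OF assms, of y] by (simp add: inner_diff_left)

lemma norm_closest_point_subspace_le:
  fixes U :: "'a::euclidean_space set"
  assumes U: "subspace U"
  shows "norm (closest_point U y) \<le> norm y"
proof -
  let ?p = "closest_point U y"
  have "?p \<bullet> ?p = y \<bullet> ?p"
    using closest_point_inner_left[OF U closest_point_in_subspace[OF U]] .
  also have "\<dots> \<le> norm y * norm ?p"
    by (rule norm_cauchy_schwarz)
  finally have "norm ?p * norm ?p \<le> norm y * norm ?p"
    by (simp add: norm_eq_sqrt_inner)
  then show ?thesis
    by (cases "norm ?p = 0") auto
qed

lemma norm_diff_closest_point_subspace_le:
  fixes U :: "'a::euclidean_space set"
  assumes U: "subspace U"
  shows "norm (y - closest_point U y) \<le> norm y"
  using closest_point_le[OF closed_subspace[OF U] subspace_0[OF U], of y] by (simp add: dist_norm)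

lemma matrix_projection_eq_closest_point:
  fixes A :: "real ^ 'd ^ 'n" and s :: "real ^ 'n"
  assumes "orthonormal_basis_matrix A U"
  shows "(A ** transpose A) *v s = closest_point U s"
proof -
  have ob: "\<And>i j. column i A \<bullet> column j A = (if i = j then 1 else 0)" and sp: "span (columns A) = U"
    using assms by (auto simp: orthonormal_basis_matrix_def)
  have U: "subspace U"
    using sp subspace_span by blast
  have "closest_point U s = A *v (transpose A *v s)"
  proof (rule closest_point_subspace_eqI[OF U])
    have eq: "A *v w = (\<Sum>j\<in>UNIV. w $ j *\<^sub>R column j A)" for w
      by (simp add: matrix_mult_sum scalar_mult_eq_scaleR)
    show "A *v (transpose A *v s) \<in> U"
      unfolding eq sp[symmetric]
      by (intro span_sum span_scale span_base) (auto simp: columns_def)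
    have tr: "(transpose A *v s) $ j = column j A \<bullet> s" for j
      by (simp add: matrix_vector_mult_def transpose_def column_def inner_vec_def)
    have "(s - A *v (transpose A *v s)) \<bullet> column i A = 0" for i
      unfolding eq inner_diff_left inner_sum_left inner_scaleR_left ob tr
      by (simp add: if_distrib inner_commute cong: if_cong)
    then have *: "columns A \<subseteq> {u. (s - A *v (transpose A *v s)) \<bullet> u = 0}"
      by (auto simp: columns_def)
    fix u assume "u \<in> U"
    then have "u \<in> span (columns A)" using sp by simp
    then show "(s - A *v (transpose A *v s)) \<bullet> u = 0"
      using span_minimal[OF * subspace_hyperplane] by blast
  qed
  then show ?thesis
    by (simp only: matrix_vector_mul_assoc)
qed

section \<open>Calculus of twice continuously differentiable maps\<close>

lemma C2_onI:
  assumes "\<And>x. x \<in> S \<Longrightarrow> (f has_derivative blinfun_apply (f' x)) (at x within S)"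
    and "\<And>x. x \<in> S \<Longrightarrow> (f' has_derivative blinfun_apply (f'' x)) (at x within S)"
    and "continuous_on S f''"
  shows "C2_on S f"
  using assms unfolding C2_on_def by blast

lemma C2_onE:
  assumes "C2_on S f"
  obtains f' f'' where "\<And>x. x \<in> S \<Longrightarrow> (f has_derivative blinfun_apply (f' x)) (at x within S)"
    "\<And>x. x \<in> S \<Longrightarrow> (f' has_derivative blinfun_apply (f'' x)) (at x within S)"
    "continuous_on S f''"
  using assms unfolding C2_on_def by blast

lemma C2_on_subset: "C2_on T f \<Longrightarrow> S \<subseteq> T \<Longrightarrow> C2_on S f"
proof -
  assume *: "C2_on T f" "S \<subseteq> T"
  obtain f' f'' where f': "\<And>x. x \<in> T \<Longrightarrow> (f has_derivative blinfun_apply (f' x)) (at x within T)"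
    "\<And>x. x \<in> T \<Longrightarrow> (f' has_derivative blinfun_apply (f'' x)) (at x within T)"
    "continuous_on T f''"
    using C2_onE[OF *(1)] by metis
  show "C2_on S f"
  proof (rule C2_onI[OF _ _ continuous_on_subset[OF f'(3) *(2)]])
    fix x assume "x \<in> S"
    then have x: "x \<in> T" using *(2) by auto
    show "(f has_derivative blinfun_apply (f' x)) (at x within S)"
      by (rule has_derivative_subset[OF f'(1)[OF x] *(2)])
    show "(f' has_derivative blinfun_apply (f'' x)) (at x within S)"
      by (rule has_derivative_subset[OF f'(2)[OF x] *(2)])
  qed
qed

lemma C2_on_cong:
  assumes "\<And>x. x \<in> S \<Longrightarrow> f x = g x" "C2_on S f"
  shows "C2_on S g"
proof -
  obtain f' f'' where f': "\<And>x. x \<in> S \<Longrightarrow> (f has_derivative blinfun_apply (f' x)) (at x within S)"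
    "\<And>x. x \<in> S \<Longrightarrow> (f' has_derivative blinfun_apply (f'' x)) (at x within S)"
    "continuous_on S f''"
    using C2_onE[OF assms(2)] by metis
  have "(g has_derivative blinfun_apply (f' x)) (at x within S)" if "x \<in> S" for x
    using has_derivative_transform[OF that _ f'(1)[OF that]] assms(1) by metis
  then show ?thesis
    using f'(2,3) by (rule C2_onI)
qed

text \<open>Precomposition with the linear part is itself linear on derivatives (\<open>K\<close>
  below), so both derivatives arise by composition alone. The sets are arbitrary, which lets
  \<open>T\<close> be relatively open in a subspace and \<open>A\<close> the projection onto
  it.\<close>

lemma C2_on_compose_affine:
  fixes A :: "'a::euclidean_space \<Rightarrow> 'b::euclidean_space" and f :: "'b \<Rightarrow> 'c::euclidean_space"
  assumes f: "C2_on T f" and A: "linear A" and ST: "\<And>x. x \<in> S \<Longrightarrow> A x + c \<in> T"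
  shows "C2_on S (\<lambda>x. f (A x + c))"
proof -
  obtain f' f'' where f': "\<And>x. x \<in> T \<Longrightarrow> (f has_derivative blinfun_apply (f' x)) (at x within T)"
    and f'': "\<And>x. x \<in> T \<Longrightarrow> (f' has_derivative blinfun_apply (f'' x)) (at x within T)"
    and cf: "continuous_on T f''"
    using C2_onE[OF f] by metis
  define a where "a = Blinfun A"
  have a: "blinfun_apply a = A"
    unfolding a_def using A linear_conv_bounded_linear bounded_linear_Blinfun_apply by blast
  have bl: "bounded_linear (\<lambda>B :: ('b, 'c) blinfun. B o\<^sub>L a)"
    by (intro bounded_linear_intros)
  define K where "K = Blinfun (\<lambda>B :: ('b, 'c) blinfun. B o\<^sub>L a)"
  have K: "blinfun_apply K = (\<lambda>B. B o\<^sub>L a)"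
    unfolding K_def using bl bounded_linear_Blinfun_apply by blast
  have dA: "((\<lambda>x. A x + c) has_derivative A) (at x within S)" for x
    using A by (auto intro!: derivative_eq_intros bounded_linear_imp_has_derivative
        simp: linear_conv_bounded_linear)
  have im: "(\<lambda>x. A x + c) ` S \<subseteq> T" using ST by auto
  have chain: "((\<lambda>x. g (A x + c)) has_derivative (\<lambda>h. g' (A h))) (at x within S)"
    if "x \<in> S" "(g has_derivative g') (at (A x + c) within T)"
    for x g' and g :: "'b \<Rightarrow> 'd::real_normed_vector"
    using has_derivative_in_compose[OF dA has_derivative_subset[OF that(2) im]] .
  show ?thesis
  proof (rule C2_onI)
    show "((\<lambda>x. f (A x + c)) has_derivative blinfun_apply (f' (A x + c) o\<^sub>L a)) (at x within S)"
      if "x \<in> S" for x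
      using chain[OF that f'[OF ST[OF that]]] by (simp add: a blinfun_compose.rep_eq comp_def)
    show "((\<lambda>x. f' (A x + c) o\<^sub>L a) has_derivative blinfun_apply (K o\<^sub>L (f'' (A x + c) o\<^sub>L a)))
           (at x within S)" if "x \<in> S" for x
      using bounded_linear.has_derivative[OF bl chain[OF that f''[OF ST[OF that]]]]
      by (simp add: K a blinfun_compose.rep_eq comp_def)
    have "continuous_on S (\<lambda>x. A x + c)"
      by (rule has_derivative_continuous_on[OF dA])
    then have "continuous_on S (\<lambda>x. f'' (A x + c))"
      using continuous_on_compose2[OF cf] im by blast
    then show "continuous_on S (\<lambda>x. K o\<^sub>L (f'' (A x + c) o\<^sub>L a))"
      by (intro continuous_intros)
  qed
qed

lemma C2_on_linear_compose:
  fixes A :: "'b::euclidean_space \<Rightarrow> 'c::euclidean_space" and f :: "'a::euclidean_space \<Rightarrow> 'b"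
  assumes f: "C2_on S f" and A: "linear A"
  shows "C2_on S (\<lambda>x. A (f x))"
proof -
  obtain f' f'' where f': "\<And>x. x \<in> S \<Longrightarrow> (f has_derivative blinfun_apply (f' x)) (at x within S)"
    and f'': "\<And>x. x \<in> S \<Longrightarrow> (f' has_derivative blinfun_apply (f'' x)) (at x within S)"
    and cf: "continuous_on S f''"
    using C2_onE[OF f] by metis
  define a where "a = Blinfun A"
  have bA: "bounded_linear A"
    using A linear_conv_bounded_linear by blast
  have a: "blinfun_apply a = A"
    unfolding a_def using bA bounded_linear_Blinfun_apply by blast
  have bl: "bounded_linear (\<lambda>B :: ('a, 'b) blinfun. a o\<^sub>L B)"
    by (intro bounded_linear_intros)
  define K where "K = Blinfun (\<lambda>B :: ('a, 'b) blinfun. a o\<^sub>L B)"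
  have K: "blinfun_apply K = (\<lambda>B. a o\<^sub>L B)"
    unfolding K_def using bl bounded_linear_Blinfun_apply by blast
  show ?thesis
  proof (rule C2_onI)
    show "((\<lambda>x. A (f x)) has_derivative blinfun_apply (a o\<^sub>L f' x)) (at x within S)"
      if "x \<in> S" for x
      using bounded_linear.has_derivative[OF bA f'[OF that]]
      by (simp add: a blinfun_compose.rep_eq comp_def)
    show "((\<lambda>x. a o\<^sub>L f' x) has_derivative blinfun_apply (K o\<^sub>L f'' x)) (at x within S)"
      if "x \<in> S" for x
      using bounded_linear.has_derivative[OF bl f''[OF that]]
      by (simp add: K blinfun_compose.rep_eq comp_def)
    show "continuous_on S (\<lambda>x. K o\<^sub>L f'' x)"
      using cf by (intro continuous_intros)
  qed
qed

lemma C2_on_const: "C2_on S (\<lambda>x. c)"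
  by (rule C2_onI[where f' = "\<lambda>_. 0" and f'' = "\<lambda>_. 0"])
      (auto simp: zero_blinfun.rep_eq)

lemma C2_on_add:
  assumes "C2_on S f" "C2_on S g"
  shows "C2_on S (\<lambda>x. f x + g x)"
proof -
  obtain f' f'' where f': "\<And>x. x \<in> S \<Longrightarrow> (f has_derivative blinfun_apply (f' x)) (at x within S)"
    "\<And>x. x \<in> S \<Longrightarrow> (f' has_derivative blinfun_apply (f'' x)) (at x within S)"
    "continuous_on S f''"
    using C2_onE[OF assms(1)] by metis
  obtain g' g'' where g': "\<And>x. x \<in> S \<Longrightarrow> (g has_derivative blinfun_apply (g' x)) (at x within S)"
    "\<And>x. x \<in> S \<Longrightarrow> (g' has_derivative blinfun_apply (g'' x)) (at x within S)"
    "continuous_on S g''"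
    using C2_onE[OF assms(2)] by metis
  have eq: "blinfun_apply (p + q) = (\<lambda>h. blinfun_apply p h + blinfun_apply q h)" 
    for p q :: "('d::real_normed_vector, 'e::real_normed_vector) blinfun"
    by (simp add: fun_eq_iff blinfun.add_left)
  show ?thesis
    by (rule C2_onI[where f' = "\<lambda>x. f' x + g' x" and f'' = "\<lambda>x. f'' x + g'' x"])
      (auto simp: eq intro!: has_derivative_add f' g' continuous_intros)
qed

lemma C2_on_uminus: "C2_on S f \<Longrightarrow> C2_on S (\<lambda>x. - f x)"
  by (rule C2_on_linear_compose[where A = uminus]) (auto intro: linearI)

lemma C2_on_diff: "C2_on S f \<Longrightarrow> C2_on S g \<Longrightarrow> C2_on S (\<lambda>x. f x - g x)"
  using C2_on_add[of S f "\<lambda>x. - g x"] C2_on_uminus by auto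

lemma C2_on_sum: "(\<And>i. i \<in> I \<Longrightarrow> C2_on S (f i)) \<Longrightarrow> C2_on S (\<lambda>x. \<Sum>i\<in>I. f i x)"
  by (induction I rule: infinite_finite_induct) (auto intro: C2_on_add C2_on_const)

lemma C2_on_linear:
  fixes A :: "'a::euclidean_space \<Rightarrow> 'b::euclidean_space"
  assumes A: "linear A"
  shows "C2_on S A"
proof -
  have "blinfun_apply (Blinfun A) = A"
    using A linear_conv_bounded_linear bounded_linear_Blinfun_apply by blast
  moreover have "(A has_derivative A) (at x within S)" for x
    using A bounded_linear_imp_has_derivative linear_conv_bounded_linear by blast
  ultimately show ?thesis
    by (intro C2_onI[where f' = "\<lambda>_. Blinfun A" and f'' = "\<lambda>_. 0"])
      (auto simp: zero_blinfun.rep_eq)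
qed

lemma C2_on_power2:
  fixes f :: "'a::euclidean_space \<Rightarrow> real"
  assumes f: "C2_on S f"
  shows "C2_on S (\<lambda>x. (f x)\<^sup>2)"
proof -
  obtain f' f'' where f': "\<And>x. x \<in> S \<Longrightarrow> (f has_derivative blinfun_apply (f' x)) (at x within S)"
    and f'': "\<And>x. x \<in> S \<Longrightarrow> (f' has_derivative blinfun_apply (f'' x)) (at x within S)"
    and cf: "continuous_on S f''"
    using C2_onE[OF f] by metis
  show ?thesis
  \<comment> \<open>The last summand of \<open>f''\<close> is
    \<open>\<lambda>h. (2 * f' x h) *\<^sub>R f' x\<close>: the factor \<open>2 * f x\<close>
    differentiated, times \<open>f' x\<close>.\<close>
  proof (rule C2_onI[where f' = "\<lambda>x. (2 * f x) *\<^sub>R f' x" and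
        f'' = "\<lambda>x. (2 * f x) *\<^sub>R f'' x + ((2 *\<^sub>R blinfun_scaleR_left (f' x)) o\<^sub>L f' x)"])
    show "((\<lambda>x. (f x)\<^sup>2) has_derivative blinfun_apply ((2 * f x) *\<^sub>R f' x)) (at x within S)"
      if "x \<in> S" for x
      using f'[OF that] unfolding power2_eq_square
      by (auto intro!: derivative_eq_intros simp: blinfun.scaleR_left)
    show "((\<lambda>x. (2 * f x) *\<^sub>R f' x) has_derivative blinfun_apply
            ((2 * f x) *\<^sub>R f'' x + ((2 *\<^sub>R blinfun_scaleR_left (f' x)) o\<^sub>L f' x))) (at x within S)"
      if "x \<in> S" for x
      using f'[OF that] f''[OF that]
      by (auto intro!: derivative_eq_intros ext
          simp: blinfun.scaleR_left blinfun.add_left blinfun_compose.rep_eq)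
    have "continuous_on S f" "continuous_on S f'"
      by (rule has_derivative_continuous_on[OF f'], simp)
        (rule has_derivative_continuous_on[OF f''], simp)
    then show "continuous_on S
        (\<lambda>x. (2 * f x) *\<^sub>R f'' x + ((2 *\<^sub>R blinfun_scaleR_left (f' x)) o\<^sub>L f' x))"
      using cf by (intro continuous_intros
          bounded_linear.continuous_on[OF bounded_linear_blinfun_scaleR_left])
  qed
qed

lemma C2_on_continuous_on: "C2_on S f \<Longrightarrow> continuous_on S f"
  unfolding C2_on_def using has_derivative_continuous_on by fast

lemma C2_on_inner_const: "C2_on S f \<Longrightarrow> C2_on S (\<lambda>x. c \<bullet> f x)"
  by (rule C2_on_linear_compose[where A = "\<lambda>y. c \<bullet> y"])
    (auto intro!: linearI simp: inner_add_right)

text \<open>Squares of coordinates reduce the claim to \<open>C2_on_power2\<close>. It serves for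
  the squared defect in \<open>support\<close>.\<close>

lemma C2_on_norm_power2:
  fixes f :: "'a::euclidean_space \<Rightarrow> 'b::euclidean_space"
  assumes "C2_on S f"
  shows "C2_on S (\<lambda>x. (norm (f x))\<^sup>2)"
proof (rule C2_on_cong)
  show "C2_on S (\<lambda>x. \<Sum>b\<in>Basis. (b \<bullet> f x)\<^sup>2)"
    by (intro C2_on_sum C2_on_power2 C2_on_inner_const assms)
  show "(\<Sum>b\<in>Basis. (b \<bullet> f x)\<^sup>2) = (norm (f x))\<^sup>2" for x
    unfolding power2_norm_eq_inner 
    by (subst euclidean_inner) (simp add: power2_eq_square inner_commute)
qed

lemma grad_eqI: "GDERIV f x :> D \<Longrightarrow> grad f x = D"
proof -
  assume D: "GDERIV f x :> D"
  have "D' = D" if "GDERIV f x :> D'" for D'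
  proof -
    have "(\<lambda>h. h \<bullet> D') = (\<lambda>h. h \<bullet> D)"
      using that D unfolding gderiv_def by (rule has_derivative_unique)
    then have "h \<bullet> D' = h \<bullet> D" for h
      by (rule fun_cong)
    from this[of "D' - D"] show "D' = D"
      by (metis eq_iff_diff_eq_0 inner_diff_right inner_eq_zero_iff)
  qed
  then show ?thesis
    unfolding grad_def using D by blast
qed

lemma C2_on_GDERIV:
  fixes f :: "'a::euclidean_space \<Rightarrow> real"
  assumes "C2_on S f" "open S" "x \<in> S"
  shows "GDERIV f x :> grad f x"
proof -
  obtain f' where "(f has_derivative blinfun_apply f') (at x within S)"
    using C2_onE[OF assms(1)] assms(3) by metis
  then have d: "(f has_derivative blinfun_apply f') (at x)"
    by (simp only: at_within_open[OF assms(3,2)])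
  have "linear (blinfun_apply f')"
    by (simp add: blinfun.bounded_linear_right bounded_linear.linear)
  then have "blinfun_apply f' = (\<lambda>h. h \<bullet> adjoint (blinfun_apply f') 1)"
    using adjoint_works[of "blinfun_apply f'" _ 1]
    by (simp add: fun_eq_iff)
  then have "GDERIV f x :> adjoint (blinfun_apply f') 1"
    using d unfolding gderiv_def by simp
  then show ?thesis
    using grad_eqI by metis
qed

section \<open>Regular and limiting subgradients\<close>

text \<open>At \<open>y = x\<close> both sides of the estimate are equal, so the punctured
  neighbourhood of the definition may be replaced by a full one; with the real value
  \<open>a\<close> the left side is computed in the reals.\<close>

lemma regular_subdifferential_real_iff:
  assumes "f x = ereal a"
  shows "w \<in> regular_subdifferential f x \<longleftrightarrow>
    (\<forall>e>0. \<exists>d>0. \<forall>y. dist y x < d \<longrightarrow> ereal (a + w \<bullet> (y - x) - e * norm (y - x)) \<le> f y)"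
proof -
  have "(\<forall>y. y \<noteq> x \<and> dist y x < d \<longrightarrow> ereal (a + w \<bullet> (y - x) - e * norm (y - x)) \<le> f y) \<longleftrightarrow>
      (\<forall>y. dist y x < d \<longrightarrow> ereal (a + w \<bullet> (y - x) - e * norm (y - x)) \<le> f y)" for d e
    using assms by (metis add.right_neutral diff_self inner_zero_right mult_zero_right norm_zero order_refl
        diff_zero)
  then show ?thesis
    using assms by (simp add: regular_subdifferential_def eventually_at add_diff_eq)
qed

lemma regular_subdifferential_finite:
  "w \<in> regular_subdifferential f x \<Longrightarrow> \<bar>f x\<bar> \<noteq> \<infinity>"
  by (simp add: regular_subdifferential_def)

lemma regular_subdifferential_subset: "regular_subdifferential f x \<subseteq> subdifferential f x"
proof
  fix w assume w: "w \<in> regular_subdifferential f x"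
  show "w \<in> subdifferential f x"
    unfolding subdifferential_def mem_Collect_eq
    using w regular_subdifferential_finite[OF w]
    by (intro conjI exI[of _ "\<lambda>_. x"] exI[of _ "\<lambda>_. w"]) auto
qed

lemma convex_regular_subdifferential: "convex (regular_subdifferential f x)"
proof (rule convexI)
  fix p q and s t :: real
  assume p: "p \<in> regular_subdifferential f x" and q: "q \<in> regular_subdifferential f x"
    and st: "0 \<le> s" "0 \<le> t" "s + t = 1"
  obtain a where a: "f x = ereal a"
    using regular_subdifferential_finite[OF p] by auto
  show "s *\<^sub>R p + t *\<^sub>R q \<in> regular_subdifferential f x"
    unfolding regular_subdifferential_real_iff[of f, OF a]
  proof (intro allI impI)
    fix e :: real assume "e > 0"
    obtain d1 where d1: "d1 > 0" "\<And>y. dist y x < d1 \<Longrightarrow>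
        ereal (a + p \<bullet> (y - x) - e * norm (y - x)) \<le> f y"
      using p \<open>e > 0\<close> unfolding regular_subdifferential_real_iff[of f, OF a] by blast
    obtain d2 where d2: "d2 > 0" "\<And>y. dist y x < d2 \<Longrightarrow>
        ereal (a + q \<bullet> (y - x) - e * norm (y - x)) \<le> f y"
      using q \<open>e > 0\<close> unfolding regular_subdifferential_real_iff[of f, OF a] by blast
    have "ereal (a + (s *\<^sub>R p + t *\<^sub>R q) \<bullet> (y - x) - e * norm (y - x)) \<le> f y"
      if y: "dist y x < min d1 d2" for y
    proof -
      define m where "m = max (p \<bullet> (y - x)) (q \<bullet> (y - x))"
      have "(s *\<^sub>R p + t *\<^sub>R q) \<bullet> (y - x) \<le> s * m + t * m"
        unfolding inner_add_left inner_scaleR_left m_def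
        using st by (intro add_mono mult_left_mono) auto
      also have "\<dots> = m"
        using st by (simp flip: distrib_right)
      finally have "ereal (a + (s *\<^sub>R p + t *\<^sub>R q) \<bullet> (y - x) - e * norm (y - x))
          \<le> ereal (a + m - e * norm (y - x))"
        by simp
      also have "\<dots> \<le> f y"
        using d1(2)[of y] d2(2)[of y] y by (auto simp: m_def max_def)
      finally show ?thesis .
    qed
    then show "\<exists>d>0. \<forall>y. dist y x < d \<longrightarrow>
        ereal (a + (s *\<^sub>R p + t *\<^sub>R q) \<bullet> (y - x) - e * norm (y - x)) \<le> f y"
      using d1(1) d2(1) by (intro exI[of _ "min d1 d2"]) auto
  qed
qed

text \<open>A differentiable function that touches \<open>f\<close> from below hands on its
  gradient. Concrete subgradients arise below in this way, from support functions and from a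
  quadratic penalty.\<close>

lemma grad_in_regular_subdifferential:
  assumes eq: "f x = ereal (q x)" and D: "GDERIV q x :> D"
    and le: "\<forall>\<^sub>F y in nhds x. ereal (q y) \<le> f y"
  shows "D \<in> regular_subdifferential f x"
  unfolding regular_subdifferential_real_iff[of f, OF eq]
proof (intro allI impI)
  fix e :: real assume "e > 0"
  obtain d1 where d1: "d1 > 0" "\<And>y. dist y x < d1 \<Longrightarrow> ereal (q y) \<le> f y"
    using le unfolding eventually_nhds_metric by blast
  obtain d2 where d2: "d2 > 0" "\<And>y. norm (y - x) < d2 \<Longrightarrow>
      norm (q y - q x - (y - x) \<bullet> D) \<le> e * norm (y - x)"
    using D \<open>e > 0\<close> unfolding gderiv_def has_derivative_at_alt by blast
  have "ereal (q x + D \<bullet> (y - x) - e * norm (y - x)) \<le> f y" if y: "dist y x < min d1 d2" for y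
  proof -
    have "ereal (q x + D \<bullet> (y - x) - e * norm (y - x)) \<le> ereal (q y)"
      using d2(2)[of y] y by (auto simp: dist_norm inner_commute)
    also have "\<dots> \<le> f y"
      using d1(2) y by simp
    finally show ?thesis .
  qed
  then show "\<exists>d>0. \<forall>y. dist y x < d \<longrightarrow> ereal (q x + D \<bullet> (y - x) - e * norm (y - x)) \<le> f y"
    using d1(1) d2(1) by (intro exI[of _ "min d1 d2"]) auto
qed

lemma lsc_eventually_greater:
  assumes "lsc f" "c < f x"
  shows "\<forall>\<^sub>F y in nhds x. c < f y"
proof -
  have "c < Liminf (at x) f"
    using assms unfolding lsc_def by (meson less_le_trans)
  then have "\<forall>\<^sub>F y in at x. c < f y"
    by (rule less_LiminfD)
  then show ?thesis
    using assms(2) by (auto simp: eventually_at_filter elim: eventually_mono)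
qed

text \<open>Lower bounds for the other summands and convergence of the sum bound one summand from
  above. This splits convergence of the values of a separable sum into convergence of the values in
  its blocks.\<close>

lemma tendsto_summands_of_tendsto_sum:
  fixes a :: "nat \<Rightarrow> 'i::finite \<Rightarrow> real"
  assumes sum: "(\<lambda>k. \<Sum>i\<in>UNIV. a k i) \<longlonglongrightarrow> (\<Sum>i\<in>UNIV. b i)"
    and lower: "\<And>i e. e > 0 \<Longrightarrow> \<forall>\<^sub>F k in sequentially. b i - e < a k i"
  shows "(\<lambda>k. a k i) \<longlonglongrightarrow> b i"
proof (rule tendstoI)
  fix e :: real assume "e > 0"
  define n where "n = real (CARD('i))"
  have n: "n \<ge> 1"
    unfolding n_def by (metis One_nat_def Suc_leI finite of_nat_1 of_nat_le_iff zero_less_card_finite)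
  \<comment> \<open>The sum may exceed its limit by \<open>r\<close>, and each of the other
    \<open>n - 1\<close> summands may fall short by \<open>r\<close>; together
    \<open>n * r < e\<close>.\<close>
  define r where "r = e / (2 * n)"
  have r: "r > 0" "n * r < e" "r < e"
    using \<open>e > 0\<close> n unfolding r_def by (auto simp: field_simps)
  have "\<forall>\<^sub>F k in sequentially. \<forall>j. b j - r < a k j"
    using lower[OF r(1)] by (simp add: eventually_all_finite)
  moreover have "\<forall>\<^sub>F k in sequentially. dist (\<Sum>i\<in>UNIV. a k i) (\<Sum>i\<in>UNIV. b i) < r"
    using sum r(1) by (rule tendstoD)
  ultimately show "\<forall>\<^sub>F k in sequentially. dist (a k i) (b i) < e"
  proof eventually_elim
    case (elim k)
    have "(\<Sum>j\<in>UNIV-{i}. b j - r) \<le> (\<Sum>j\<in>UNIV-{i}. a k j)"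
      using elim(1) by (intro sum_mono) (simp add: less_imp_le)
    then have "(\<Sum>j\<in>UNIV-{i}. b j) - (n - 1) * r \<le> (\<Sum>j\<in>UNIV-{i}. a k j)"
      using n by (simp add: sum_subtractf n_def card_Diff_singleton of_nat_diff)
    moreover have "(\<Sum>j\<in>UNIV. a k j) < (\<Sum>j\<in>UNIV. b j) + r"
      using elim(2) by (simp add: dist_real_def abs_less_iff)
    ultimately have "a k i < b i + n * r"
      using sum.remove[of UNIV i "a k"] sum.remove[of UNIV i b] by (simp add: algebra_simps)
    moreover have "b i - r < a k i"
      using elim(1) by blast
    ultimately show ?case
      using r by (simp add: dist_real_def abs_less_iff)
  qed
qed

section \<open>Separable sums\<close>

definition separable_sum :: "('k::finite \<Rightarrow> 'a \<Rightarrow> ereal) \<Rightarrow> 'a ^ 'k \<Rightarrow> ereal" where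
  "separable_sum f z = (\<Sum>i\<in>UNIV. f i (z $ i))"

lemma separable_sum_real:
  "(\<And>i. f i (z $ i) = ereal (a i)) \<Longrightarrow> separable_sum f z = ereal (\<Sum>i\<in>UNIV. a i)"
  unfolding separable_sum_def by simp

text \<open>Holds without excluding \<open>-\<infinity>\<close>: in \<open>ereal\<close> a sum with
  an infinite summand is infinite even when the signs are mixed.\<close>

lemma separable_sum_finite_iff:
  "\<bar>separable_sum f z\<bar> \<noteq> \<infinity> \<longleftrightarrow> (\<forall>i. \<bar>f i (z $ i)\<bar> \<noteq> \<infinity>)"
  unfolding separable_sum_def by (auto simp: sum_Inf)

lemma norm_axis: "norm (axis i y :: 'a::real_inner ^ 'k::finite) = norm y"
  by (simp add: norm_eq_sqrt_inner inner_axis)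

text \<open>Perturbing one block with the others fixed gives one inclusion; for the other, the block
  estimates are added, with the tolerance \<open>e\<close> divided by the number of blocks. If some
  block value is infinite, both sides are empty.\<close>

lemma regular_subdifferential_separable_sum:
  fixes f :: "'k::finite \<Rightarrow> 'a::euclidean_space \<Rightarrow> ereal"
  shows "regular_subdifferential (separable_sum f) z =
    {s. \<forall>i. s $ i \<in> regular_subdifferential (f i) (z $ i)}"
proof (cases "\<forall>i. \<bar>f i (z $ i)\<bar> \<noteq> \<infinity>")
  case False
  then obtain j where j: "\<bar>f j (z $ j)\<bar> = \<infinity>" by metis
  have "s \<notin> regular_subdifferential (separable_sum f) z" for s
    using False regular_subdifferential_finite[of s "separable_sum f" z]
    unfolding separable_sum_finite_iff by metis
  moreover have "s $ j \<notin> regular_subdifferential (f j) (z $ j)" for s :: "'a ^ 'k"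
    using j regular_subdifferential_finite[of "s $ j" "f j" "z $ j"] by auto
  ultimately show ?thesis by blast
next
  case True
  then have "\<forall>i. \<exists>a. f i (z $ i) = ereal a" by auto
  then obtain a where a: "\<And>i. f i (z $ i) = ereal (a i)" by metis
  note ra = separable_sum_real[of f, OF a]
  show ?thesis
  proof (intro set_eqI iffI CollectI allI)
    fix s i assume s: "s \<in> regular_subdifferential (separable_sum f) z"
    show "s $ i \<in> regular_subdifferential (f i) (z $ i)"
      unfolding regular_subdifferential_real_iff[of "f i", OF a]
    proof (intro allI impI)
      fix e :: real assume "e > 0"
      then obtain d where d: "d > 0" "\<And>y. dist y z < d \<Longrightarrow>
          ereal ((\<Sum>i\<in>UNIV. a i) + s \<bullet> (y - z) - e * norm (y - z)) \<le> separable_sum f y"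
        using s unfolding regular_subdifferential_real_iff[of "separable_sum f", OF ra] by blast
      have "ereal (a i + s $ i \<bullet> (y - z $ i) - e * norm (y - z $ i)) \<le> f i y"
        if y: "dist y (z $ i) < d" for y
      proof -
        define y' where "y' = z + axis i (y - z $ i)"
        have y': "y' - z = axis i (y - z $ i)" "y' $ i = y" "\<And>j. j \<noteq> i \<Longrightarrow> y' $ j = z $ j"
          by (auto simp: y'_def axis_def)
        have "separable_sum f y' = f i y + (\<Sum>j\<in>UNIV-{i}. f j (z $ j))"
          unfolding separable_sum_def by (subst sum.remove[of _ i]) (auto simp: y')
        also have "\<dots> = f i y + ereal (\<Sum>j\<in>UNIV-{i}. a j)"
          by (simp add: a)
        finally have eq: "separable_sum f y' = f i y + ereal (\<Sum>j\<in>UNIV-{i}. a j)" .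
        have "dist y' z < d"
          using y unfolding dist_norm y'(1) by (simp add: norm_axis dist_norm)
        from d(2)[OF this] have "ereal (a i + (\<Sum>j\<in>UNIV-{i}. a j) + s $ i \<bullet> (y - z $ i) -
            e * norm (y - z $ i)) \<le> f i y + ereal (\<Sum>j\<in>UNIV-{i}. a j)"
          unfolding eq y'(1) by (simp add: norm_axis inner_axis sum.remove[of UNIV i a])
        then show ?thesis
          by (cases "f i y") (auto simp: algebra_simps)
      qed
      then show "\<exists>d>0. \<forall>y. dist y (z $ i) < d \<longrightarrow>
          ereal (a i + s $ i \<bullet> (y - z $ i) - e * norm (y - z $ i)) \<le> f i y"
        using d(1) by blast
    qed
  next
    fix s assume "s \<in> {s. \<forall>i. s $ i \<in> regular_subdifferential (f i) (z $ i)}"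
    then have s: "s $ i \<in> regular_subdifferential (f i) (z $ i)" for i by blast
    show "s \<in> regular_subdifferential (separable_sum f) z"
      unfolding regular_subdifferential_real_iff[of "separable_sum f", OF ra]
    proof (intro allI impI)
      fix e :: real assume "e > 0"
      define e' where "e' = e / real CARD('k)"
      have "e' > 0" unfolding e'_def using \<open>e > 0\<close> by simp
      then have "\<forall>i. \<exists>d>0. \<forall>y. dist y (z $ i) < d \<longrightarrow>
          ereal (a i + s $ i \<bullet> (y - z $ i) - e' * norm (y - z $ i)) \<le> f i y"
        using s unfolding regular_subdifferential_real_iff[of "f _", OF a] by blast
      then obtain d where d: "\<And>i. d i > 0" "\<And>i y. dist y (z $ i) < d i \<Longrightarrow>
          ereal (a i + s $ i \<bullet> (y - z $ i) - e' * norm (y - z $ i)) \<le> f i y"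
        by metis
      define m where "m = Min (range d)"
      have m: "m > 0" "\<And>i. m \<le> d i"
        unfolding m_def using d(1) by auto
      have "ereal ((\<Sum>i\<in>UNIV. a i) + s \<bullet> (y - z) - e * norm (y - z)) \<le> separable_sum f y"
        if y: "dist y z < m" for y
      proof -
        have yi: "dist (y $ i) (z $ i) < d i" for i
          using y m(2)[of i] dist_vec_nth_le[of y i z] by linarith
        have "(\<Sum>i\<in>UNIV. e' * norm (y $ i - z $ i)) \<le> (\<Sum>i\<in>(UNIV::'k set). e' * norm (y - z))"
          using \<open>e' > 0\<close> Finite_Cartesian_Product.norm_nth_le[of "y - z"]
          by (intro sum_mono mult_left_mono) auto
        also have "\<dots> = e * norm (y - z)"
          by (simp add: e'_def)
        finally have "ereal ((\<Sum>i\<in>UNIV. a i) + s \<bullet> (y - z) - e * norm (y - z)) \<le>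
            (\<Sum>i\<in>UNIV. ereal (a i + s $ i \<bullet> (y $ i - z $ i) - e' * norm (y $ i - z $ i)))"
          by (simp add: sum.distrib sum_subtractf inner_vec_def)
        also have "\<dots> \<le> separable_sum f y"
          unfolding separable_sum_def using d(2)[OF yi] by (intro sum_mono)
        finally show ?thesis .
      qed
      then show "\<exists>d>0. \<forall>y. dist y z < d \<longrightarrow>
          ereal ((\<Sum>i\<in>UNIV. a i) + s \<bullet> (y - z) - e * norm (y - z)) \<le> separable_sum f y"
        using m(1) by blast
    qed
  qed
qed

lemma tendsto_of_tendsto_separable_sum:
  fixes f :: "'k::finite \<Rightarrow> 'a::euclidean_space \<Rightarrow> ereal"
  assumes lsc: "\<And>i. lsc (f i)" and X: "X \<longlonglongrightarrow> z"
    and h: "(\<lambda>k. separable_sum f (X k)) \<longlonglongrightarrow> separable_sum f z"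
    and finz: "\<bar>separable_sum f z\<bar> \<noteq> \<infinity>" and fin: "\<And>k. \<bar>separable_sum f (X k)\<bar> \<noteq> \<infinity>"
  shows "(\<lambda>k. f i (X k $ i)) \<longlonglongrightarrow> f i (z $ i)"
proof -
  define a where "a = (\<lambda>k i. real_of_ereal (f i (X k $ i)))"
  define b where "b = (\<lambda>i. real_of_ereal (f i (z $ i)))"
  have a: "f i (X k $ i) = ereal (a k i)" for k i
    using fin[of k] unfolding separable_sum_finite_iff a_def by (simp add: ereal_real')
  have b: "f i (z $ i) = ereal (b i)" for i
    using finz unfolding separable_sum_finite_iff b_def by (simp add: ereal_real')
  have "(\<lambda>k. a k i) \<longlonglongrightarrow> b i"
  proof (rule tendsto_summands_of_tendsto_sum)
    show "(\<lambda>k. \<Sum>i\<in>UNIV. a k i) \<longlonglongrightarrow> (\<Sum>i\<in>UNIV. b i)"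
      using h unfolding separable_sum_real[of f, OF a] separable_sum_real[of f, OF b] by simp
    fix i and e :: real assume "e > 0"
    then have "\<forall>\<^sub>F y in nhds (z $ i). ereal (b i - e) < f i y"
      using lsc b by (intro lsc_eventually_greater) auto
    moreover have "(\<lambda>k. X k $ i) \<longlonglongrightarrow> z $ i"
      using X by (rule tendsto_vec_nth)
    ultimately have "\<forall>\<^sub>F k in sequentially. ereal (b i - e) < f i (X k $ i)"
      unfolding filterlim_iff by blast
    then show "\<forall>\<^sub>F k in sequentially. b i - e < a k i"
      by (simp add: a)
  qed
  then show ?thesis by (simp add: a b)
qed

text \<open>Limiting subgradients require convergence of function values. That of the sum passes to
  every block because lower semicontinuity bounds all blocks from below; in the other direction the
  block sequences are stacked index by index.\<close>

lemma subdifferential_separable_sum: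
  fixes f :: "'k::finite \<Rightarrow> 'a::euclidean_space \<Rightarrow> ereal"
  assumes lsc: "\<And>i. lsc (f i)"
  shows "subdifferential (separable_sum f) z = {s. \<forall>i. s $ i \<in> subdifferential (f i) (z $ i)}"
proof (intro set_eqI iffI CollectI allI)
  fix s i assume "s \<in> subdifferential (separable_sum f) z"
  then obtain X W where fin: "\<bar>separable_sum f z\<bar> \<noteq> \<infinity>"
    and W: "\<And>k::nat. W k \<in> regular_subdifferential (separable_sum f) (X k)"
    and X: "X \<longlonglongrightarrow> z" and h: "(\<lambda>k. separable_sum f (X k)) \<longlonglongrightarrow> separable_sum f z" and s: "W \<longlonglongrightarrow> s"
    unfolding subdifferential_def mem_Collect_eq by metis
  have "(\<lambda>k. f i (X k $ i)) \<longlonglongrightarrow> f i (z $ i)"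
    using regular_subdifferential_finite[OF W]
    by (rule tendsto_of_tendsto_separable_sum[OF lsc X h fin])
  moreover have "W k $ i \<in> regular_subdifferential (f i) (X k $ i)" for k
    using W[of k] unfolding regular_subdifferential_separable_sum by blast
  ultimately show "s $ i \<in> subdifferential (f i) (z $ i)"
    using fin X s unfolding subdifferential_def separable_sum_finite_iff
    by (intro CollectI conjI exI[of _ "\<lambda>k. X k $ i"] exI[of _ "\<lambda>k. W k $ i"])
      (auto intro: tendsto_vec_nth)
next
  fix s assume "s \<in> {s. \<forall>i. s $ i \<in> subdifferential (f i) (z $ i)}"
  then have "\<forall>i. \<bar>f i (z $ i)\<bar> \<noteq> \<infinity> \<and>
       (\<exists>X W. (\<forall>k::nat. W k \<in> regular_subdifferential (f i) (X k)) \<and>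
         X \<longlonglongrightarrow> z $ i \<and> (\<lambda>k. f i (X k)) \<longlonglongrightarrow> f i (z $ i) \<and> W \<longlonglongrightarrow> s $ i)"
    by (simp add: subdifferential_def)
  then obtain X W where fin: "\<And>i. \<bar>f i (z $ i)\<bar> \<noteq> \<infinity>"
    and W: "\<And>i k::nat. W i k \<in> regular_subdifferential (f i) (X i k)"
    and X: "\<And>i. X i \<longlonglongrightarrow> z $ i" and h: "\<And>i. (\<lambda>k. f i (X i k)) \<longlonglongrightarrow> f i (z $ i)"
    and s: "\<And>i. W i \<longlonglongrightarrow> s $ i"
    by metis
  define X' where "X' = (\<lambda>k. \<chi> i. X i k)"
  define W' where "W' = (\<lambda>k. \<chi> i. W i k)"
  define a where "a = (\<lambda>k i. real_of_ereal (f i (X i k)))"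
  define b where "b = (\<lambda>i. real_of_ereal (f i (z $ i)))"
  have a: "f i (X' k $ i) = ereal (a k i)" for k i
    using regular_subdifferential_finite[OF W[of i k]] unfolding a_def X'_def
    by (simp add: ereal_real')
  have b: "f i (z $ i) = ereal (b i)" for i
    using fin[of i] unfolding b_def by (simp add: ereal_real')
  have "(\<lambda>k. a k i) \<longlonglongrightarrow> b i" for i
    using h[of i] a[of i] by (simp add: X'_def b)
  then have "(\<lambda>k. separable_sum f (X' k)) \<longlonglongrightarrow> separable_sum f z"
    unfolding separable_sum_real[of f, OF a] separable_sum_real[of f, OF b]
    by (auto intro: tendsto_sum)
  moreover have "X' \<longlonglongrightarrow> z"
    unfolding X'_def by (rule vec_tendstoI) (simp add: X)
  moreover have "W' \<longlonglongrightarrow> s"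
    unfolding W'_def by (rule vec_tendstoI) (simp add: s)
  moreover have "W' k \<in> regular_subdifferential (separable_sum f) (X' k)" for k
    unfolding regular_subdifferential_separable_sum using W by (simp add: W'_def X'_def)
  ultimately show "s \<in> subdifferential (separable_sum f) z"
    unfolding subdifferential_def mem_Collect_eq separable_sum_finite_iff using fin
    by (intro conjI exI[of _ X'] exI[of _ W'] allI)
qed

text \<open>The level \<open>c\<close> is distributed over the blocks: real numbers
  \<open>b i\<close> below the block values whose sum still exceeds \<open>c\<close>. Once they are
  found, each of the finitely many inequalities persists nearby.\<close>

lemma lsc_separable_sum:
  fixes f :: "'k::finite \<Rightarrow> 'a::euclidean_space \<Rightarrow> ereal"
  assumes lsc: "\<And>i. lsc (f i)" and fin: "\<And>i y. f i y \<noteq> -\<infinity>"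
  shows "lsc (separable_sum f)"
  unfolding lsc_def le_Liminf_iff
proof (intro allI impI)
  fix z and c :: ereal assume c: "c < separable_sum f z"
  have "\<exists>b. (\<forall>i. ereal (b i) < f i (z $ i)) \<and> c < ereal (\<Sum>i\<in>UNIV. b i)"
  proof (cases "\<forall>i. \<bar>f i (z $ i)\<bar> \<noteq> \<infinity>")
    case True
    then have "\<forall>i. \<exists>a. f i (z $ i) = ereal a" by auto
    then obtain a where a: "\<And>i. f i (z $ i) = ereal (a i)" by metis
    obtain r where r: "c < ereal r" "r < (\<Sum>i\<in>UNIV. a i)"
      using c ereal_dense2[of c "ereal (sum a UNIV)"] unfolding separable_sum_real[of f, OF a]
      by (auto simp: less_ereal.simps)
    define e where "e = ((\<Sum>i\<in>UNIV. a i) - r) / real CARD('k)"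
    have "e > 0" unfolding e_def using r(2) by simp
    moreover have "(\<Sum>i\<in>UNIV. a i - e) = r"
      by (simp add: sum_subtractf e_def)
    ultimately show ?thesis
      using r(1) by (intro exI[of _ "\<lambda>i. a i - e"]) (simp add: a)
  next
    case False
    then obtain j where j: "f j (z $ j) = \<infinity>"
      using fin by (metis ereal_infinity_cases)
    have "\<forall>i. \<exists>b. ereal b < f i (z $ i)"
      using fin by (metis MInfty_neq_ereal(1) ereal_dense2 less_ereal.simps(6) linorder_less_linear
          order_less_imp_not_less not_less_iff_gr_or_eq ereal_less_eq(2) order_le_less)
    then obtain b where b: "\<And>i. ereal (b i) < f i (z $ i)" by metis
    have "c \<noteq> \<infinity>" using c by auto
    then obtain C where C: "c < ereal C"
      by (metis ereal_dense2 ereal_infty_less(1))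
    \<comment> \<open>An infinite block lies above every real number, so it can take whatever the
      other blocks leave missing from \<open>C\<close>.\<close>
    define b' where "b' = b(j := C - (\<Sum>i\<in>UNIV-{j}. b i))"
    have "(\<Sum>i\<in>UNIV. b' i) = C"
      by (subst sum.remove[of _ j]) (auto simp: b'_def)
    then show ?thesis
      using b j C by (intro exI[of _ b']) (auto simp: b'_def)
  qed
  then obtain b where b: "\<And>i. ereal (b i) < f i (z $ i)" "c < ereal (\<Sum>i\<in>UNIV. b i)" by blast
  have "\<forall>\<^sub>F y in at z. ereal (b i) < f i (y $ i)" for i
  proof -
    have "\<forall>\<^sub>F y in nhds (z $ i). ereal (b i) < f i y"
      using lsc b(1) by (rule lsc_eventually_greater)
    moreover have "((\<lambda>y. y $ i) \<longlongrightarrow> z $ i) (at z)"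
      by (intro tendsto_vec_nth tendsto_ident_at)
    ultimately show ?thesis
      unfolding filterlim_iff by blast
  qed
  then have "\<forall>\<^sub>F y in at z. \<forall>i. ereal (b i) < f i (y $ i)"
    by (simp add: eventually_all_finite)
  then show "\<forall>\<^sub>F y in at z. c < separable_sum f y"
  proof eventually_elim
    case (elim y)
    note b(2)
    also have "ereal (\<Sum>i\<in>UNIV. b i) = (\<Sum>i\<in>UNIV. ereal (b i))"
      by simp
    also have "\<dots> \<le> separable_sum f y"
      unfolding separable_sum_def using elim by (intro sum_mono) (simp add: less_imp_le)
    finally show ?case .
  qed
qed

section \<open>Clarke regularity\<close>

lemma regular_normal_cone_iff:
  "w \<in> regular_normal_cone S x \<longleftrightarrow> x \<in> S \<and>
    (\<forall>e>0. \<exists>d>0. \<forall>y\<in>S. dist y x < d \<longrightarrow> w \<bullet> (y - x) \<le> e * norm (y - x))"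
proof -
  have "(\<forall>y\<in>S. y \<noteq> x \<and> dist y x < d \<longrightarrow> w \<bullet> (y - x) \<le> e * norm (y - x)) \<longleftrightarrow>
      (\<forall>y\<in>S. dist y x < d \<longrightarrow> w \<bullet> (y - x) \<le> e * norm (y - x))" for d e
    by auto
  then show ?thesis
    by (simp add: regular_normal_cone_def eventually_at)
qed

lemma regular_normal_cone_subset: "regular_normal_cone S x \<subseteq> normal_cone S x"
proof
  fix w assume w: "w \<in> regular_normal_cone S x"
  then have "x \<in> S" by (simp add: regular_normal_cone_def)
  then show "w \<in> normal_cone S x"
    unfolding normal_cone_def mem_Collect_eq
    using w by (intro conjI exI[of _ "\<lambda>_. x"] exI[of _ "\<lambda>_. w"]) auto
qed

lemma regular_normal_cone_add:
  assumes "p \<in> regular_normal_cone S x" "q \<in> regular_normal_cone S x"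
  shows "p + q \<in> regular_normal_cone S x"
  unfolding regular_normal_cone_iff
proof (intro conjI allI impI)
  show "x \<in> S" using assms(1) regular_normal_cone_iff by blast
  fix e :: real assume "e > 0"
  then have e2: "e / 2 > 0" by simp
  obtain d1 where d1: "d1 > 0"
      "\<And>y. y \<in> S \<Longrightarrow> dist y x < d1 \<Longrightarrow> p \<bullet> (y - x) \<le> e / 2 * norm (y - x)"
    using assms(1) e2 unfolding regular_normal_cone_iff by meson
  obtain d2 where d2: "d2 > 0"
      "\<And>y. y \<in> S \<Longrightarrow> dist y x < d2 \<Longrightarrow> q \<bullet> (y - x) \<le> e / 2 * norm (y - x)"
    using assms(2) e2 unfolding regular_normal_cone_iff by meson
  have "(p + q) \<bullet> (y - x) \<le> e * norm (y - x)" if "y \<in> S" "dist y x < min d1 d2" for y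
    using d1(2)[OF that(1)] d2(2)[OF that(1)] that(2) by (simp add: inner_add_left)
  then show "\<exists>d>0. \<forall>y\<in>S. dist y x < d \<longrightarrow> (p + q) \<bullet> (y - x) \<le> e * norm (y - x)"
    using d1(1) d2(1) by (intro exI[of _ "min d1 d2"]) auto
qed

lemma regular_normal_cone_scaleR:
  assumes p: "p \<in> regular_normal_cone S x" and t: "t \<ge> 0"
  shows "t *\<^sub>R p \<in> regular_normal_cone S x"
  unfolding regular_normal_cone_iff
proof (intro conjI allI impI)
  show "x \<in> S" using assms(1) regular_normal_cone_iff by blast
  fix e :: real assume "e > 0"
  \<comment> \<open>\<open>t + 1\<close> instead of \<open>t\<close> also covers
    \<open>t = 0\<close>.\<close>
  then have "e / (t + 1) > 0" using t by simp
  then obtain d where d: "d > 0"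
      "\<And>y. y \<in> S \<Longrightarrow> dist y x < d \<Longrightarrow> p \<bullet> (y - x) \<le> e / (t + 1) * norm (y - x)"
    using p unfolding regular_normal_cone_iff by meson
  have "(t *\<^sub>R p) \<bullet> (y - x) \<le> e * norm (y - x)" if "y \<in> S" "dist y x < d" for y
  proof -
    have "(t *\<^sub>R p) \<bullet> (y - x) \<le> t * (e / (t + 1) * norm (y - x))"
      using mult_left_mono[OF d(2)[OF that] t] by simp
    also have "\<dots> = (t / (t + 1)) * (e * norm (y - x))" by simp
    also have "\<dots> \<le> 1 * (e * norm (y - x))"
      using t \<open>e > 0\<close> by (intro mult_right_mono) auto
    finally show ?thesis by simp
  qed
  then show "\<exists>d>0. \<forall>y\<in>S. dist y x < d \<longrightarrow> (t *\<^sub>R p) \<bullet> (y - x) \<le> e * norm (y - x)"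
    using d(1) by blast
qed

text \<open>Raising a point of the epigraph only decreases its product with \<open>(w, -1)\<close>,
  so the estimate on the graph decides. Conversely, a violation at \<open>y\<close> makes
  \<open>(y, c)\<close>, with \<open>c\<close> the violated bound, a point of the epigraph at a
  distance of order \<open>norm (y - x)\<close>.\<close>

lemma regular_subdifferential_iff_epi:
  assumes a: "f x = ereal a"
  shows "w \<in> regular_subdifferential f x \<longleftrightarrow> (w, -1) \<in> regular_normal_cone (epi f) (x, a)"
proof
  assume w: "w \<in> regular_subdifferential f x"
  show "(w, -1) \<in> regular_normal_cone (epi f) (x, a)"
    unfolding regular_normal_cone_iff
  proof (intro conjI allI impI)
    show "(x, a) \<in> epi f" by (simp add: epi_def a)
    fix e :: real assume "e > 0"
    then obtain d where d: "d > 0"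
        "\<And>y. dist y x < d \<Longrightarrow> ereal (a + w \<bullet> (y - x) - e * norm (y - x)) \<le> f y"
      using w unfolding regular_subdifferential_real_iff[of f, OF a] by blast
    have "(w, -1) \<bullet> (p - (x, a)) \<le> e * norm (p - (x, a))"
      if p: "p \<in> epi f" "dist p (x, a) < d" for p
    proof -
      have "dist (fst p) x < d"
        using p(2) dist_fst_le[of p "(x, a)"] by simp
      note d(2)[OF this]
      also have "f (fst p) \<le> ereal (snd p)"
        using p(1) by (auto simp: epi_def)
      finally have "a + w \<bullet> (fst p - x) - e * norm (fst p - x) \<le> snd p"
        by simp
      moreover have "e * norm (fst p - x) \<le> e * norm (p - (x, a))"
        using \<open>e > 0\<close> norm_fst_le[of "fst p - x" "snd p - a"]
        by (intro mult_left_mono) (auto simp: minus_prod_def)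
      ultimately show ?thesis
        by (simp add: inner_prod_def)
    qed
    then show "\<exists>d>0. \<forall>p\<in>epi f. dist p (x, a) < d \<longrightarrow> (w, -1) \<bullet> (p - (x, a)) \<le> e * norm (p - (x, a))"
      using d(1) by blast
  qed
next
  assume w: "(w, -1) \<in> regular_normal_cone (epi f) (x, a)"
  show "w \<in> regular_subdifferential f x"
    unfolding regular_subdifferential_real_iff[of f, OF a]
  proof (intro allI impI)
    fix e :: real assume e: "e > 0"
    \<comment> \<open>The distance of \<open>(y, c)\<close> from \<open>(x, a)\<close> is at most
      \<open>C * norm (y - x)\<close>; the tolerance \<open>e / (2 * C)\<close> then leaves
      \<open>e / 2\<close>, half of what a violation demands.\<close>
    define C where "C = 1 + norm w + e"
    have C: "C > 0" unfolding C_def using e by (simp add: add_pos_nonneg add.commute)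
    have "e / (2 * C) > 0" using e C by simp
    then obtain d where d: "d > 0" "\<And>p. p \<in> epi f \<Longrightarrow> dist p (x, a) < d \<Longrightarrow>
        (w, -1) \<bullet> (p - (x, a)) \<le> e / (2 * C) * norm (p - (x, a))"
      using w unfolding regular_normal_cone_iff by meson
    have "ereal (a + w \<bullet> (y - x) - e * norm (y - x)) \<le> f y" if y: "dist y x < d / C" for y
    proof (rule ccontr)
      define c where "c = a + w \<bullet> (y - x) - e * norm (y - x)"
      assume "\<not> ereal (a + w \<bullet> (y - x) - e * norm (y - x)) \<le> f y"
      then have lt: "f y < ereal c" by (simp add: c_def)
      then have ne: "y \<noteq> x" by (auto simp: c_def a)
      have "\<bar>c - a\<bar> \<le> \<bar>w \<bullet> (y - x)\<bar> + e * norm (y - x)"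
        unfolding c_def using mult_nonneg_nonneg[of e "norm (y - x)"] e
        by (smt (verit) norm_ge_zero)
      also have "\<dots> \<le> norm w * norm (y - x) + e * norm (y - x)"
        by (simp add: Cauchy_Schwarz_ineq2)
      finally have "norm ((y, c) - (x, a)) \<le> norm (y - x) + (norm w * norm (y - x) + e * norm (y - x))"
        using norm_Pair_le[of "y - x" "c - a"] by simp
      also have "\<dots> = C * norm (y - x)"
        by (simp add: C_def algebra_simps)
      finally have n: "norm ((y, c) - (x, a)) \<le> C * norm (y - x)" .
      also have "\<dots> < d"
        using y C by (simp add: dist_norm field_simps)
      finally have "(w, -1) \<bullet> ((y, c) - (x, a)) \<le> e / (2 * C) * norm ((y, c) - (x, a))"
        using lt by (intro d(2)) (auto simp: epi_def dist_norm)
      also have "\<dots> \<le> e / (2 * C) * (C * norm (y - x))"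
        using n C e by (intro mult_left_mono) auto
      finally have "e * norm (y - x) \<le> e / 2 * norm (y - x)"
        using C by (simp add: c_def inner_prod_def)
      then show False using e ne by simp
    qed
    then show "\<exists>d>0. \<forall>y. dist y x < d \<longrightarrow> ereal (a + w \<bullet> (y - x) - e * norm (y - x)) \<le> f y"
      using d(1) C by (intro exI[of _ "d / C"]) auto
  qed
qed

text \<open>The factors \<open>t k\<close> may tend to 0 and thus admit unbounded \<open>W\<close>:
  constant factors 1 give limiting subgradients, and \<open>\<tau> = 0\<close> gives horizon
  subgradients.\<close>

lemma normal_cone_epi_limit:
  assumes W: "\<And>k. W k \<in> regular_subdifferential f (X k)"
    and X: "X \<longlonglongrightarrow> x" "(\<lambda>k. f (X k)) \<longlonglongrightarrow> f x" and fin: "\<bar>f x\<bar> \<noteq> \<infinity>"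
    and t: "\<And>k::nat. t k \<ge> 0" "t \<longlonglongrightarrow> \<tau>" "(\<lambda>k. t k *\<^sub>R W k) \<longlonglongrightarrow> w"
  shows "(w, - \<tau>) \<in> normal_cone (epi f) (x, real_of_ereal (f x))"
proof -
  define a where "a = (\<lambda>k. real_of_ereal (f (X k)))"
  have a: "f (X k) = ereal (a k)" for k
    using regular_subdifferential_finite[OF W[of k]] by (simp add: a_def ereal_real')
  have fx: "f x = ereal (real_of_ereal (f x))"
    using fin by (simp add: ereal_real')
  have "(\<lambda>k. ereal (a k)) \<longlonglongrightarrow> ereal (real_of_ereal (f x))"
    using X(2) fx by (simp add: a)
  then have "(\<lambda>k. (X k, a k)) \<longlonglongrightarrow> (x, real_of_ereal (f x))"
    using X(1) by (auto intro: tendsto_Pair)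
  moreover have "(\<lambda>k. (t k *\<^sub>R W k, - t k)) \<longlonglongrightarrow> (w, - \<tau>)"
    using t by (auto intro: tendsto_Pair tendsto_minus)
  moreover have "(t k *\<^sub>R W k, - t k) \<in> regular_normal_cone (epi f) (X k, a k)" for k
    using regular_normal_cone_scaleR[OF _ t(1)[of k]] W[of k]
    unfolding regular_subdifferential_iff_epi[of f, OF a] by fastforce
  moreover have "(x, real_of_ereal (f x)) \<in> epi f"
    using fx by (simp add: epi_def)
  ultimately show ?thesis
    unfolding normal_cone_def mem_Collect_eq
    by (intro conjI exI[of _ "\<lambda>k. (X k, a k)"] exI[of _ "\<lambda>k. (t k *\<^sub>R W k, - t k)"] allI)
qed

lemma clarke_regular_subdifferential:
  assumes "clarke_regular f x"
  shows "subdifferential f x = regular_subdifferential f x"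
proof (rule antisym[OF _ regular_subdifferential_subset], rule subsetI)
  have fin: "\<bar>f x\<bar> \<noteq> \<infinity>" and
    eq: "regular_normal_cone (epi f) (x, real_of_ereal (f x)) = normal_cone (epi f) (x, real_of_ereal (f x))"
    using assms by (auto simp: clarke_regular_def)
  have fx: "f x = ereal (real_of_ereal (f x))"
    using fin by (simp add: ereal_real')
  fix w assume "w \<in> subdifferential f x"
  then obtain X W where XW: "\<And>k::nat. W k \<in> regular_subdifferential f (X k)"
     "X \<longlonglongrightarrow> x" "(\<lambda>k. f (X k)) \<longlonglongrightarrow> f x" "W \<longlonglongrightarrow> w"
    unfolding subdifferential_def by blast
  have "(w, - 1) \<in> normal_cone (epi f) (x, real_of_ereal (f x))"
    using XW fin by (intro normal_cone_epi_limit[where X = X and W = W and t = "\<lambda>_. 1"]) auto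
  then show "w \<in> regular_subdifferential f x"
    unfolding regular_subdifferential_iff_epi[of f, OF fx] eq .
qed

text \<open>Limits of \<open>t k *\<^sub>R W k\<close> with \<open>t k \<rightarrow> 0\<close> are horizon subgradients; under Clarke regularity
  they are directions of recession of the subdifferential.\<close>

lemma clarke_regular_horizon:
  assumes cr: "clarke_regular f x"
    and W: "\<And>k. W k \<in> regular_subdifferential f (X k)"
    and X: "X \<longlonglongrightarrow> x" "(\<lambda>k. f (X k)) \<longlonglongrightarrow> f x"
    and t: "\<And>k::nat. t k \<ge> 0" "t \<longlonglongrightarrow> 0" "(\<lambda>k. t k *\<^sub>R W k) \<longlonglongrightarrow> w"
    and g: "g \<in> subdifferential f x"
  shows "g + w \<in> subdifferential f x"
proof -
  let ?p = "(x, real_of_ereal (f x))"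
  have fin: "\<bar>f x\<bar> \<noteq> \<infinity>" and eq: "regular_normal_cone (epi f) ?p = normal_cone (epi f) ?p"
    using cr by (auto simp: clarke_regular_def)
  have fx: "f x = ereal (real_of_ereal (f x))"
    using fin by (simp add: ereal_real')
  have "(w, - 0) \<in> regular_normal_cone (epi f) ?p"
    unfolding eq using W X fin t by (rule normal_cone_epi_limit)
  moreover have "(g, -1) \<in> regular_normal_cone (epi f) ?p"
    using g unfolding clarke_regular_subdifferential[OF cr] regular_subdifferential_iff_epi[of f, OF fx] .
  \<comment> \<open>A horizontal normal leaves the last coordinate at -1, so the sum can be read as
    a subgradient again.\<close>
  ultimately have "(g, -1) + (w, - 0) \<in> regular_normal_cone (epi f) ?p"
    by (intro regular_normal_cone_add)
  then show ?thesis
    unfolding clarke_regular_subdifferential[OF cr] regular_subdifferential_iff_epi[of f, OF fx] by simp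
qed

text \<open>Divides a tolerance by the norm \<open>n\<close> of a vector; the added 1 admits the
  zero vector.\<close>

lemma divide_add_one_mult_le:
  fixes e n :: real
  assumes "e > 0" "n \<ge> 0"
  shows "e / (n + 1) > 0" "e / (n + 1) * n \<le> e"
  using assms by (auto simp: divide_simps algebra_simps)

section \<open>The U- and V-space of a convex subdifferential\<close>

text \<open>In a convex set a regular normal obeys the global inequality
  \<open>p \<bullet> (c - y) \<le> 0\<close>, because short steps from \<open>y\<close> towards
  \<open>c\<close> stay in the set, and this inequality survives limits. At a relative interior
  point every segment from \<open>c\<close> extends beyond \<open>g\<close>, which gives the reverse
  inequality.\<close>

lemma normal_cone_convex_rel_interior:
  fixes C :: "'a::euclidean_space set"
  assumes C: "convex C" and g: "g \<in> rel_interior C"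
  shows "normal_cone C g = {w. \<forall>a\<in>C. \<forall>b\<in>C. w \<bullet> (a - b) = 0}"
proof (intro set_eqI iffI)
  fix w assume "w \<in> normal_cone C g"
  then obtain X W where W: "\<And>k::nat. W k \<in> regular_normal_cone C (X k)"
    and lim: "X \<longlonglongrightarrow> g" "W \<longlonglongrightarrow> w"
    unfolding normal_cone_def by blast
  have le: "p \<bullet> (c - y) \<le> 0" if p: "p \<in> regular_normal_cone C y" and c: "c \<in> C" for p y c
  proof (rule field_le_epsilon)
    fix e :: real assume "e > 0"
    define e' where "e' = e / (norm (c - y) + 1)"
    have e': "e' > 0" "e' * norm (c - y) \<le> e"
      unfolding e'_def by (rule divide_add_one_mult_le[OF \<open>e > 0\<close> norm_ge_zero])+
    have y: "y \<in> C" using p regular_normal_cone_iff by blast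
    obtain d where d: "d > 0" "\<And>z. z \<in> C \<Longrightarrow> dist z y < d \<Longrightarrow> p \<bullet> (z - y) \<le> e' * norm (z - y)"
      using p e'(1) unfolding regular_normal_cone_iff by meson
    define n where "n = norm (c - y)"
    define t where "t = min 1 (d / 2 / (n + 1))"
    have t: "0 < t" "t \<le> 1" "t * norm (c - y) < d"
    proof -
      have n: "n \<ge> 0" and d2: "d / 2 > 0" using d(1) by (auto simp: n_def)
      note * = divide_add_one_mult_le[OF d2 n]
      show "0 < t" "t \<le> 1" using *(1) by (auto simp: t_def)
      have "t * norm (c - y) \<le> d / 2 / (n + 1) * n"
        unfolding n_def[symmetric] using n by (intro mult_right_mono) (auto simp: t_def)
      also have "\<dots> < d"
        using *(2) d(1) by linarith
      finally show "t * norm (c - y) < d" .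
    qed
    have "y + t *\<^sub>R (c - y) = (1 - t) *\<^sub>R y + t *\<^sub>R c"
      by (simp add: algebra_simps)
    also have "\<dots> \<in> C"
      using C y c t by (intro convexD) auto
    finally have "p \<bullet> (t *\<^sub>R (c - y)) \<le> e' * norm (t *\<^sub>R (c - y))"
      using d(2)[of "y + t *\<^sub>R (c - y)"] t by (simp add: dist_norm)
    then have "t * (p \<bullet> (c - y)) \<le> t * (e' * norm (c - y))"
      using t by (simp add: mult_ac)
    then show "p \<bullet> (c - y) \<le> 0 + e"
      using t(1) e'(2) by simp
  qed
  have w: "w \<bullet> (c - g) \<le> 0" if "c \<in> C" for c
  proof (rule LIMSEQ_le_const2)
    show "(\<lambda>k. W k \<bullet> (c - X k)) \<longlonglongrightarrow> w \<bullet> (c - g)"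
      using lim by (intro tendsto_intros)
    show "\<exists>N. \<forall>n\<ge>N. W n \<bullet> (c - X n) \<le> 0"
      using le[OF W that] by blast
  qed
  have "w \<bullet> (c - g) = 0" if c: "c \<in> C" for c
  proof -
    obtain e where e: "e > 1" "(1 - e) *\<^sub>R c + e *\<^sub>R g \<in> C"
      using g c convex_rel_interior_iff[OF C] by blast
    have "(1 - e) *\<^sub>R c + e *\<^sub>R g - g = (1 - e) *\<^sub>R (c - g)"
      by (simp add: algebra_simps)
    then have "(1 - e) * (w \<bullet> (c - g)) \<le> 0"
      using w[OF e(2)] by simp
    then have "w \<bullet> (c - g) \<ge> 0"
      using e(1) by (simp add: mult_le_0_iff)
    then show ?thesis using w[OF c] by simp
  qed
  then have "w \<bullet> a = w \<bullet> g" if "a \<in> C" for a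
    using that by (simp add: inner_diff_right)
  then show "w \<in> {w. \<forall>a\<in>C. \<forall>b\<in>C. w \<bullet> (a - b) = 0}"
    by (simp add: inner_diff_right)
next
  fix w assume "w \<in> {w. \<forall>a\<in>C. \<forall>b\<in>C. w \<bullet> (a - b) = 0}"
  then have "w \<in> regular_normal_cone C g"
    using g rel_interior_subset[of C] unfolding regular_normal_cone_iff
    by (auto intro!: exI[of _ 1])
  then show "w \<in> normal_cone C g"
    using regular_normal_cone_subset by blast
qed

lemma ri_subgradient_in:
  assumes "convex (subdifferential f x)" "subdifferential f x \<noteq> {}"
  shows "ri_subgradient f x \<in> rel_interior (subdifferential f x)"
  unfolding ri_subgradient_def
  using rel_interior_eq_empty[OF assms(1)] assms(2) by (meson ex_in_conv someI_ex)

text \<open>Eliminates the choice made in \<open>ri_subgradient\<close>: this description depends on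
  the subdifferential alone.\<close>

lemma U_space_eq:
  assumes "convex (subdifferential f x)" "subdifferential f x \<noteq> {}"
  shows "U_space f x = {w. \<forall>a\<in>subdifferential f x. \<forall>b\<in>subdifferential f x. w \<bullet> (a - b) = 0}"
  unfolding U_space_def
  by (rule normal_cone_convex_rel_interior[OF assms(1) ri_subgradient_in[OF assms]])

lemma subspace_U_space:
  assumes "convex (subdifferential f x)" "subdifferential f x \<noteq> {}"
  shows "subspace (U_space f x)"
  unfolding U_space_eq[OF assms] subspace_def by (auto simp: inner_add_left)

lemma subspace_V_space: "subspace (V_space f x)"
  unfolding V_space_def by (rule subspace_span)

lemma orthogonal_comp_V_space:
  assumes "convex (subdifferential f x)" "subdifferential f x \<noteq> {}"
  shows "U_space f x = (V_space f x)\<^sup>\<bottom>"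
proof (intro set_eqI iffI)
  let ?C = "subdifferential f x" and ?g = "ri_subgradient f x"
  have g: "?g \<in> ?C"
    using ri_subgradient_in[OF assms] rel_interior_subset by blast
  fix w
  show "w \<in> (V_space f x)\<^sup>\<bottom>" if "w \<in> U_space f x"
  proof -
    have "(\<lambda>g. g - ?g) ` ?C \<subseteq> {p. w \<bullet> p = 0}"
      using that g unfolding U_space_eq[OF assms] by auto
    then have "V_space f x \<subseteq> {p. w \<bullet> p = 0}"
      unfolding V_space_def by (rule span_minimal) (rule subspace_hyperplane)
    then show ?thesis
      by (auto simp: orthogonal_comp_def orthogonal_def inner_commute)
  qed
  show "w \<in> U_space f x" if w: "w \<in> (V_space f x)\<^sup>\<bottom>"
  proof -
    have "w \<bullet> (a - ?g) = 0" if "a \<in> ?C" for a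
    proof -
      have "a - ?g \<in> V_space f x"
        unfolding V_space_def using that by (intro span_base) auto
      then show ?thesis
        using w by (auto simp: orthogonal_comp_def orthogonal_def inner_commute)
    qed
    then have "w \<bullet> a = w \<bullet> ?g" if "a \<in> ?C" for a
      using that by (simp add: inner_diff_right)
    then show ?thesis
      unfolding U_space_eq[OF assms] by (simp add: inner_diff_right)
  qed
qed

lemma V_space_eq:
  assumes "convex (subdifferential f x)" "subdifferential f x \<noteq> {}"
  shows "V_space f x = {p. \<forall>u\<in>U_space f x. p \<bullet> u = 0}"
proof -
  have "V_space f x = (U_space f x)\<^sup>\<bottom>"
    unfolding orthogonal_comp_V_space[OF assms] by (simp add: orthogonal_comp_self subspace_V_space)
  then show ?thesis
    by (auto simp: orthogonal_comp_def orthogonal_def inner_commute)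
qed

lemma diff_in_V_space:
  assumes "convex (subdifferential f x)" "a \<in> subdifferential f x" "b \<in> subdifferential f x"
  shows "a - b \<in> V_space f x"
proof -
  have ne: "subdifferential f x \<noteq> {}" using assms(2) by blast
  then show ?thesis
    unfolding V_space_eq[OF assms(1) ne] U_space_eq[OF assms(1) ne] using assms(2,3)
    by (auto simp: inner_commute)
qed

lemma diff_closest_point_in_V_space:
  assumes "convex (subdifferential f x)" "subdifferential f x \<noteq> {}"
  shows "y - closest_point (U_space f x) y \<in> V_space f x"
  unfolding V_space_eq[OF assms] using closest_point_orthogonal[OF subspace_U_space[OF assms]] by blast

lemma inner_U_space_eq:
  assumes "convex (subdifferential f x)" "u \<in> U_space f x"
    "a \<in> subdifferential f x" "b \<in> subdifferential f x"
  shows "a \<bullet> u = b \<bullet> u"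
proof -
  have ne: "subdifferential f x \<noteq> {}" using assms(3) by blast
  have "u \<bullet> (a - b) = 0"
    using assms(2-4) unfolding U_space_eq[OF assms(1) ne] by blast
  then show ?thesis by (simp add: inner_diff_right inner_commute)
qed

text \<open>The V-space is the direction of the affine hull of the subdifferential, so a relative
  interior subgradient may be moved by a fixed amount in all its directions.\<close>

lemma rel_interior_add_V_space:
  assumes cv: "convex (subdifferential f x)" and g: "g \<in> rel_interior (subdifferential f x)"
  obtains \<rho> where "\<rho> > 0" "\<And>w. w \<in> V_space f x \<Longrightarrow> norm w \<le> \<rho> \<Longrightarrow> g + w \<in> subdifferential f x"
proof -
  let ?C = "subdifferential f x" and ?g = "ri_subgradient f x"
  have gC: "g \<in> ?C" using g rel_interior_subset by blast
  then have ne: "?C \<noteq> {}" by blast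
  have rC: "?g \<in> ?C"
    using ri_subgradient_in[OF cv ne] rel_interior_subset by blast
  have aff: "affine hull ?C = (\<lambda>y. ?g + y) ` V_space f x"
    using affine_hull_span_gen[OF hull_inc[OF rC, of affine]]
    by (simp add: V_space_def image_def)
  obtain e where e: "e > 0" "cball g e \<inter> affine hull ?C \<subseteq> ?C"
    using g unfolding mem_rel_interior_cball by blast
  have "g + w \<in> ?C" if w: "w \<in> V_space f x" "norm w \<le> e" for w
  proof -
    have "(g - ?g) + w \<in> V_space f x"
      by (rule subspace_add[OF subspace_V_space diff_in_V_space[OF cv gC rC] w(1)])
    then have "?g + ((g - ?g) + w) \<in> affine hull ?C"
      unfolding aff by blast
    moreover have "g + w \<in> cball g e"
      using w(2) by (simp add: dist_norm)
    ultimately show ?thesis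
      using e(2) by auto
  qed
  then show ?thesis using that e(1) by blast
qed

lemma dim_V_space_add_dim_U_space:
  fixes f :: "'a::euclidean_space \<Rightarrow> ereal"
  assumes "convex (subdifferential f x)" "subdifferential f x \<noteq> {}"
  shows "dim (V_space f x) + dim (U_space f x) = DIM('a)"
proof -
  have "V_space f x = {y \<in> UNIV. \<forall>u\<in>U_space f x. orthogonal u y}"
    unfolding V_space_eq[OF assms] by (auto simp: orthogonal_def inner_commute)
  then show ?thesis
    using dim_subspace_orthogonal_to_vectors[OF subspace_U_space[OF assms] subspace_UNIV]
    by (simp add: dim_UNIV)
qed

section \<open>Graphs over a subspace\<close>

text \<open>For \<open>y = x + u + w\<close> with \<open>u\<close> in \<open>U\<close> and
  \<open>w\<close> orthogonal to \<open>U\<close> this is \<open>w - v u\<close>, the offset of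
  \<open>y\<close> from the graph point over \<open>u\<close>.\<close>

definition graph_defect :: "'a::euclidean_space set \<Rightarrow> 'a \<Rightarrow> ('a \<Rightarrow> 'a) \<Rightarrow> 'a \<Rightarrow> 'a" where
  "graph_defect U x v y = y - x - closest_point U (y - x) - v (closest_point U (y - x))"

lemma C2_on_compose_closest_point:
  fixes U :: "'a::euclidean_space set" and k :: "'a \<Rightarrow> 'b::euclidean_space"
  assumes U: "subspace U" and k: "C2_on (U \<inter> ball 0 r) k"
  shows "C2_on (ball x r) (\<lambda>y. k (closest_point U (y - x)))"
proof -
  interpret P: linear "closest_point U" by (rule linear_closest_point[OF U])
  have "C2_on (ball x r) (\<lambda>y. k (closest_point U y + (- closest_point U x)))"
  proof (rule C2_on_compose_affine[OF k linear_closest_point[OF U]])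
    fix y assume "y \<in> ball x r"
    then have "norm (y - x) < r" by (simp add: dist_norm norm_minus_commute)
    then have "norm (closest_point U (y - x)) < r"
      using norm_closest_point_subspace_le[OF U, of "y - x"] by linarith
    then show "closest_point U y + - closest_point U x \<in> U \<inter> ball 0 r"
      using closest_point_in_subspace[OF U, of "y - x"] by (simp add: P.diff)
  qed
  then show ?thesis by (simp add: P.diff)
qed

lemma C2_on_graph_defect:
  assumes U: "subspace U" and v: "C2_on (U \<inter> ball 0 r) v"
  shows "C2_on (ball x r) (graph_defect U x v)"
proof -
  have id: "C2_on (ball x r) (\<lambda>y. y - x)"
    by (intro C2_on_diff C2_on_const C2_on_linear linear_id[unfolded id_def])
  show ?thesis
    unfolding graph_defect_def[abs_def]
    by (intro C2_on_diff[OF C2_on_diff[OF id C2_on_linear_compose[OF id linear_closest_point[OF U]]]]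
        C2_on_compose_closest_point U v)
qed

lemma graph_defect_eq_0_iff:
  assumes U: "subspace U" and v: "\<And>u w. u \<in> U \<Longrightarrow> w \<in> U \<Longrightarrow> v u \<bullet> w = 0"
  shows "graph_defect U x v y = 0 \<longleftrightarrow> (\<exists>u\<in>U. y = x + (u + v u))"
proof
  assume "graph_defect U x v y = 0"
  then show "\<exists>u\<in>U. y = x + (u + v u)"
    using closest_point_in_subspace[OF U]
    by (intro bexI[of _ "closest_point U (y - x)"]) (auto simp: graph_defect_def algebra_simps)
next
  assume "\<exists>u\<in>U. y = x + (u + v u)"
  then obtain u where u: "u \<in> U" "y = x + (u + v u)" by blast
  then have "closest_point U (y - x) = u"
    using v by (intro closest_point_subspace_eqI[OF U]) auto
  then show "graph_defect U x v y = 0"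
    using u by (simp add: graph_defect_def)
qed

text \<open>The defining functions are the coordinates of the defect in an orthonormal basis of
  \<open>V\<close>; the defect lies in \<open>V\<close>, so they vanish together exactly when it
  does. Their Jacobian is onto already on \<open>V\<close>.\<close>

lemma manifold_about_graph:
  fixes U V :: "'a::euclidean_space set"
  assumes U: "subspace U" and V: "V = {p. \<forall>u\<in>U. p \<bullet> u = 0}"
    and r: "r > 0" and v: "C2_on (U \<inter> ball 0 r) v" "v ` U \<subseteq> V" "v 0 = 0"
  shows "manifold_about (dim U) {x + (u + v u) | u. u \<in> U} x"
proof -
  interpret P: linear "closest_point U" by (rule linear_closest_point[OF U])
  have sV: "subspace V"
    unfolding V subspace_def by (auto simp: inner_add_left)
  have "dim V + dim U = DIM('a)"
    using dim_subspace_orthogonal_to_vectors[OF U subspace_UNIV] V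
    by (simp add: orthogonal_def inner_commute dim_UNIV)
  obtain B where B: "B \<subseteq> V" "pairwise orthogonal B" "\<And>b. b \<in> B \<Longrightarrow> norm b = 1"
    "independent B" "card B = dim V" "span B = V"
    using orthonormal_basis_subspace[OF sV] by metis
  have "finite B" using B(4) independent_imp_finite by blast
  then obtain b where b: "bij_betw b {0..<card B} B"
    using ex_bij_betw_nat_finite by blast
  define m where "m = card B"
  have bB: "b j \<in> B" if "j < m" for j
    using b that unfolding m_def bij_betw_def by auto
  let ?G = "graph_defect U x v"
  define F where "F = (\<lambda>j y. b j \<bullet> ?G y)"
  have vV: "v u \<in> V" if "u \<in> U" for u using v(2) that by auto
  have GV: "?G y \<in> V" for y
  proof -
    have "y - x - closest_point U (y - x) \<in> V"
      unfolding V using closest_point_orthogonal[OF U] by blast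
    then show ?thesis
      unfolding graph_defect_def
      by (rule subspace_diff[OF sV _ vV[OF closest_point_in_subspace[OF U]]])
  qed
  have G0: "?G y = 0 \<longleftrightarrow> (\<forall>j<m. F j y = 0)" for y
  proof
    assume F0: "\<forall>j<m. F j y = 0"
    have "c \<bullet> ?G y = 0" if c: "c \<in> B" for c
    proof -
      obtain j where "j < m" "c = b j"
        using b c unfolding m_def bij_betw_def by fastforce
      then show ?thesis using F0 by (simp add: F_def)
    qed
    then have "B \<subseteq> {c. ?G y \<bullet> c = 0}" by (auto simp: inner_commute)
    then have "span B \<subseteq> {c. ?G y \<bullet> c = 0}"
      by (rule span_minimal) (rule subspace_hyperplane)
    then have "?G y \<bullet> ?G y = 0" using GV B(6) by blast
    then show "?G y = 0" by simp
  qed (simp add: F_def)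
  have Giff: "?G y = 0 \<longleftrightarrow> (\<exists>u\<in>U. y = x + (u + v u))" for y
    using vV by (intro graph_defect_eq_0_iff[OF U]) (auto simp: V)
  have C2F: "C2_on (ball x r) (F j)" for j
    unfolding F_def by (intro C2_on_inner_const C2_on_graph_defect[OF U v(1)])
  have gradF: "grad (F j) x \<bullet> p = b j \<bullet> p" if p: "p \<in> V" for j p
  proof -
    have "GDERIV (F j) x :> grad (F j) x"
      using C2_on_GDERIV[OF C2F] r by simp
    then have "(F j has_derivative (\<lambda>h. h \<bullet> grad (F j) x)) (at (x + 0 *\<^sub>R p))"
      by (simp add: gderiv_def)
    then have "((\<lambda>t. F j (x + t *\<^sub>R p)) has_derivative (\<lambda>t. (t *\<^sub>R p) \<bullet> grad (F j) x)) (at 0)"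
      by (rule has_derivative_compose[rotated]) (auto intro!: derivative_eq_intros)
    \<comment> \<open>On this line the component in \<open>U\<close> is 0 and
      \<open>v 0 = 0\<close>, so the defect is just \<open>t *\<^sub>R p\<close>.\<close>
    moreover have "F j (x + t *\<^sub>R p) = t *\<^sub>R (b j \<bullet> p)" for t
    proof -
      have "closest_point U (t *\<^sub>R p) = 0"
        using p U by (intro closest_point_subspace_eqI[OF U]) (auto simp: V subspace_0)
      then show ?thesis
        by (simp add: F_def graph_defect_def v(3))
    qed
    then have "((\<lambda>t. F j (x + t *\<^sub>R p)) has_derivative (\<lambda>t. t *\<^sub>R (b j \<bullet> p))) (at 0)"
      by (auto intro!: derivative_eq_intros)
    ultimately have "(\<lambda>t. (t *\<^sub>R p) \<bullet> grad (F j) x) = (\<lambda>t. t *\<^sub>R (b j \<bullet> p))"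
      by (rule has_derivative_unique)
    from fun_cong[OF this, of 1] show ?thesis
      by (simp add: inner_commute)
  qed
  have onto: "\<exists>p. \<forall>j<m. grad (F j) x \<bullet> p = c j" for c :: "nat \<Rightarrow> real"
  proof (intro exI allI impI)
    fix j assume j: "j < m"
    define p where "p = (\<Sum>i<m. c i *\<^sub>R b i)"
    have "p \<in> V"
      unfolding p_def using bB B(1) sV by (intro subspace_sum subspace_scale) auto
    then have "grad (F j) x \<bullet> p = (\<Sum>i<m. c i * (b j \<bullet> b i))"
      by (simp add: gradF) (simp add: p_def inner_sum_right)
    also have "\<dots> = (\<Sum>i<m. if i = j then c i else 0)"
    proof (rule sum.cong)
      fix i assume "i \<in> {..<m}"
      then have i: "i < m" by simp
      show "c i * (b j \<bullet> b i) = (if i = j then c i else 0)"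
      proof (cases "i = j")
        case True
        then show ?thesis using B(3)[OF bB[OF j]] by (simp flip: power2_norm_eq_inner)
      next
        case False
        then have "b j \<noteq> b i"
          using b i j unfolding bij_betw_def m_def inj_on_def by auto
        then show ?thesis
          using B(2) bB[OF i] bB[OF j] False by (auto simp: pairwise_def orthogonal_def)
      qed
    qed simp
    also have "\<dots> = c j"
      using j by simp
    finally show "grad (F j) x \<bullet> (\<Sum>i<m. c i *\<^sub>R b i) = c j"
      by (simp add: p_def)
  qed
  have "x \<in> {x + (u + v u) | u. u \<in> U}"
    using v(3) subspace_0[OF U] by force
  moreover have "m + dim U = DIM('a)"
    using B(5) \<open>dim V + dim U = DIM('a)\<close> by (simp add: m_def)
  moreover have "{x + (u + v u) | u. u \<in> U} \<inter> ball x r = {y \<in> ball x r. \<forall>j<m. F j y = 0}"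
    using G0 Giff by blast
  ultimately show ?thesis
    unfolding manifold_about_def using r C2F onto
    by (intro conjI exI[of _ m] exI[of _ r] exI[of _ F]) auto
qed

text \<open>A vector orthogonal to \<open>U\<close> sees only \<open>v u\<close>, which is of
  smaller order than \<open>u\<close>, and \<open>norm u\<close> is at most
  \<open>norm (y - x)\<close> since \<open>u\<close> is the projection of
  \<open>y - x\<close>.\<close>

lemma regular_normal_cone_graph:
  fixes U :: "'a::euclidean_space set"
  assumes U: "subspace U" and v: "\<And>u w. u \<in> U \<Longrightarrow> w \<in> U \<Longrightarrow> v u \<bullet> w = 0" "v 0 = 0"
    and D: "(v has_derivative (\<lambda>_. 0)) (at 0 within U)"
    and z: "\<And>u. u \<in> U \<Longrightarrow> z \<bullet> u = 0"
  shows "z \<in> regular_normal_cone {x + (u + v u) | u. u \<in> U} x"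
  unfolding regular_normal_cone_iff
proof (intro conjI allI impI)
  show "x \<in> {x + (u + v u) | u. u \<in> U}"
    using v(2) subspace_0[OF U] by force
  fix e :: real assume "e > 0"
  define e' where "e' = e / (norm z + 1)"
  have e': "e' > 0" "norm z * e' \<le> e"
    using divide_add_one_mult_le[OF \<open>e > 0\<close> norm_ge_zero, of z] by (auto simp: e'_def mult.commute)
  obtain d where d: "d > 0" "\<And>u. u \<in> U \<Longrightarrow> norm u < d \<Longrightarrow> norm (v u) \<le> e' * norm u"
    using D e'(1) unfolding has_derivative_within_alt v(2) by auto
  have "z \<bullet> (y - x) \<le> e * norm (y - x)" if y: "y = x + (u + v u)" "u \<in> U" "dist y x < d" for y u
  proof -
    have "closest_point U (y - x) = u"
      using v y by (intro closest_point_subspace_eqI[OF U]) auto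
    then have un: "norm u \<le> norm (y - x)"
      using norm_closest_point_subspace_le[OF U] by metis
    then have "norm u < d" using y(3) by (simp add: dist_norm)
    have "z \<bullet> (y - x) = z \<bullet> v u"
      using y z[OF y(2)] by (simp add: inner_add_right)
    also have "\<dots> \<le> norm z * norm (v u)"
      by (rule norm_cauchy_schwarz)
    also have "\<dots> \<le> norm z * (e' * norm u)"
      using d(2)[OF y(2) \<open>norm u < d\<close>] by (intro mult_left_mono) auto
    also have "\<dots> \<le> e * norm u"
      using mult_right_mono[OF e'(2), of "norm u"] by simp
    also have "\<dots> \<le> e * norm (y - x)"
      using un \<open>e > 0\<close> by simp
    finally show ?thesis .
  qed
  then show "\<exists>d>0. \<forall>y\<in>{x + (u + v u) | u. u \<in> U}. dist y x < d \<longrightarrow> z \<bullet> (y - x) \<le> e * norm (y - x)"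
    using d(1) by (intro exI[of _ d]) auto
qed

section \<open>Fast tracks\<close>

locale convex_fast_track =
  fixes f :: "'a::euclidean_space \<Rightarrow> ereal" and x :: 'a and v :: "'a \<Rightarrow> 'a"
  assumes convex: "convex (subdifferential f x)" and track: "fast_track f x v"
begin

abbreviation "sd \<equiv> subdifferential f x"
abbreviation "U \<equiv> U_space f x"
abbreviation "V \<equiv> V_space f x"
abbreviation "P \<equiv> closest_point U"
abbreviation "M \<equiv> track_manifold f x v"
abbreviation "L g u \<equiv> real_of_ereal (U_lagrangian f x g u)"

lemma nonempty: "sd \<noteq> {}"
  using track by (simp add: fast_track_def)

lemma ri_subgradient_exists:
  obtains g where "g \<in> rel_interior sd"
  using rel_interior_eq_empty[OF convex] nonempty by blast

lemma subspace_U: "subspace U"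
  by (rule subspace_U_space[OF convex nonempty])

lemma V_eq: "V = {p. \<forall>u\<in>U. p \<bullet> u = 0}"
  by (rule V_space_eq[OF convex nonempty])

lemma v_in_V: "u \<in> U \<Longrightarrow> v u \<in> V"
  using track by (auto simp: fast_track_def)

lemma v_orthogonal: "u \<in> U \<Longrightarrow> w \<in> U \<Longrightarrow> v u \<bullet> w = 0"
  using v_in_V V_eq by blast

lemma track_manifold_eq: "M = {x + (u + v u) | u. u \<in> U}"
  by (simp add: track_manifold_def)

text \<open>Membership of \<open>x\<close> in its own manifold gives \<open>u + v u = 0\<close> for
  some \<open>u\<close>; the summands are orthogonal, so \<open>u\<close> is 0 and
  \<open>v u\<close> with it.\<close>

lemma v_0: "v 0 = 0"
proof -
  have "x \<in> M"
    using track by (auto simp: fast_track_def manifold_about_def)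
  then obtain u where u: "u \<in> U" "u + v u = 0"
    unfolding track_manifold_eq by auto
  have "u \<bullet> u = (u + v u) \<bullet> u"
    using v_orthogonal[OF u(1) u(1)] by (simp add: inner_add_left)
  then have "u = 0" using u(2) by simp
  then show ?thesis using u(2) by simp
qed

lemma mem_track_manifold_iff: "y \<in> M \<longleftrightarrow> graph_defect U x v y = 0"
proof -
  have "graph_defect U x v y = 0 \<longleftrightarrow> (\<exists>u\<in>U. y = x + (u + v u))"
    by (rule graph_defect_eq_0_iff[OF subspace_U v_orthogonal])
  then show ?thesis unfolding track_manifold_eq by blast
qed

text \<open>The working form of a fast track, in real numbers: equality along the track and a lower
  bound on the entire slice \<open>x + u + V\<close>.\<close>

lemma lagrangian_near_0:
  assumes g: "g \<in> rel_interior (sd)"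
  obtains r where "r > 0" "C2_on (U \<inter> ball 0 r) v" "C2_on (U \<inter> ball 0 r) (L g)"
    "\<And>u. u \<in> U \<inter> ball 0 r \<Longrightarrow> \<bar>U_lagrangian f x g u\<bar> \<noteq> \<infinity>"
    "\<And>u. u \<in> U \<inter> ball 0 r \<Longrightarrow> f (x + u + v u) = ereal (L g u + g \<bullet> v u)"
    "\<And>u w. u \<in> U \<inter> ball 0 r \<Longrightarrow> w \<in> V \<Longrightarrow> ereal (L g u + g \<bullet> w) \<le> f (x + u + w)"
proof -
  obtain r where r: "r > 0" "C2_on (U \<inter> ball 0 r) v" "C2_on (U \<inter> ball 0 r) (L g)"
    and min: "\<And>u. u \<in> U \<inter> ball 0 r \<Longrightarrow> v u \<in> U_minimizers f x g u"
    and fin: "\<And>u. u \<in> U \<inter> ball 0 r \<Longrightarrow> \<bar>U_lagrangian f x g u\<bar> \<noteq> \<infinity>"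
    using track g unfolding fast_track_def by metis
  have L: "U_lagrangian f x g u = ereal (L g u)" if "u \<in> U \<inter> ball 0 r" for u
    using fin[OF that] by (simp add: ereal_real')
  have "f (x + u + v u) = ereal (L g u + g \<bullet> v u)" if "u \<in> U \<inter> ball 0 r" for u
  proof -
    have "f (x + u + v u) - ereal (g \<bullet> v u) = ereal (L g u)"
      using min[OF that] L[OF that] by (simp add: U_minimizers_def)
    then show ?thesis by (cases "f (x + u + v u)") (auto simp: algebra_simps)
  qed
  moreover have "ereal (L g u + g \<bullet> w) \<le> f (x + u + w)" if u: "u \<in> U \<inter> ball 0 r" and w: "w \<in> V" for u w
  proof -
    have "ereal (L g u) \<le> f (x + u + w) - ereal (g \<bullet> w)"
      using INF_lower[OF w, of "\<lambda>w. f (x + u + w) - ereal (g \<bullet> w)"] L[OF u]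
      unfolding U_lagrangian_def lagrangian_over_def by metis
    then show ?thesis by (cases "f (x + u + w)") (auto simp: algebra_simps)
  qed
  ultimately show ?thesis using that r fin by blast
qed

lemma lagrangian_0:
  assumes "g \<in> rel_interior (sd)"
  shows "f x = ereal (L g 0)"
proof -
  obtain r where r: "r > 0" 
    "\<And>u. u \<in> U \<inter> ball 0 r \<Longrightarrow> f (x + u + v u) = ereal (L g u + g \<bullet> v u)"
    using lagrangian_near_0[OF assms] by metis
  then show ?thesis using r(2)[of 0] subspace_0[OF subspace_U] by (simp add: v_0)
qed

text \<open>A smooth minorant that touches \<open>f\<close> near \<open>x\<close> exactly along the track.\<close>

definition support :: "'a \<Rightarrow> 'a \<Rightarrow> real" where
  "support g y = L g (P (y - x)) + g \<bullet> (y - x - P (y - x)) - (norm (graph_defect U x v y))\<^sup>2"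

lemma support_minorant:
  assumes g: "g \<in> rel_interior (sd)"
  obtains r where "r > 0" "C2_on (ball x r) (support g)"
    "\<And>y. y \<in> ball x r \<Longrightarrow> ereal (support g y) \<le> f y"
    "\<And>y. y \<in> ball x r \<Longrightarrow> ereal (support g y) = f y \<longleftrightarrow> y \<in> M"
proof -
  obtain r where r: "r > 0" "C2_on (U \<inter> ball 0 r) v" "C2_on (U \<inter> ball 0 r) (L g)"
    and eq: "\<And>u. u \<in> U \<inter> ball 0 r \<Longrightarrow> f (x + u + v u) = ereal (L g u + g \<bullet> v u)"
    and le: "\<And>u w. u \<in> U \<inter> ball 0 r \<Longrightarrow> w \<in> V \<Longrightarrow> ereal (L g u + g \<bullet> w) \<le> f (x + u + w)"
    using lagrangian_near_0[OF g] by metis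
  have id: "C2_on (ball x r) (\<lambda>y. y - x)"
    by (intro C2_on_diff C2_on_const C2_on_linear linear_id[unfolded id_def])
  have C2: "C2_on (ball x r) (support g)"
    unfolding support_def[abs_def]
    by (intro C2_on_diff[OF C2_on_add C2_on_norm_power2] C2_on_graph_defect[OF subspace_U r(2)]
        C2_on_compose_closest_point[OF subspace_U r(3)] C2_on_inner_const
        C2_on_diff[OF id C2_on_linear_compose[OF id linear_closest_point[OF subspace_U]]])
  have PU: "P (y - x) \<in> U \<inter> ball 0 r" if "y \<in> ball x r" for y
    using that closest_point_in_subspace[OF subspace_U, of "y - x"]
      norm_closest_point_subspace_le[OF subspace_U, of "y - x"]
    by (simp add: dist_norm norm_minus_commute)
  \<comment> \<open>The minorant before the square is subtracted; \<open>f\<close> may touch it off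
    the track too, which the square excludes.\<close>
  have b: "ereal (L g (P (y - x)) + g \<bullet> (y - x - P (y - x))) \<le> f y" if "y \<in> ball x r" for y
    using le[OF PU[OF that] diff_closest_point_in_V_space[OF convex nonempty], of "y - x"] by simp
  have "ereal (support g y) \<le> f y" if "y \<in> ball x r" for y
    by (rule order_trans[OF _ b[OF that]]) (simp add: support_def)
  moreover have "ereal (support g y) = f y \<longleftrightarrow> y \<in> M" if y: "y \<in> ball x r" for y
  proof
    assume "ereal (support g y) = f y"
    with b[OF y] have "(norm (graph_defect U x v y))\<^sup>2 \<le> 0"
      by (simp add: support_def flip: \<open>ereal (support g y) = f y\<close>)
    then show "y \<in> M"
      by (simp add: mem_track_manifold_iff)
  next
    assume "y \<in> M"
    then have "graph_defect U x v y = 0" by (simp add: mem_track_manifold_iff)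
    moreover from this have "y - x - P (y - x) = v (P (y - x))"
      by (simp add: graph_defect_def)
    moreover from this have "x + P (y - x) + v (P (y - x)) = y"
      by (simp add: algebra_simps)
    ultimately show "ereal (support g y) = f y"
      using eq[OF PU[OF y]] by (simp add: support_def)
  qed
  ultimately show ?thesis using that r(1) C2 by blast
qed

lemma manifold_about_track: "manifold_about (dim U) M x"
proof -
  obtain g where g: "g \<in> rel_interior (sd)"
    by (rule ri_subgradient_exists)
  obtain r where r: "r > 0" "C2_on (U \<inter> ball 0 r) v"
    using lagrangian_near_0[OF g] by metis
  show ?thesis
    unfolding track_manifold_eq using v_in_V
    by (intro manifold_about_graph[OF subspace_U V_eq r] v_0) auto
qed

end

text \<open>Regularity is expressed by the subdifferentials because this form is what
  \<open>regular_F\<close> establishes for the sum, to which the locale is applied in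
  \<open>has_U_gradient_F\<close>.\<close>

locale regular_fast_track =
  fixes f :: "'a::euclidean_space \<Rightarrow> ereal" and x :: 'a and v :: "'a \<Rightarrow> 'a"
  assumes regular: "subdifferential f x = regular_subdifferential f x"
    and track': "fast_track f x v"

sublocale regular_fast_track \<subseteq> convex_fast_track
  by unfold_locales (simp_all add: regular convex_regular_subdifferential track')

context regular_fast_track
begin

text \<open>Testing the lower estimate of \<open>f\<close> by a subgradient along the track shows that a functional
  linear in the derivatives of \<open>L g\<close> and \<open>v\<close> is nonnegative on \<open>U\<close>, hence zero; varying the
  subgradient separates the two derivatives.\<close>

lemma track_derivatives:
  assumes g: "g \<in> rel_interior (sd)"
  shows "(v has_derivative (\<lambda>_. 0)) (at 0 within U)"
    and "(L g has_derivative (\<lambda>p. P g \<bullet> p)) (at 0 within U)"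
proof -
  obtain r where r: "r > 0" "C2_on (U \<inter> ball 0 r) v" "C2_on (U \<inter> ball 0 r) (L g)"
    and eq: "\<And>u. u \<in> U \<inter> ball 0 r \<Longrightarrow> f (x + u + v u) = ereal (L g u + g \<bullet> v u)"
    using lagrangian_near_0[OF g] by metis
  have U0: "0 \<in> U" by (rule subspace_0[OF subspace_U])
  then have U0r: "0 \<in> U \<inter> ball 0 r" using r(1) by simp
  have within: "at 0 within U \<inter> ball 0 r = at 0 within U"
    by (rule at_within_nhd[of _ "ball 0 r"]) (use r(1) in auto)
  obtain v' where "(v has_derivative blinfun_apply v') (at 0 within U \<inter> ball 0 r)"
    using C2_onE[OF r(2)] U0r by metis
  then have v': "(v has_derivative blinfun_apply v') (at 0 within U)"
    by (simp only: within)
  obtain l where "(L g has_derivative blinfun_apply l) (at 0 within U \<inter> ball 0 r)"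
    using C2_onE[OF r(3)] U0r by metis
  then have l: "(L g has_derivative blinfun_apply l) (at 0 within U)"
    by (simp only: within)
  have gC: "g \<in> sd" using g rel_interior_subset by blast
  define K where "K = norm v' + 1"
  have K: "K \<ge> 1" by (simp add: K_def)
  have vK: "\<exists>d>0. \<forall>u\<in>U. norm u < d \<longrightarrow> norm (v u) \<le> K * norm u"
  proof -
    obtain d where d: "d > 0" "\<And>u. u \<in> U \<Longrightarrow> norm u < d \<Longrightarrow> norm (v u - v' u) \<le> 1 * norm u"
      using v' unfolding has_derivative_within_alt v_0 by (metis diff_zero zero_less_one)
    have "norm (v u) \<le> K * norm u" if "u \<in> U" "norm u < d" for u
      using d(2)[OF that] norm_triangle_sub[of "v u" "v' u"] norm_blinfun[of v' u]
      by (simp add: K_def algebra_simps)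
    then show ?thesis using d(1) by blast
  qed
  \<comment> \<open>The estimate of \<open>f\<close> by \<open>q\<close> at
    \<open>x + u + v u\<close>. Since \<open>q\<close> and \<open>g\<close> agree on
    \<open>U\<close>, only their difference on \<open>v u\<close> remains. The increment has norm at
    most \<open>(1 + K) * norm u\<close>, hence the choice of \<open>e'\<close>.\<close>
  have key: "\<exists>d>0. \<forall>u\<in>U. norm u < d \<longrightarrow> (q - g) \<bullet> v u \<le> L g u - L g 0 - g \<bullet> u + e * norm u"
    if q: "q \<in> sd" and e: "e > 0" for q e
  proof -
    define e' where "e' = e / (1 + K)"
    have e': "e' > 0" "e' * (1 + K) = e" using e K by (auto simp: e'_def)
    obtain d1 where d1: "d1 > 0"
      "\<And>y. dist y x < d1 \<Longrightarrow> ereal (L g 0 + q \<bullet> (y - x) - e' * norm (y - x)) \<le> f y"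
      using q e'(1) unfolding regular regular_subdifferential_real_iff[of f, OF lagrangian_0[OF g]]
      by blast
    obtain d2 where d2: "d2 > 0" "\<And>u. u \<in> U \<Longrightarrow> norm u < d2 \<Longrightarrow> norm (v u) \<le> K * norm u"
      using vK by blast
    define d where "d = min (min d2 r) (d1 / (1 + K))"
    have d: "d > 0" "d \<le> d2" "d \<le> r" "d * (1 + K) \<le> d1"
    proof -
      show "d > 0" "d \<le> d2" "d \<le> r" using d1(1) d2(1) r(1) K by (auto simp: d_def)
      have "d * (1 + K) \<le> d1 / (1 + K) * (1 + K)"
        using K by (intro mult_right_mono) (auto simp: d_def)
      then show "d * (1 + K) \<le> d1" using K by simp
    qed
    have "(q - g) \<bullet> v u \<le> L g u - L g 0 - g \<bullet> u + e * norm u" if u: "u \<in> U" "norm u < d" for u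
    proof -
      have n: "norm (u + v u) \<le> (1 + K) * norm u"
        using norm_triangle_ineq[of u "v u"] d2(2)[of u] u d by (simp add: algebra_simps)
      also have "\<dots> < (1 + K) * d" using u(2) K by simp
      also have "\<dots> \<le> d1" using d(4) by (simp add: mult.commute)
      finally have "ereal (L g 0 + q \<bullet> (u + v u) - e' * norm (u + v u)) \<le> f (x + u + v u)"
        using d1(2)[of "x + u + v u"] by (simp add: dist_norm add.assoc)
      also have "f (x + u + v u) = ereal (L g u + g \<bullet> v u)"
        using u d(3) by (intro eq) auto
      finally have "L g 0 + q \<bullet> (u + v u) - e' * norm (u + v u) \<le> L g u + g \<bullet> v u"
        by simp
      moreover have "e' * norm (u + v u) \<le> e * norm u"
        using mult_left_mono[OF n, of e'] e' by (simp add: mult.assoc[symmetric])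
      moreover have "q \<bullet> u = g \<bullet> u"
        by (rule inner_U_space_eq[OF convex u(1) q gC])
      ultimately show ?thesis
        by (simp add: inner_add_right inner_diff_left)
    qed
    then show ?thesis using d(1) by blast
  qed
  \<comment> \<open>A linear functional whose negative part is of smaller order is nonnegative along
    every ray, and replacing \<open>u\<close> by \<open>- u\<close> shows that it vanishes.\<close>
  have zero: "a u = 0"
    if lin: "linear a" and u: "u \<in> U"
      and low: "\<And>e. e > 0 \<Longrightarrow> \<exists>d>0. \<forall>u\<in>U. norm u < d \<longrightarrow> - e * norm u \<le> a u"
    for a :: "'a \<Rightarrow> real" and u
  proof -
    interpret linear a by (rule lin)
    have nn: "0 \<le> a p" if p: "p \<in> U" for p
    proof (rule field_le_epsilon)
      fix e :: real assume "e > 0"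
      define n where "n = norm p"
      define e' where "e' = e / (n + 1)"
      have e': "e' > 0" "e' * n \<le> e"
        unfolding e'_def n_def by (rule divide_add_one_mult_le[OF \<open>e > 0\<close> norm_ge_zero])+
      obtain d where d: "d > 0" "\<And>u. u \<in> U \<Longrightarrow> norm u < d \<Longrightarrow> - e' * norm u \<le> a u"
        using low[OF e'(1)] by blast
      define t where "t = d / 2 / (n + 1)"
      have "d / 2 > 0" using d(1) by simp
      note * = divide_add_one_mult_le[OF this norm_ge_zero, of p, folded n_def, folded t_def]
      have t: "t > 0" "t * n < d" using *(1) *(2) d(1) by linarith+
      have "- e' * norm (t *\<^sub>R p) \<le> a (t *\<^sub>R p)"
        using p t by (intro d(2) subspace_scale[OF subspace_U]) (auto simp: n_def)
      then have "t * (- (e' * n)) \<le> t * a p"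
        using t(1) by (simp add: scale n_def mult_ac)
      then have "- (e' * n) \<le> a p"
        using t(1) by (simp only: mult_le_cancel_left_pos)
      then show "0 \<le> a p + e" using e'(2) by linarith
    qed
    have "- u \<in> U" using u subspace_neg[OF subspace_U] by blast
    from nn[OF this] nn[OF u] show ?thesis by (simp add: neg)
  qed
  have lin_l: "linear (blinfun_apply l)" and lin_v': "linear (blinfun_apply v')"
    by (simp_all add: blinfun.bounded_linear_right bounded_linear.linear)
  \<comment> \<open>Three errors of \<open>e / 3\<close> each: from \<open>key\<close> and from the
    derivatives of \<open>v\<close> and of \<open>L g\<close>.\<close>
  have comb: "l u - (q - g) \<bullet> v' u - g \<bullet> u = 0" if q: "q \<in> sd" and u: "u \<in> U" for q u
  proof (rule zero[OF _ u])
    show "linear (\<lambda>u. l u - (q - g) \<bullet> v' u - g \<bullet> u)"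
      by (rule linearI) (simp_all add: blinfun.add_right blinfun.scaleR_right inner_add_right algebra_simps)
    fix e :: real assume "e > 0"
    then have e3: "e / 3 > 0" by simp
    define e2 where "e2 = e / 3 / (norm (q - g) + 1)"
    have e2: "e2 > 0" "e2 * norm (q - g) \<le> e / 3"
      unfolding e2_def by (rule divide_add_one_mult_le[OF e3 norm_ge_zero])+
    obtain d1 where d1: "d1 > 0" "\<And>u. u \<in> U \<Longrightarrow> norm u < d1 \<Longrightarrow>
        (q - g) \<bullet> v u \<le> L g u - L g 0 - g \<bullet> u + e / 3 * norm u"
      using key[OF q e3] by blast
    obtain d2 where d2: "d2 > 0" "\<And>u. u \<in> U \<Longrightarrow> norm u < d2 \<Longrightarrow> norm (v u - v' u) \<le> e2 * norm u"
      using v' e2(1) unfolding has_derivative_within_alt v_0 by (metis diff_zero)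
    obtain d3 where d3: "d3 > 0" "\<And>u. u \<in> U \<Longrightarrow> norm u < d3 \<Longrightarrow> norm (L g u - L g 0 - l u) \<le> e / 3 * norm u"
      using l e3 unfolding has_derivative_within_alt by (metis diff_zero)
    have "- e * norm u \<le> l u - (q - g) \<bullet> v' u - g \<bullet> u" if u: "u \<in> U" "norm u < min d1 (min d2 d3)" for u
    proof -
      have "(q - g) \<bullet> v' u - (q - g) \<bullet> v u \<le> norm (q - g) * norm (v u - v' u)"
        using norm_cauchy_schwarz[of "q - g" "v' u - v u"]
        by (simp add: inner_diff_right norm_minus_commute)
      also have "\<dots> \<le> norm (q - g) * (e2 * norm u)"
        using d2(2)[OF u(1)] u(2) by (intro mult_left_mono) auto
      also have "\<dots> \<le> e / 3 * norm u"
        using mult_right_mono[OF e2(2), of "norm u"] by (simp add: mult_ac)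
      finally have a: "(q - g) \<bullet> v' u - (q - g) \<bullet> v u \<le> e / 3 * norm u" .
      have b: "L g u - L g 0 - l u \<le> e / 3 * norm u"
        using order_trans[OF abs_ge_self d3(2)[OF u(1), unfolded real_norm_def]] u(2) by simp
      show ?thesis
        using a b d1(2)[OF u(1)] u(2) by simp
    qed
    then show "\<exists>d>0. \<forall>u\<in>U. norm u < d \<longrightarrow> - e * norm u \<le> l u - (q - g) \<bullet> v' u - g \<bullet> u"
      using d1(1) d2(1) d3(1) by (intro exI[of _ "min d1 (min d2 d3)"]) auto
  qed
  have lu: "l u = P g \<bullet> u" if "u \<in> U" for u
    using comb[OF gC that] closest_point_inner_left[OF subspace_U that] by simp
  have v'0: "v' u \<bullet> p = 0" if u: "u \<in> U" for u p
  proof -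
    obtain \<rho> where \<rho>: "\<rho> > 0" "\<And>w. w \<in> V \<Longrightarrow> norm w \<le> \<rho> \<Longrightarrow> g + w \<in> sd"
      using rel_interior_add_V_space[OF convex g] by metis
    define z where "z = p - P p"
    have z: "z \<in> V" unfolding z_def by (rule diff_closest_point_in_V_space[OF convex nonempty])
    define t where "t = \<rho> / (norm z + 1)"
    have t: "t > 0" "t * norm z \<le> \<rho>"
      unfolding t_def by (rule divide_add_one_mult_le[OF \<rho>(1) norm_ge_zero])+
    \<comment> \<open>Subtracting the instances of \<open>comb\<close> for \<open>g\<close> and for
      \<open>g\<close> moved along \<open>z\<close> isolates
      \<open>z \<bullet> v' u\<close>.\<close>
    have "g + t *\<^sub>R z \<in> sd"
      using t z by (intro \<rho>(2) subspace_scale[OF subspace_V_space]) auto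
    from comb[OF this u] comb[OF gC u] have zv: "z \<bullet> v' u = 0"
      using t(1) by simp
    \<comment> \<open>\<open>v\<close> takes values orthogonal to \<open>U\<close>, so its
      derivative along \<open>U\<close> is orthogonal to \<open>U\<close> as well.\<close>
    have "P p \<bullet> v' u = 0"
    proof (rule zero[OF _ u])
      show "linear (\<lambda>u. P p \<bullet> v' u)"
        by (rule linearI) (simp_all add: blinfun.add_right blinfun.scaleR_right inner_add_right)
      fix e :: real assume "e > 0"
      define e' where "e' = e / (norm (P p) + 1)"
      have e': "e' > 0" "e' * norm (P p) \<le> e"
        unfolding e'_def by (rule divide_add_one_mult_le[OF \<open>e > 0\<close> norm_ge_zero])+
      obtain d where d: "d > 0" "\<And>u. u \<in> U \<Longrightarrow> norm u < d \<Longrightarrow> norm (v u - v' u) \<le> e' * norm u"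
        using v' e'(1) unfolding has_derivative_within_alt v_0 by (metis diff_zero)
      have "- e * norm u \<le> P p \<bullet> v' u" if u: "u \<in> U" "norm u < d" for u
      proof -
        have "- (P p \<bullet> v' u) = P p \<bullet> (v u - v' u)"
          using v_orthogonal[OF u(1) closest_point_in_subspace[OF subspace_U]]
          by (simp add: inner_diff_right inner_commute)
        also have "\<dots> \<le> norm (P p) * norm (v u - v' u)"
          by (rule norm_cauchy_schwarz)
        also have "\<dots> \<le> norm (P p) * (e' * norm u)"
          using d(2)[OF u] by (intro mult_left_mono) auto
        also have "\<dots> \<le> e * norm u"
          using mult_right_mono[OF e'(2), of "norm u"] by (simp add: mult_ac)
        finally show ?thesis by simp
      qed
      then show "\<exists>d>0. \<forall>u\<in>U. norm u < d \<longrightarrow> - e * norm u \<le> P p \<bullet> v' u"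
        using d(1) by blast
    qed
    then show ?thesis
      using zv by (simp add: z_def inner_diff_right inner_commute)
  qed
  show "(v has_derivative (\<lambda>_. 0)) (at 0 within U)"
  proof -
    have "v' u = 0" if "u \<in> U" for u
      using v'0[OF that, of "v' u"] by simp
    then show ?thesis
      using v' unfolding has_derivative_within_alt by simp
  qed
  show "(L g has_derivative (\<lambda>p. P g \<bullet> p)) (at 0 within U)"
    using l unfolding has_derivative_within_alt using lu
    by (simp add: bounded_linear_inner_right)
qed

end

section \<open>Primal-dual gradient structure of separable sums\<close>

lemma C2_on_nth:
  fixes k :: "'a::euclidean_space \<Rightarrow> 'b::euclidean_space"
  assumes k: "C2_on (ball (z $ i) r) k"
  shows "C2_on (ball z r) (\<lambda>y :: 'a ^ 'k::finite. k (y $ i))"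
proof -
  have "C2_on (ball z r) (\<lambda>y. k (y $ i + 0))"
  proof (rule C2_on_compose_affine[OF k])
    show "linear (\<lambda>y :: 'a ^ 'k. y $ i)"
      by (intro linearI) auto
    show "y $ i + 0 \<in> ball (z $ i) r" if "y \<in> ball z r" for y
      using that dist_vec_nth_le[of z i y] by simp
  qed
  then show ?thesis by simp
qed

lemma GDERIV_nth:
  fixes k :: "'a::euclidean_space \<Rightarrow> real"
  assumes "GDERIV k (y $ i) :> D"
  shows "GDERIV (\<lambda>y :: 'a ^ 'k::finite. k (y $ i)) y :> axis i D"
proof -
  have "((\<lambda>y :: 'a ^ 'k. y $ i) has_derivative (\<lambda>h. h $ i)) (at y)"
    by (rule bounded_linear_imp_has_derivative) (rule bounded_linear_vec_nth)
  from has_derivative_compose[OF this, of k] show ?thesis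
    using assms unfolding gderiv_def inner_axis by blast
qed

lemma GDERIV_sum:
  assumes "\<And>i. i \<in> I \<Longrightarrow> GDERIV (f i) x :> D i"
  shows "GDERIV (\<lambda>x. \<Sum>i\<in>I. f i x) x :> (\<Sum>i\<in>I. D i)"
  using assms unfolding gderiv_def inner_sum_right by (intro has_derivative_sum)

text \<open>The data of a primal-dual gradient structure, over arbitrary finite index sets in place of
  \<open>{0..m1}\<close> and \<open>{1..m2}\<close>.\<close>

locale pdg =
  fixes f :: "'a::euclidean_space \<Rightarrow> ereal" and x :: 'a and M :: "'a set"
    and A :: "'p set" and B :: "'q set"
    and fs :: "'p \<Rightarrow> 'a \<Rightarrow> real" and \<phi> :: "'q \<Rightarrow> 'a \<Rightarrow> real"
    and \<Delta> :: "(('p \<Rightarrow> real) \<times> ('q \<Rightarrow> real)) set" and \<delta> :: real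
  assumes finite_A: "finite A" and A_nonempty: "A \<noteq> {}" and finite_B: "finite B"
    and \<delta>: "\<delta> > 0"
    and C2_fs: "\<And>i. i \<in> A \<Longrightarrow> C2_on (ball x \<delta>) (fs i)"
    and C2_\<phi>: "\<And>j. j \<in> B \<Longrightarrow> C2_on (ball x \<delta>) (\<phi> j)"
    and zero_outside: "\<And>\<alpha> \<beta> i. (\<alpha>, \<beta>) \<in> \<Delta> \<Longrightarrow> i \<notin> A \<Longrightarrow> \<alpha> i = 0"
      "\<And>\<alpha> \<beta> j. (\<alpha>, \<beta>) \<in> \<Delta> \<Longrightarrow> j \<notin> B \<Longrightarrow> \<beta> j = 0"
    and closed_\<Delta>: "closed \<Delta>"
    and convex_\<Delta>: "\<And>\<alpha> \<beta> \<alpha>' \<beta>' t. (\<alpha>, \<beta>) \<in> \<Delta> \<Longrightarrow> (\<alpha>', \<beta>') \<in> \<Delta> \<Longrightarrow> t \<in> {0..1} \<Longrightarrow>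
        ((\<lambda>i. (1 - t) * \<alpha> i + t * \<alpha>' i), (\<lambda>j. (1 - t) * \<beta> j + t * \<beta>' j)) \<in> \<Delta>"
    and fs_x: "\<And>i. i \<in> A \<Longrightarrow> ereal (fs i x) = f x" and \<phi>_x: "\<And>j. j \<in> B \<Longrightarrow> \<phi> j x = 0"
    and in_M: "\<And>y. y \<in> ball x \<delta> \<Longrightarrow> (\<forall>i\<in>A. ereal (fs i y) = f y) \<Longrightarrow> (\<forall>j\<in>B. \<phi> j y = 0) \<Longrightarrow> y \<in> M"
    and simplex: "\<And>\<alpha> \<beta> i. (\<alpha>, \<beta>) \<in> \<Delta> \<Longrightarrow> i \<in> A \<Longrightarrow> \<alpha> i \<ge> 0"
      "\<And>\<alpha> \<beta>. (\<alpha>, \<beta>) \<in> \<Delta> \<Longrightarrow> (\<Sum>i\<in>A. \<alpha> i) = 1"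
    and vertex: "\<And>i. i \<in> A \<Longrightarrow> ((\<lambda>k. if k = i then 1 else 0), (\<lambda>_. 0)) \<in> \<Delta>"
    and single: "\<And>j'. j' \<in> B \<Longrightarrow> \<exists>(\<alpha>, \<beta>)\<in>\<Delta>. \<beta> j' \<noteq> 0 \<and> (\<forall>j\<in>B. j \<noteq> j' \<longrightarrow> \<beta> j = 0)"
    and active: "\<And>y. y \<in> M \<inter> ball x \<delta> \<Longrightarrow> \<exists>i\<in>A. f y = ereal (fs i y)"
    and subgradient_iff: "\<And>y g. y \<in> M \<inter> ball x \<delta> \<Longrightarrow> g \<in> subdifferential f y \<longleftrightarrow>
        (\<exists>(\<alpha>, \<beta>)\<in>\<Delta>.
           (\<forall>i\<in>A. ereal (fs i y) \<noteq> f y \<longrightarrow> \<alpha> i = 0) \<and>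
           (\<forall>j\<in>B. \<phi> j y \<noteq> 0 \<longrightarrow> \<beta> j = 0) \<and>
           g = (\<Sum>i\<in>A. \<alpha> i *\<^sub>R grad (fs i) y) + (\<Sum>j\<in>B. \<beta> j *\<^sub>R grad (\<phi> j) y))"

lemma pdg_structureD:
  assumes "pdg_structure f x M"
  obtains m1 m2 fs \<phi> \<Delta> \<delta> where "pdg f x M {0..m1::nat} {1..m2::nat} fs \<phi> \<Delta> \<delta>"
proof -
  obtain m1 m2 and fs \<phi> :: "nat \<Rightarrow> 'a \<Rightarrow> real" and \<Delta> \<delta> where *: "\<delta> > 0"
        "\<forall>i\<in>{0..m1}. C2_on (ball x \<delta>) (fs i)"
        "\<forall>j\<in>{1..m2}. C2_on (ball x \<delta>) (\<phi> j)"
        and cs: "coefficient_set m1 m2 \<Delta>"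
        and x: "x \<in> {y \<in> ball x \<delta>. (\<forall>i\<in>{0..m1}. ereal (fs i y) = f y) \<and> (\<forall>j\<in>{1..m2}. \<phi> j y = 0)}"
        and sub: "{y \<in> ball x \<delta>. (\<forall>i\<in>{0..m1}. ereal (fs i y) = f y) \<and> (\<forall>j\<in>{1..m2}. \<phi> j y = 0)}
          \<subseteq> M \<inter> ball x \<delta>"
        and splx: "\<forall>(\<alpha>, \<beta>)\<in>\<Delta>. (\<forall>i\<in>{0..m1}. \<alpha> i \<ge> 0) \<and> (\<Sum>i=0..m1. \<alpha> i) = 1"
        and ver: "\<forall>i\<in>{0..m1}. ((\<lambda>k. if k = i then 1 else 0), (\<lambda>_. 0)) \<in> \<Delta>"
        and sing: "\<forall>j'\<in>{1..m2}. \<exists>(\<alpha>, \<beta>)\<in>\<Delta>. \<beta> j' \<noteq> 0 \<and> (\<forall>j\<in>{1..m2}. j \<noteq> j' \<longrightarrow> \<beta> j = 0)"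
        and sd: "\<forall>y \<in> M \<inter> ball x \<delta>.
           (\<exists>i\<in>{0..m1}. f y = ereal (fs i y)) \<and>
           (\<forall>g. g \<in> subdifferential f y \<longleftrightarrow>
              (\<exists>(\<alpha>, \<beta>)\<in>\<Delta>.
                 (\<forall>i\<in>{0..m1}. ereal (fs i y) \<noteq> f y \<longrightarrow> \<alpha> i = 0) \<and>
                 (\<forall>j\<in>{1..m2}. \<phi> j y \<noteq> 0 \<longrightarrow> \<beta> j = 0) \<and>
                 g = (\<Sum>i=0..m1. \<alpha> i *\<^sub>R grad (fs i) y) + (\<Sum>j=1..m2. \<beta> j *\<^sub>R grad (\<phi> j) y)))"
    using assms unfolding pdg_structure_def by (elim conjE exE) rule
  have "pdg f x M {0..m1} {1..m2} fs \<phi> \<Delta> \<delta>"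
  proof
    show "closed \<Delta>" using cs by (simp add: coefficient_set_def)
    show "((\<lambda>i. (1 - t) * \<alpha> i + t * \<alpha>' i), (\<lambda>j. (1 - t) * \<beta> j + t * \<beta>' j)) \<in> \<Delta>"
      if "(\<alpha>, \<beta>) \<in> \<Delta>" "(\<alpha>', \<beta>') \<in> \<Delta>" "t \<in> {0..1}" for \<alpha> \<beta> \<alpha>' \<beta>' t
      using cs that unfolding coefficient_set_def by fast
    show "\<alpha> i = 0" if "(\<alpha>, \<beta>) \<in> \<Delta>" "i \<notin> {0..m1}" for \<alpha> \<beta> i
      using cs that unfolding coefficient_set_def by fast
    show "\<beta> j = 0" if "(\<alpha>, \<beta>) \<in> \<Delta>" "j \<notin> {1..m2}" for \<alpha> \<beta> j
      using cs that unfolding coefficient_set_def by fast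
    show "\<alpha> i \<ge> 0" if "(\<alpha>, \<beta>) \<in> \<Delta>" "i \<in> {0..m1}" for \<alpha> \<beta> i
      using splx that by fast
    show "(\<Sum>i=0..m1. \<alpha> i) = 1" if "(\<alpha>, \<beta>) \<in> \<Delta>" for \<alpha> \<beta>
      using splx that by fast
    show "\<exists>(\<alpha>, \<beta>)\<in>\<Delta>. \<beta> j' \<noteq> 0 \<and> (\<forall>j\<in>{1..m2}. j \<noteq> j' \<longrightarrow> \<beta> j = 0)" if "j' \<in> {1..m2}" for j'
      using sing that by (rule bspec)
    show "\<exists>i\<in>{0..m1}. f y = ereal (fs i y)" if "y \<in> M \<inter> ball x \<delta>" for y
      using bspec[OF sd that] by (rule conjunct1)
    show "g \<in> subdifferential f y \<longleftrightarrow>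
              (\<exists>(\<alpha>, \<beta>)\<in>\<Delta>.
                 (\<forall>i\<in>{0..m1}. ereal (fs i y) \<noteq> f y \<longrightarrow> \<alpha> i = 0) \<and>
                 (\<forall>j\<in>{1..m2}. \<phi> j y \<noteq> 0 \<longrightarrow> \<beta> j = 0) \<and>
                 g = (\<Sum>i=0..m1. \<alpha> i *\<^sub>R grad (fs i) y) + (\<Sum>j=1..m2. \<beta> j *\<^sub>R grad (\<phi> j) y))"
      if "y \<in> M \<inter> ball x \<delta>" for y g
      using bspec[OF sd that] by (elim conjE allE[of _ g])
    show "y \<in> M" if "y \<in> ball x \<delta>" "\<forall>i\<in>{0..m1}. ereal (fs i y) = f y" "\<forall>j\<in>{1..m2}. \<phi> j y = 0" for y
      using sub that by blast
  qed (use * x ver in auto)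
  then show ?thesis by (rule that)
qed

lemma (in pdg) pdg_structure:
  assumes "lsc f"
  shows "pdg_structure f x M"
proof -
  \<comment> \<open>Structure functions are numbered from 0 and constraints from 1, hence the shift
    by one for \<open>A\<close> only.\<close>
  define m1 where "m1 = card A - 1"
  define m2 where "m2 = card B"
  have "card A > 0" using finite_A A_nonempty by (simp add: card_gt_0_iff)
  then have "{0..m1} = {0..<card A}" by (auto simp: m1_def)
  then obtain a where a: "bij_betw a {0..m1} A"
    using ex_bij_betw_nat_finite[OF finite_A] by metis
  have "\<exists>b. bij_betw b {1..m2} B"
    unfolding m2_def using finite_B ex_bij_betw_nat_finite_1 by blast
  then obtain b where b: "bij_betw b {1..m2} B" by blast
  define a' where "a' = the_inv_into {0..m1} a"
  define b' where "b' = the_inv_into {1..m2} b"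
  have a': "a' (a i) = i" if "i \<in> {0..m1}" for i
    using a that unfolding a'_def bij_betw_def by (simp add: the_inv_into_f_f)
  have b': "b' (b j) = j" if "j \<in> {1..m2}" for j
    using b that unfolding b'_def bij_betw_def by (simp add: the_inv_into_f_f)
  have aa': "a (a' p) = p" "a' p \<in> {0..m1}" if "p \<in> A" for p
    using a that f_the_inv_into_f[of a "{0..m1}" p] the_inv_into_into[of a "{0..m1}" p "{0..m1}"]
    unfolding a'_def bij_betw_def by auto
  have bb': "b (b' q) = q" "b' q \<in> {1..m2}" if "q \<in> B" for q
    using b that f_the_inv_into_f[of b "{1..m2}" q] the_inv_into_into[of b "{1..m2}" q "{1..m2}"]
    unfolding b'_def bij_betw_def by auto
  have aA: "a i \<in> A" if "i \<in> {0..m1}" for i using a that bij_betwE by blast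
  have bB: "b j \<in> B" if "j \<in> {1..m2}" for j using b that bij_betwE by blast
  define T :: "(nat \<Rightarrow> real) \<times> (nat \<Rightarrow> real) \<Rightarrow> ('p \<Rightarrow> real) \<times> ('q \<Rightarrow> real)"
    where "T = (\<lambda>z. ((\<lambda>p. if p \<in> A then fst z (a' p) else 0), (\<lambda>q. if q \<in> B then snd z (b' q) else 0)))"
  define R :: "('p \<Rightarrow> real) \<times> ('q \<Rightarrow> real) \<Rightarrow> (nat \<Rightarrow> real) \<times> (nat \<Rightarrow> real)"
    where "R = (\<lambda>z. ((\<lambda>i. if i \<in> {0..m1} then fst z (a i) else 0), (\<lambda>j. if j \<in> {1..m2} then snd z (b j) else 0)))"
  \<comment> \<open>A preimage under \<open>T\<close> rather than an image under \<open>R\<close>,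
    so that closedness follows from continuity.\<close>
  define D where "D = {z. (\<forall>i. i \<notin> {0..m1} \<longrightarrow> fst z i = 0) \<and> (\<forall>j. j \<notin> {1..m2} \<longrightarrow> snd z j = 0) \<and> T z \<in> \<Delta>}"
  have TR: "T (R (\<alpha>, \<beta>)) = (\<alpha>, \<beta>)" if "(\<alpha>, \<beta>) \<in> \<Delta>" for \<alpha> \<beta>
    using zero_outside[OF that] aa' bb' by (auto simp: T_def R_def fun_eq_iff)
  have RD: "R (\<alpha>, \<beta>) \<in> D" if "(\<alpha>, \<beta>) \<in> \<Delta>" for \<alpha> \<beta>
  proof -
    have "T (R (\<alpha>, \<beta>)) \<in> \<Delta>" using TR[OF that] that by simp
    then show ?thesis by (simp add: D_def) (simp add: R_def)
  qed
  have sumA: "(\<Sum>i\<in>A. k i) = (\<Sum>i=0..m1. k (a i))" for k :: "'p \<Rightarrow> 'z::comm_monoid_add"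
    using sum.reindex_bij_betw[OF a, of k] by simp
  have sumB: "(\<Sum>i\<in>B. k i) = (\<Sum>i=1..m2. k (b i))" for k :: "'q \<Rightarrow> 'z::comm_monoid_add"
    using sum.reindex_bij_betw[OF b, of k] by simp
  have closedD: "closed D"
  proof -
    have cT: "continuous_on UNIV T"
    proof -
      have "continuous_on UNIV (\<lambda>z :: (nat \<Rightarrow> real) \<times> (nat \<Rightarrow> real). if p \<in> A then fst z (a' p) else 0)" for p
        by (cases "p \<in> A") (simp_all add:
            continuous_on_product_then_coordinatewise[OF continuous_on_fst[OF continuous_on_id]])
      moreover have "continuous_on UNIV (\<lambda>z :: (nat \<Rightarrow> real) \<times> (nat \<Rightarrow> real). if q \<in> B then snd z (b' q) else 0)" for q
        by (cases "q \<in> B") (simp_all add: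
            continuous_on_product_then_coordinatewise[OF continuous_on_snd[OF continuous_on_id]])
      ultimately show ?thesis
        unfolding T_def by (intro continuous_on_Pair continuous_on_coordinatewise_then_product)
    qed
    have "D = (\<Inter>i\<in>-{0..m1}. {z. fst z i = 0}) \<inter> (\<Inter>j\<in>-{1..m2}. {z. snd z j = 0}) \<inter> T -` \<Delta>"
      by (auto simp: D_def)
    also have "closed \<dots>"
      by (intro closed_Int closed_INT ballI closed_Collect_eq closed_vimage closed_\<Delta> cT continuous_on_const
          continuous_on_product_then_coordinatewise[OF continuous_on_fst[OF continuous_on_id]]
          continuous_on_product_then_coordinatewise[OF continuous_on_snd[OF continuous_on_id]])
    finally show ?thesis .
  qed
  have comb: "((\<lambda>i. (1 - t) * \<alpha> i + t * \<alpha>' i), (\<lambda>j. (1 - t) * \<beta> j + t * \<beta>' j)) \<in> D"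
    if z: "(\<alpha>, \<beta>) \<in> D" "(\<alpha>', \<beta>') \<in> D" "t \<in> {0..1}" for \<alpha> \<beta> \<alpha>' \<beta>' t
  proof -
    have "T (\<alpha>, \<beta>) \<in> \<Delta>" "T (\<alpha>', \<beta>') \<in> \<Delta>" using z by (auto simp: D_def)
    from convex_\<Delta>[OF this[unfolded T_def] z(3)]
    have "T ((\<lambda>i. (1 - t) * \<alpha> i + t * \<alpha>' i), (\<lambda>j. (1 - t) * \<beta> j + t * \<beta>' j)) \<in> \<Delta>"
      by (rule back_subst[where P = "\<lambda>z. z \<in> \<Delta>"]) (auto simp: T_def fun_eq_iff)
    then show ?thesis using z by (auto simp: D_def)
  qed
  have cs: "coefficient_set m1 m2 D"
    unfolding coefficient_set_def
  proof (intro conjI ballI)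
    show "closed D" by (rule closedD)
    show "case z of (\<alpha>, \<beta>) \<Rightarrow> (\<forall>i. i \<notin> {0..m1} \<longrightarrow> \<alpha> i = 0) \<and> (\<forall>j. j \<notin> {1..m2} \<longrightarrow> \<beta> j = 0)"
      if "z \<in> D" for z
      using that by (auto simp: D_def)
    show "case z of (\<alpha>, \<beta>) \<Rightarrow> \<forall>(\<alpha>', \<beta>')\<in>D. \<forall>t\<in>{0..1}.
        ((\<lambda>i. (1 - t) * \<alpha> i + t * \<alpha>' i), (\<lambda>j. (1 - t) * \<beta> j + t * \<beta>' j)) \<in> D"
      if "z \<in> D" for z
      using comb that by (cases z) auto
  qed
  have DT: "(\<lambda>p. if p \<in> A then \<alpha> (a' p) else 0, \<lambda>q. if q \<in> B then \<beta> (b' q) else 0) \<in> \<Delta>"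
    if "(\<alpha>, \<beta>) \<in> D" for \<alpha> \<beta>
    using that unfolding D_def T_def mem_Collect_eq fst_conv snd_conv by blast
  have splx: "(\<forall>i\<in>{0..m1}. \<alpha> i \<ge> 0) \<and> (\<Sum>i=0..m1. \<alpha> i) = 1" if "(\<alpha>, \<beta>) \<in> D" for \<alpha> \<beta>
  proof
    show "\<forall>i\<in>{0..m1}. \<alpha> i \<ge> 0"
    proof
      fix i assume i: "i \<in> {0..m1}"
      show "\<alpha> i \<ge> 0"
        using simplex(1)[OF DT[OF that] aA[OF i]] aA[OF i] a'[OF i] by simp
    qed
    have "(\<Sum>i=0..m1. \<alpha> i) = (\<Sum>p\<in>A. if p \<in> A then \<alpha> (a' p) else 0)"
      unfolding sumA using aA a' by (intro sum.cong) auto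
    also have "\<dots> = 1"
      by (rule simplex(2)[OF DT[OF that]])
    finally show "(\<Sum>i=0..m1. \<alpha> i) = 1" .
  qed
  have ver: "((\<lambda>k. if k = i then 1 else 0), (\<lambda>_. 0)) \<in> D" if i: "i \<in> {0..m1}" for i
  proof -
    have "R ((\<lambda>k. if k = a i then 1 else 0), (\<lambda>_. 0)) = ((\<lambda>k. if k = i then 1 else 0), (\<lambda>_. 0))"
      using i a' by (auto simp: R_def fun_eq_iff) (metis atLeastAtMost_iff zero_le)
    then show ?thesis using RD[OF vertex[OF aA[OF i]]] by simp
  qed
  have sing: "\<exists>(\<alpha>, \<beta>)\<in>D. \<beta> j' \<noteq> 0 \<and> (\<forall>j\<in>{1..m2}. j \<noteq> j' \<longrightarrow> \<beta> j = 0)" if j': "j' \<in> {1..m2}" for j'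
  proof -
    obtain \<alpha> \<beta> where ab: "(\<alpha>, \<beta>) \<in> \<Delta>" "\<beta> (b j') \<noteq> 0" "\<And>q. q \<in> B \<Longrightarrow> q \<noteq> b j' \<Longrightarrow> \<beta> q = 0"
      using single[OF bB[OF j']] by blast
    have "\<beta> (b j) = 0" if "j \<in> {1..m2}" "j \<noteq> j'" for j
      using that b' j' by (intro ab(3) bB) metis+
    then have "snd (R (\<alpha>, \<beta>)) j' \<noteq> 0 \<and> (\<forall>j\<in>{1..m2}. j \<noteq> j' \<longrightarrow> snd (R (\<alpha>, \<beta>)) j = 0)"
      using ab(2) j' by (simp add: R_def)
    then show ?thesis
      using RD[OF ab(1)] by (intro bexI[of _ "R (\<alpha>, \<beta>)"]) (auto simp: case_prod_beta)
  qed
  have sd: "g \<in> subdifferential f y \<longleftrightarrow>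
        (\<exists>(\<alpha>, \<beta>)\<in>D.
           (\<forall>i\<in>{0..m1}. ereal (fs (a i) y) \<noteq> f y \<longrightarrow> \<alpha> i = 0) \<and>
           (\<forall>j\<in>{1..m2}. \<phi> (b j) y \<noteq> 0 \<longrightarrow> \<beta> j = 0) \<and>
           g = (\<Sum>i=0..m1. \<alpha> i *\<^sub>R grad (fs (a i)) y) + (\<Sum>j=1..m2. \<beta> j *\<^sub>R grad (\<phi> (b j)) y))"
    (is "_ \<longleftrightarrow> ?rhs") if y: "y \<in> M \<inter> ball x \<delta>" for y g
  proof
    assume "g \<in> subdifferential f y"
    then obtain \<alpha> \<beta> where ab: "(\<alpha>, \<beta>) \<in> \<Delta>" "\<forall>i\<in>A. ereal (fs i y) \<noteq> f y \<longrightarrow> \<alpha> i = 0"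
           "\<forall>j\<in>B. \<phi> j y \<noteq> 0 \<longrightarrow> \<beta> j = 0"
           "g = (\<Sum>i\<in>A. \<alpha> i *\<^sub>R grad (fs i) y) + (\<Sum>j\<in>B. \<beta> j *\<^sub>R grad (\<phi> j) y)"
      using subgradient_iff[OF y] by blast
    show ?rhs
      using RD[OF ab(1)] ab(2,3) aA bB unfolding ab(4) sumA sumB
      by (intro bexI[of _ "R (\<alpha>, \<beta>)"]) (auto simp: R_def intro!: arg_cong2[where f = "(+)"] sum.cong)
  next
    assume ?rhs
    then obtain \<alpha> \<beta> where ab: "(\<alpha>, \<beta>) \<in> D"
           "\<forall>i\<in>{0..m1}. ereal (fs (a i) y) \<noteq> f y \<longrightarrow> \<alpha> i = 0"
           "\<forall>j\<in>{1..m2}. \<phi> (b j) y \<noteq> 0 \<longrightarrow> \<beta> j = 0"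
           "g = (\<Sum>i=0..m1. \<alpha> i *\<^sub>R grad (fs (a i)) y) + (\<Sum>j=1..m2. \<beta> j *\<^sub>R grad (\<phi> (b j)) y)"
      by blast
    show "g \<in> subdifferential f y"
      unfolding subgradient_iff[OF y]
    proof (intro bexI[OF _ DT[OF ab(1)]] case_prodI conjI ballI impI)
      show "(if i \<in> A then \<alpha> (a' i) else 0) = 0" if "i \<in> A" "ereal (fs i y) \<noteq> f y" for i
        using ab(2) aa'[OF that(1)] that by (metis (no_types, lifting))
      show "(if j \<in> B then \<beta> (b' j) else 0) = 0" if "j \<in> B" "\<phi> j y \<noteq> 0" for j
        using ab(3) bb'[OF that(1)] that by (metis (no_types, lifting))
      show "g = (\<Sum>i\<in>A. (if i \<in> A then \<alpha> (a' i) else 0) *\<^sub>R grad (fs i) y) +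
          (\<Sum>j\<in>B. (if j \<in> B then \<beta> (b' j) else 0) *\<^sub>R grad (\<phi> j) y)"
        unfolding ab(4) sumA sumB using a' b' aA bB
        by (intro arg_cong2[where f = "(+)"] sum.cong) auto
    qed
  qed
  have act: "\<exists>i\<in>{0..m1}. f y = ereal (fs (a i) y)" if "y \<in> M \<inter> ball x \<delta>" for y
    using active[OF that] aa' by metis
  have inM: "y \<in> M" if "y \<in> ball x \<delta>" "\<forall>i\<in>{0..m1}. ereal (fs (a i) y) = f y" "\<forall>j\<in>{1..m2}. \<phi> (b j) y = 0" for y
    using in_M[OF that(1)] that(2,3) aa' bb' by metis
  show ?thesis
    unfolding pdg_structure_def
  proof (rule conjI[OF assms], rule exI[of _ m1], rule exI[of _ m2], rule exI[of _ "\<lambda>i. fs (a i)"],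
      rule exI[of _ "\<lambda>j. \<phi> (b j)"], rule exI[of _ D], rule exI[of _ \<delta>], intro conjI ballI allI)
    show "\<delta> > 0" "coefficient_set m1 m2 D" by (rule \<delta> cs)+
    show "C2_on (ball x \<delta>) (fs (a i))" if "i \<in> {0..m1}" for i
      by (rule C2_fs[OF aA[OF that]])
    show "C2_on (ball x \<delta>) (\<phi> (b j))" if "j \<in> {1..m2}" for j
      by (rule C2_\<phi>[OF bB[OF that]])
    show "x \<in> {y \<in> ball x \<delta>. (\<forall>i\<in>{0..m1}. ereal (fs (a i) y) = f y) \<and> (\<forall>j\<in>{1..m2}. \<phi> (b j) y = 0)}"
      using \<delta> fs_x[OF aA] \<phi>_x[OF bB] by simp
    show "{y \<in> ball x \<delta>. (\<forall>i\<in>{0..m1}. ereal (fs (a i) y) = f y) \<and> (\<forall>j\<in>{1..m2}. \<phi> (b j) y = 0)}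
        \<subseteq> M \<inter> ball x \<delta>"
      using inM by blast
    show "case z of (\<alpha>, \<beta>) \<Rightarrow> (\<forall>i\<in>{0..m1}. 0 \<le> \<alpha> i) \<and> (\<Sum>i=0..m1. \<alpha> i) = 1" if "z \<in> D" for z
      using splx that by blast
    show "((\<lambda>k. if k = i then 1 else 0), (\<lambda>_. 0)) \<in> D" if "i \<in> {0..m1}" for i
      by (rule ver[OF that])
    show "\<exists>(\<alpha>, \<beta>)\<in>D. \<beta> j' \<noteq> 0 \<and> (\<forall>j\<in>{1..m2}. j \<noteq> j' \<longrightarrow> \<beta> j = 0)" if "j' \<in> {1..m2}" for j'
      by (rule sing[OF that])
    show "\<exists>i\<in>{0..m1}. f y = ereal (fs (a i) y)" if "y \<in> M \<inter> ball x \<delta>" for y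
      by (rule act[OF that])
  qed (rule sd)
qed

text \<open>Coefficients of \<open>\<nabla>q + (\<Sum>l. c l *\<^sub>R (\<nabla>fs l - \<nabla>q)) + (\<Sum>j. b j *\<^sub>R \<nabla>\<phi> j)\<close> for
  which this vector is a subgradient whenever \<open>\<nabla>q\<close> is one: write \<open>\<nabla>q\<close> with coefficients
  in \<open>\<Delta>\<close> and collect terms.\<close>

definition shifted_coefficients ::
    "'p set \<Rightarrow> (('p \<Rightarrow> real) \<times> ('q \<Rightarrow> real)) set \<Rightarrow> (('p \<Rightarrow> real) \<times> ('q \<Rightarrow> real)) set" where
  "shifted_coefficients A \<Delta> = {(c, b). \<forall>(\<alpha>, \<beta>)\<in>\<Delta>.
     ((\<lambda>l. c l + (1 - (\<Sum>l\<in>A. c l)) * \<alpha> l), (\<lambda>j. b j + (1 - (\<Sum>l\<in>A. c l)) * \<beta> j)) \<in> \<Delta>}"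

lemma shifted_coefficientsD:
  "(c, b) \<in> shifted_coefficients A \<Delta> \<Longrightarrow> (\<alpha>, \<beta>) \<in> \<Delta> \<Longrightarrow>
    ((\<lambda>l. c l + (1 - (\<Sum>l\<in>A. c l)) * \<alpha> l), (\<lambda>j. b j + (1 - (\<Sum>l\<in>A. c l)) * \<beta> j)) \<in> \<Delta>"
  unfolding shifted_coefficients_def by blast

lemma shifted_coefficients_zero: "((\<lambda>_. 0), (\<lambda>_. 0)) \<in> shifted_coefficients A \<Delta>"
  unfolding shifted_coefficients_def by auto

text \<open>For fixed \<open>(\<alpha>, \<beta>)\<close> the condition is affine in
  \<open>(c, b)\<close>. The set is thus an intersection of affine preimages of \<Delta>, which
  transfers convexity and, in the next lemma, closedness.\<close>

lemma shifted_coefficients_convex: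
  assumes conv: "\<And>\<alpha> \<beta> \<alpha>' \<beta>' t. (\<alpha>, \<beta>) \<in> \<Delta> \<Longrightarrow> (\<alpha>', \<beta>') \<in> \<Delta> \<Longrightarrow> t \<in> {0..1} \<Longrightarrow>
        ((\<lambda>i. (1 - t) * \<alpha> i + t * \<alpha>' i), (\<lambda>j. (1 - t) * \<beta> j + t * \<beta>' j)) \<in> \<Delta>"
    and c: "(c, b) \<in> shifted_coefficients A \<Delta>" "(c', b') \<in> shifted_coefficients A \<Delta>" and t: "t \<in> {0..1}"
  shows "((\<lambda>i. (1 - t) * c i + t * c' i), (\<lambda>j. (1 - t) * b j + t * b' j)) \<in> shifted_coefficients A \<Delta>"
  unfolding shifted_coefficients_def
proof (intro CollectI case_prodI ballI, clarify)
  fix \<alpha> \<beta> assume ab: "(\<alpha>, \<beta>) \<in> \<Delta>"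
  have sum: "(\<Sum>l\<in>A. (1 - t) * c l + t * c' l) = (1 - t) * (\<Sum>l\<in>A. c l) + t * (\<Sum>l\<in>A. c' l)"
    by (simp add: sum.distrib sum_distrib_left)
  show "((\<lambda>l. (1 - t) * c l + t * c' l + (1 - (\<Sum>l\<in>A. (1 - t) * c l + t * c' l)) * \<alpha> l),
      (\<lambda>j. (1 - t) * b j + t * b' j + (1 - (\<Sum>l\<in>A. (1 - t) * c l + t * c' l)) * \<beta> j)) \<in> \<Delta>"
    using conv[OF shifted_coefficientsD[OF c(1) ab] shifted_coefficientsD[OF c(2) ab] t]
    unfolding sum by (rule back_subst[where P = "\<lambda>z. z \<in> \<Delta>"]) (simp add: fun_eq_iff algebra_simps)
qed

lemma closed_shifted_coefficients:
  fixes \<Delta> :: "(('p \<Rightarrow> real) \<times> ('q \<Rightarrow> real)) set"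
  assumes "closed \<Delta>"
  shows "closed (shifted_coefficients A \<Delta>)"
proof -
  have c: "continuous_on UNIV (\<lambda>z :: ('p \<Rightarrow> real) \<times> ('q \<Rightarrow> real). fst z i)"
    "continuous_on UNIV (\<lambda>z :: ('p \<Rightarrow> real) \<times> ('q \<Rightarrow> real). snd z j)" for i j
    by (rule continuous_on_product_then_coordinatewise[OF continuous_on_fst[OF continuous_on_id]],
        rule continuous_on_product_then_coordinatewise[OF continuous_on_snd[OF continuous_on_id]])
  have "continuous_on UNIV (\<lambda>z :: ('p \<Rightarrow> real) \<times> ('q \<Rightarrow> real).
      ((\<lambda>l. fst z l + (1 - (\<Sum>l\<in>A. fst z l)) * \<alpha> l), (\<lambda>j. snd z j + (1 - (\<Sum>l\<in>A. fst z l)) * \<beta> j)))"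
    for \<alpha> \<beta>
    by (intro continuous_on_Pair continuous_on_coordinatewise_then_product continuous_intros c)
  then have "closed (\<Inter>w\<in>\<Delta>. (\<lambda>z. ((\<lambda>l. fst z l + (1 - (\<Sum>l\<in>A. fst z l)) * fst w l),
      (\<lambda>j. snd z j + (1 - (\<Sum>l\<in>A. fst z l)) * snd w j))) -` \<Delta>)"
    by (intro closed_INT ballI closed_vimage assms)
  also have "(\<Inter>w\<in>\<Delta>. (\<lambda>z. ((\<lambda>l. fst z l + (1 - (\<Sum>l\<in>A. fst z l)) * fst w l),
      (\<lambda>j. snd z j + (1 - (\<Sum>l\<in>A. fst z l)) * snd w j))) -` \<Delta>) = shifted_coefficients A \<Delta>"
    unfolding shifted_coefficients_def by (auto simp: case_prod_beta)
  finally show ?thesis .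
qed

text \<open>Weights with sum 1 leave the factor 0 for the added element of \<Delta>; they describe
  the combinations from which \<open>\<nabla>q\<close> cancels.\<close>

lemma (in pdg) coefficients_subset_shifted: "\<Delta> \<subseteq> shifted_coefficients A \<Delta>"
  unfolding shifted_coefficients_def by (auto simp: simplex(2))

section \<open>Structure functions, constraints and coefficients for the separable sum\<close>

locale separable_pdg =
  fixes f :: "'k::finite \<Rightarrow> 'a::euclidean_space \<Rightarrow> ereal" and x :: "'a ^ 'k" and M :: "'k \<Rightarrow> 'a set"
    and A :: "'k \<Rightarrow> 'p set" and B :: "'k \<Rightarrow> 'q set"
    and fs :: "'k \<Rightarrow> 'p \<Rightarrow> 'a \<Rightarrow> real" and \<phi> :: "'k \<Rightarrow> 'q \<Rightarrow> 'a \<Rightarrow> real"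
    and \<Delta> :: "'k \<Rightarrow> (('p \<Rightarrow> real) \<times> ('q \<Rightarrow> real)) set" and \<delta> :: "'k \<Rightarrow> real"
    and q :: "'k \<Rightarrow> 'a \<Rightarrow> real" and r :: real
  assumes pdg: "\<And>i. pdg (f i) (x $ i) (M i) (A i) (B i) (fs i) (\<phi> i) (\<Delta> i) (\<delta> i)"
    and lsc: "\<And>i. lsc (f i)"
    and r: "r > 0" "\<And>i. r \<le> \<delta> i"
    and C2_q: "\<And>i. C2_on (ball (x $ i) r) (q i)"
    and q_le: "\<And>i y. y \<in> ball (x $ i) r \<Longrightarrow> ereal (q i y) \<le> f i y"
    and q_eq_iff: "\<And>i y. y \<in> ball (x $ i) r \<Longrightarrow> ereal (q i y) = f i y \<longleftrightarrow> y \<in> M i"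
begin

definition "S1 = (SIGMA i:UNIV. A i)"
definition "S2 = (SIGMA i:UNIV. B i)"
definition "AA = insert None (Some ` S1)"
definition "BB = Inl ` S1 \<union> Inr ` S2"

definition Qs :: "'a ^ 'k \<Rightarrow> real" where "Qs z = (\<Sum>i\<in>UNIV. q i (z $ i))"

fun gap :: "'k \<times> 'p \<Rightarrow> 'a ^ 'k \<Rightarrow> real" where
  "gap (i, l) z = fs i l (z $ i) - q i (z $ i)"

text \<open>The gaps occur twice. As constraints \<open>Inl s\<close> they carry the weights of an
  arbitrary subgradient, block by block. The copies \<open>Some s\<close> serve for coefficient
  vectors in which a single constraint \<open>Inr (i, j)\<close> is nonzero: the weights that
  accompany it in \<open>\<Delta> i\<close> must then not be stored in \<open>Inl\<close>
  entries.\<close>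

fun hs :: "('k \<times> 'p) option \<Rightarrow> 'a ^ 'k \<Rightarrow> real" where
  "hs None z = Qs z"
| "hs (Some s) z = Qs z + gap s z"

fun h\<phi> :: "('k \<times> 'p) + ('k \<times> 'q) \<Rightarrow> 'a ^ 'k \<Rightarrow> real" where
  "h\<phi> (Inl s) z = gap s z"
| "h\<phi> (Inr (i, j)) z = \<phi> i j (z $ i)"

lemma gap_hs_eqs:
  "gap (i, l) = (\<lambda>z. fs i l (z $ i) - q i (z $ i))" "hs None = Qs" "hs (Some s) = (\<lambda>z. Qs z + gap s z)"
  "h\<phi> (Inl s) = gap s" "h\<phi> (Inr (i, j)) = (\<lambda>z. \<phi> i j (z $ i))"
  by (simp_all add: fun_eq_iff)

text \<open>The gradient of \<open>gap (i, l)\<close> is multiplied by the coefficients of both its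
  copies, hence the sum. The result is the pair \<open>(c, b)\<close> of
  \<open>shifted_coefficients\<close> that describes the subgradient in block
  \<open>i\<close>.\<close>

definition block :: "'k \<Rightarrow> (('k \<times> 'p) option \<Rightarrow> real) \<times> (('k \<times> 'p) + ('k \<times> 'q) \<Rightarrow> real) \<Rightarrow>
    ('p \<Rightarrow> real) \<times> ('q \<Rightarrow> real)" where
  "block i z = ((\<lambda>l. fst z (Some (i, l)) + snd z (Inl (i, l))), (\<lambda>j. snd z (Inr (i, j))))"

definition \<Delta>h :: "((('k \<times> 'p) option \<Rightarrow> real) \<times> (('k \<times> 'p) + ('k \<times> 'q) \<Rightarrow> real)) set" where
  "\<Delta>h = {z. (\<forall>p. p \<notin> AA \<longrightarrow> fst z p = 0) \<and> (\<forall>p. p \<notin> BB \<longrightarrow> snd z p = 0) \<and>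
     (\<forall>p\<in>AA. 0 \<le> fst z p) \<and> (\<Sum>p\<in>AA. fst z p) = 1 \<and>
     (\<forall>i. block i z \<in> shifted_coefficients (A i) (\<Delta> i))}"

lemma finite_S: "finite S1" "finite S2"
  unfolding S1_def S2_def using pdg.finite_A[OF pdg] pdg.finite_B[OF pdg] by auto

lemma finite_AA: "finite AA" and finite_BB: "finite BB"
  unfolding AA_def BB_def using finite_S by auto

lemma mem_AA: "None \<in> AA" "Some (i, l) \<in> AA \<longleftrightarrow> l \<in> A i"
  by (auto simp: AA_def S1_def)

lemma mem_BB: "Inl (i, l) \<in> BB \<longleftrightarrow> l \<in> A i" "Inr (i, j) \<in> BB \<longleftrightarrow> j \<in> B i"
  by (auto simp: BB_def S1_def S2_def)

lemma sum_AA: "(\<Sum>p\<in>AA. k p) = k None + (\<Sum>s\<in>S1. k (Some s))"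
  for k :: "('k \<times> 'p) option \<Rightarrow> 'z::comm_monoid_add"
  unfolding AA_def using finite_S by (subst sum.insert) (auto simp: sum.reindex)

lemma sum_BB: "(\<Sum>p\<in>BB. k p) = (\<Sum>s\<in>S1. k (Inl s)) + (\<Sum>s\<in>S2. k (Inr s))"
  for k :: "('k \<times> 'p) + ('k \<times> 'q) \<Rightarrow> 'z::comm_monoid_add"
  unfolding BB_def using finite_S by (subst sum.union_disjoint) (auto simp: sum.reindex)

lemma in_block_ball: "z \<in> ball x r \<Longrightarrow> z $ i \<in> ball (x $ i) r"
  using dist_vec_nth_le[of x i z] by simp

lemma in_block_ball_\<delta>: "z \<in> ball x r \<Longrightarrow> z $ i \<in> ball (x $ i) (\<delta> i)"
  using in_block_ball[of z i] r(2)[of i] by simp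

lemma C2_fs: "l \<in> A i \<Longrightarrow> C2_on (ball (x $ i) r) (fs i l)"
  using C2_on_subset[OF pdg.C2_fs[OF pdg]] r(2) subset_ball by metis

lemma C2_\<phi>: "j \<in> B i \<Longrightarrow> C2_on (ball (x $ i) r) (\<phi> i j)"
  using C2_on_subset[OF pdg.C2_\<phi>[OF pdg]] r(2) subset_ball by metis

lemma C2_Qs: "C2_on (ball x r) Qs"
  unfolding Qs_def[abs_def] by (intro C2_on_sum C2_on_nth C2_q)

lemma C2_gap: "s \<in> S1 \<Longrightarrow> C2_on (ball x r) (gap s)"
  by (cases s) (auto simp: S1_def gap_hs_eqs intro!: C2_on_diff C2_on_nth C2_q C2_fs)

lemma C2_hs: "p \<in> AA \<Longrightarrow> C2_on (ball x r) (hs p)"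
  by (cases p) (auto simp: AA_def gap_hs_eqs(2,3) intro!: C2_on_add C2_Qs C2_gap)

lemma C2_h\<phi>: "p \<in> BB \<Longrightarrow> C2_on (ball x r) (h\<phi> p)"
  by (auto simp: BB_def S2_def gap_hs_eqs(4,5) intro!: C2_gap C2_on_nth C2_\<phi>)

lemma GDERIV_Qs:
  assumes z: "z \<in> ball x r"
  shows "GDERIV Qs z :> (\<chi> i. grad (q i) (z $ i))"
proof -
  have "GDERIV Qs z :> (\<Sum>i\<in>UNIV. axis i (grad (q i) (z $ i)))"
    unfolding Qs_def[abs_def]
    by (intro GDERIV_sum GDERIV_nth C2_on_GDERIV[OF C2_q open_ball in_block_ball[OF z]])
  also have "(\<Sum>i\<in>UNIV. axis i (grad (q i) (z $ i))) = (\<chi> i. grad (q i) (z $ i))"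
    by (simp add: vec_eq_iff axis_def if_distrib cong: if_cong)
  finally show ?thesis .
qed

lemma GDERIV_gap:
  assumes z: "z \<in> ball x r" and l: "l \<in> A i"
  shows "GDERIV (gap (i, l)) z :> axis i (grad (fs i l) (z $ i) - grad (q i) (z $ i))"
proof -
  have "GDERIV (\<lambda>z. fs i l (z $ i) - q i (z $ i)) z :>
      axis i (grad (fs i l) (z $ i)) - axis i (grad (q i) (z $ i))"
    by (intro GDERIV_diff GDERIV_nth C2_on_GDERIV[OF C2_q open_ball in_block_ball[OF z]]
        C2_on_GDERIV[OF C2_fs[OF l] open_ball in_block_ball[OF z]])
  moreover have "axis i (grad (fs i l) (z $ i)) - axis i (grad (q i) (z $ i)) =
      axis i (grad (fs i l) (z $ i) - grad (q i) (z $ i))"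
    by (simp add: vec_eq_iff axis_def)
  ultimately show ?thesis by (simp add: gap_hs_eqs(1))
qed

lemma nth_sum_Sigma_axis:
  fixes w :: "'k \<Rightarrow> 's \<Rightarrow> 'a"
  assumes "\<And>i. finite (S i)"
  shows "(\<Sum>s\<in>(SIGMA i:UNIV. S i). a s *\<^sub>R (case s of (i, l) \<Rightarrow> axis i (w i l))) $ k =
    (\<Sum>l\<in>S k. a (k, l) *\<^sub>R w k l)"
proof -
  have "(\<Sum>s\<in>(SIGMA i:UNIV. S i). a s *\<^sub>R (case s of (i, l) \<Rightarrow> axis i (w i l))) $ k =
      (\<Sum>i\<in>UNIV. \<Sum>l\<in>S i. (a (i, l) *\<^sub>R axis i (w i l)) $ k)"
    using assms by (subst sum.Sigma) (auto simp: case_prod_beta)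
  also have "\<dots> = (\<Sum>i\<in>UNIV. if i = k then (\<Sum>l\<in>S k. a (k, l) *\<^sub>R w k l) else 0)"
    by (intro sum.cong) (auto simp: axis_def)
  also have "\<dots> = (\<Sum>l\<in>S k. a (k, l) *\<^sub>R w k l)" by simp
  finally show ?thesis .
qed

text \<open>Every \<open>hs p\<close> contains \<open>Qs\<close>, so weights of total 1 contribute
  its gradient exactly once; each remaining gradient lives in a single block.\<close>

lemma gradient_combination_nth:
  assumes z: "z \<in> ball x r" and one: "(\<Sum>p\<in>AA. \<alpha> p) = 1"
  shows "((\<Sum>p\<in>AA. \<alpha> p *\<^sub>R grad (hs p) z) + (\<Sum>p\<in>BB. \<beta> p *\<^sub>R grad (h\<phi> p) z)) $ k =
    grad (q k) (z $ k) +
    (\<Sum>l\<in>A k. (\<alpha> (Some (k, l)) + \<beta> (Inl (k, l))) *\<^sub>R (grad (fs k l) (z $ k) - grad (q k) (z $ k))) +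
    (\<Sum>j\<in>B k. \<beta> (Inr (k, j)) *\<^sub>R grad (\<phi> k j) (z $ k))"
proof -
  let ?Q = "\<chi> i. grad (q i) (z $ i)"
  let ?E = "\<lambda>(i, l). axis i (grad (fs i l) (z $ i) - grad (q i) (z $ i)) :: 'a ^ 'k"
  let ?F = "\<lambda>(i, j). axis i (grad (\<phi> i j) (z $ i)) :: 'a ^ 'k"
  have gN: "grad (hs None) z = ?Q"
    using grad_eqI[OF GDERIV_Qs[OF z]] by (simp add: gap_hs_eqs(2))
  have gap: "GDERIV (gap s) z :> ?E s" if "s \<in> S1" for s
    using that GDERIV_gap[OF z] by (cases s) (auto simp: S1_def)
  have gS: "grad (hs (Some s)) z = ?Q + ?E s" if "s \<in> S1" for s
    using grad_eqI[OF GDERIV_add[OF GDERIV_Qs[OF z] gap[OF that]]] by (simp add: gap_hs_eqs(3))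
  have gL: "grad (h\<phi> (Inl s)) z = ?E s" if "s \<in> S1" for s
    using grad_eqI[OF gap[OF that]] by (simp add: gap_hs_eqs(4))
  have gR: "grad (h\<phi> (Inr s)) z = ?F s" if s: "s \<in> S2" for s
  proof -
    obtain i j where ij: "s = (i, j)" "j \<in> B i" using s by (auto simp: S2_def)
    have "GDERIV (\<lambda>z. \<phi> i j (z $ i)) z :> axis i (grad (\<phi> i j) (z $ i))"
      by (intro GDERIV_nth C2_on_GDERIV[OF C2_\<phi>[OF ij(2)] open_ball in_block_ball[OF z]])
    then show ?thesis
      using grad_eqI by (simp add: ij gap_hs_eqs(5))
  qed
  have "(\<Sum>p\<in>AA. \<alpha> p *\<^sub>R grad (hs p) z) = \<alpha> None *\<^sub>R ?Q + (\<Sum>s\<in>S1. \<alpha> (Some s) *\<^sub>R (?Q + ?E s))"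
    unfolding sum_AA gN by (simp add: gS cong: sum.cong)
  also have "\<dots> = (\<alpha> None + (\<Sum>s\<in>S1. \<alpha> (Some s))) *\<^sub>R ?Q + (\<Sum>s\<in>S1. \<alpha> (Some s) *\<^sub>R ?E s)"
    by (simp add: scaleR_add_right scaleR_add_left sum.distrib scaleR_sum_left)
  also have "\<dots> = ?Q + (\<Sum>s\<in>S1. \<alpha> (Some s) *\<^sub>R ?E s)"
    using one unfolding sum_AA by simp
  finally have 1: "(\<Sum>p\<in>AA. \<alpha> p *\<^sub>R grad (hs p) z) = ?Q + (\<Sum>s\<in>S1. \<alpha> (Some s) *\<^sub>R ?E s)" .
  have 2: "(\<Sum>p\<in>BB. \<beta> p *\<^sub>R grad (h\<phi> p) z) = (\<Sum>s\<in>S1. \<beta> (Inl s) *\<^sub>R ?E s) + (\<Sum>s\<in>S2. \<beta> (Inr s) *\<^sub>R ?F s)"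
    unfolding sum_BB by (simp add: gL gR cong: sum.cong)
  have "(\<Sum>p\<in>AA. \<alpha> p *\<^sub>R grad (hs p) z) + (\<Sum>p\<in>BB. \<beta> p *\<^sub>R grad (h\<phi> p) z) =
      ?Q + (\<Sum>s\<in>S1. (\<alpha> (Some s) + \<beta> (Inl s)) *\<^sub>R ?E s) + (\<Sum>s\<in>S2. \<beta> (Inr s) *\<^sub>R ?F s)"
    unfolding 1 2 by (simp add: scaleR_add_left sum.distrib)
  then show ?thesis
    unfolding S1_def S2_def
    by (simp only: vector_add_component vec_lambda_beta nth_sum_Sigma_axis[OF pdg.finite_A[OF pdg]]
        nth_sum_Sigma_axis[OF pdg.finite_B[OF pdg]])
qed

lemma grad_q_subgradient:
  assumes y: "y \<in> ball (x $ i) r" "y \<in> M i"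
  shows "grad (q i) y \<in> subdifferential (f i) y"
proof -
  have "f i y = ereal (q i y)" using q_eq_iff[OF y(1)] y(2) by simp
  moreover have "\<forall>\<^sub>F w in nhds y. ereal (q i w) \<le> f i w"
    using eventually_nhds_in_open[OF open_ball y(1)] q_le by (rule eventually_mono)
  ultimately have "grad (q i) y \<in> regular_subdifferential (f i) y"
    by (rule grad_in_regular_subdifferential[OF _ C2_on_GDERIV[OF C2_q[of i] open_ball y(1)]])
  then show ?thesis using regular_subdifferential_subset by blast
qed

lemma subgradient_of_shifted:
  assumes y: "y \<in> ball (x $ i) r" "y \<in> M i"
    and cb: "(c, b) \<in> shifted_coefficients (A i) (\<Delta> i)"
    and c0: "\<And>l. l \<in> A i \<Longrightarrow> ereal (fs i l y) \<noteq> f i y \<Longrightarrow> c l = 0"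
    and b0: "\<And>j. j \<in> B i \<Longrightarrow> \<phi> i j y \<noteq> 0 \<Longrightarrow> b j = 0"
  shows "grad (q i) y + (\<Sum>l\<in>A i. c l *\<^sub>R (grad (fs i l) y - grad (q i) y)) +
    (\<Sum>j\<in>B i. b j *\<^sub>R grad (\<phi> i j) y) \<in> subdifferential (f i) y"
proof -
  have y\<delta>: "y \<in> M i \<inter> ball (x $ i) (\<delta> i)" using y r(2)[of i] by auto
  note iff = pdg.subgradient_iff[OF pdg y\<delta>]
  obtain \<alpha> \<beta> where ab: "(\<alpha>, \<beta>) \<in> \<Delta> i" "\<forall>l\<in>A i. ereal (fs i l y) \<noteq> f i y \<longrightarrow> \<alpha> l = 0"
      "\<forall>j\<in>B i. \<phi> i j y \<noteq> 0 \<longrightarrow> \<beta> j = 0"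
      "grad (q i) y = (\<Sum>l\<in>A i. \<alpha> l *\<^sub>R grad (fs i l) y) + (\<Sum>j\<in>B i. \<beta> j *\<^sub>R grad (\<phi> i j) y)"
    using grad_q_subgradient[OF y] unfolding iff by blast
  \<comment> \<open>The coefficient of \<open>grad (q i) y\<close> that remains when the differences
    are expanded; this multiple is rewritten by means of \<open>(\<alpha>, \<beta>)\<close>.\<close>
  define s where "s = 1 - (\<Sum>l\<in>A i. c l)"
  have "grad (q i) y + (\<Sum>l\<in>A i. c l *\<^sub>R (grad (fs i l) y - grad (q i) y)) =
      (\<Sum>l\<in>A i. c l *\<^sub>R grad (fs i l) y) + s *\<^sub>R grad (q i) y"
    by (simp add: s_def scaleR_diff_right scaleR_diff_left sum_subtractf scaleR_sum_left)
  also have "s *\<^sub>R grad (q i) y =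
      (\<Sum>l\<in>A i. (s * \<alpha> l) *\<^sub>R grad (fs i l) y) + (\<Sum>j\<in>B i. (s * \<beta> j) *\<^sub>R grad (\<phi> i j) y)"
    by (subst ab(4)) (simp add: scaleR_add_right scaleR_sum_right)
  finally have eq: "grad (q i) y + (\<Sum>l\<in>A i. c l *\<^sub>R (grad (fs i l) y - grad (q i) y)) +
      (\<Sum>j\<in>B i. b j *\<^sub>R grad (\<phi> i j) y) =
      (\<Sum>l\<in>A i. (c l + s * \<alpha> l) *\<^sub>R grad (fs i l) y) + (\<Sum>j\<in>B i. (b j + s * \<beta> j) *\<^sub>R grad (\<phi> i j) y)"
    by (simp add: scaleR_add_left sum.distrib)
  show ?thesis
    unfolding eq iff using ab c0 b0
    by (intro bexI[OF _ shifted_coefficientsD[OF cb ab(1)]]) (auto simp: s_def)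
qed

lemma closed_\<Delta>h: "closed \<Delta>h"
proof -
  have c: "continuous_on UNIV (\<lambda>z :: (('k \<times> 'p) option \<Rightarrow> real) \<times> (('k \<times> 'p) + ('k \<times> 'q) \<Rightarrow> real). fst z i)"
    "continuous_on UNIV (\<lambda>z :: (('k \<times> 'p) option \<Rightarrow> real) \<times> (('k \<times> 'p) + ('k \<times> 'q) \<Rightarrow> real). snd z j)" for i j
    by (rule continuous_on_product_then_coordinatewise[OF continuous_on_fst[OF continuous_on_id]],
        rule continuous_on_product_then_coordinatewise[OF continuous_on_snd[OF continuous_on_id]])
  have cb: "continuous_on UNIV (block i)" for i
    unfolding block_def
    by (intro continuous_on_Pair continuous_on_coordinatewise_then_product continuous_intros c)
  have "\<Delta>h = (\<Inter>p\<in>-AA. {z. fst z p = 0}) \<inter> (\<Inter>p\<in>-BB. {z. snd z p = 0}) \<inter>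
      (\<Inter>p\<in>AA. {z. 0 \<le> fst z p}) \<inter> {z. (\<Sum>p\<in>AA. fst z p) = 1} \<inter>
      (\<Inter>i. block i -` shifted_coefficients (A i) (\<Delta> i))"
    by (auto simp: \<Delta>h_def)
  also have "closed \<dots>"
    by (intro closed_Int closed_INT ballI closed_Collect_eq closed_Collect_le closed_vimage
        closed_shifted_coefficients pdg.closed_\<Delta>[OF pdg] continuous_on_const continuous_on_sum c cb)
  finally show ?thesis .
qed

lemma convex_\<Delta>h:
  assumes z: "(\<alpha>, \<beta>) \<in> \<Delta>h" "(\<alpha>', \<beta>') \<in> \<Delta>h" and t: "t \<in> {0..1}"
  shows "((\<lambda>i. (1 - t) * \<alpha> i + t * \<alpha>' i), (\<lambda>j. (1 - t) * \<beta> j + t * \<beta>' j)) \<in> \<Delta>h"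
proof -
  let ?w = "((\<lambda>i. (1 - t) * \<alpha> i + t * \<alpha>' i), (\<lambda>j. (1 - t) * \<beta> j + t * \<beta>' j))"
  have "block i ?w \<in> shifted_coefficients (A i) (\<Delta> i)" for i
  proof -
    have "block i (\<alpha>, \<beta>) \<in> shifted_coefficients (A i) (\<Delta> i)" "block i (\<alpha>', \<beta>') \<in> shifted_coefficients (A i) (\<Delta> i)"
      using z by (auto simp: \<Delta>h_def)
    from shifted_coefficients_convex[OF pdg.convex_\<Delta>[OF pdg] this[unfolded block_def fst_conv snd_conv] t]
    show ?thesis
      by (rule back_subst[where P = "\<lambda>z. z \<in> shifted_coefficients (A i) (\<Delta> i)"])
        (auto simp: block_def fun_eq_iff algebra_simps)
  qed
  moreover have "(\<Sum>p\<in>AA. (1 - t) * \<alpha> p + t * \<alpha>' p) = 1"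
    using z by (simp add: \<Delta>h_def sum.distrib flip: sum_distrib_left)
  ultimately show ?thesis
    using z t by (auto simp: \<Delta>h_def)
qed

lemma f_block_eq:
  assumes "z \<in> ball x r" "\<forall>i. z $ i \<in> M i"
  shows "f i (z $ i) = ereal (q i (z $ i))" "separable_sum f z = ereal (Qs z)"
proof -
  show *: "f i (z $ i) = ereal (q i (z $ i))" for i
    using q_eq_iff[OF in_block_ball[OF assms(1)]] assms(2) by metis
  show "separable_sum f z = ereal (Qs z)"
    using separable_sum_real[of f z, OF *] by (simp add: Qs_def)
qed

lemma pdg_separable_sum:
  "pdg (separable_sum f) x {z. \<forall>i. z $ i \<in> M i} AA BB hs h\<phi> \<Delta>h r"
proof
  have xM: "x $ i \<in> M i" for i
    using pdg.in_M[OF pdg, of "x $ i"] pdg.fs_x[OF pdg] pdg.\<phi>_x[OF pdg] pdg.\<delta>[OF pdg] by simp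
  have fx: "f i (x $ i) = ereal (q i (x $ i))" "separable_sum f x = ereal (Qs x)" for i
    using f_block_eq(1)[of x i] f_block_eq(2)[of x] r(1) xM by auto
  have gap_x: "gap s x = 0" if sS: "s \<in> S1" for s
  proof -
    obtain i l where s: "s = (i, l)" "l \<in> A i" using sS by (auto simp: S1_def)
    have "ereal (fs i l (x $ i)) = ereal (q i (x $ i))"
      using pdg.fs_x[OF pdg s(2)] fx(1)[of i] by simp
    then show ?thesis by (simp add: s)
  qed
  show "ereal (hs p x) = separable_sum f x" if "p \<in> AA" for p
    using that gap_x by (cases p) (auto simp: AA_def fx(2))
  show "h\<phi> p x = 0" if "p \<in> BB" for p
    using that gap_x pdg.\<phi>_x[OF pdg] by (auto simp: BB_def S2_def)
  show "z \<in> {z. \<forall>i. z $ i \<in> M i}"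
    if z: "z \<in> ball x r" and hs: "\<forall>p\<in>AA. ereal (hs p z) = separable_sum f z" for z
  proof -
    have fin: "\<bar>separable_sum f z\<bar> \<noteq> \<infinity>" and eq: "separable_sum f z = ereal (Qs z)"
      using bspec[OF hs mem_AA(1)] by auto
    then have "\<forall>i. \<exists>a. f i (z $ i) = ereal a"
      unfolding separable_sum_finite_iff by (metis ereal_real')
    then obtain a where a: "\<And>i. f i (z $ i) = ereal (a i)" by metis
    have le: "q i (z $ i) \<le> a i" for i
      using q_le[OF in_block_ball[OF z], of i] a by simp
    have "(\<Sum>i\<in>UNIV. a i) = (\<Sum>i\<in>UNIV. q i (z $ i))"
      using eq separable_sum_real[of f z, OF a] by (simp add: Qs_def)
    \<comment> \<open>Equality with \<open>Qs\<close> alone forces equality in every block: the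
      terms are nonnegative, so they cannot cancel.\<close>
    then have "(\<Sum>i\<in>UNIV. a i - q i (z $ i)) = 0"
      by (simp add: sum_subtractf)
    then have "\<forall>i. a i - q i (z $ i) = 0"
      using le by (subst (asm) sum_nonneg_eq_0_iff) auto
    then show ?thesis
      using q_eq_iff[OF in_block_ball[OF z]] a by auto
  qed
  show "\<exists>p\<in>AA. separable_sum f z = ereal (hs p z)" if "z \<in> {z. \<forall>i. z $ i \<in> M i} \<inter> ball x r" for z
    using f_block_eq(2)[of z] that by (intro bexI[OF _ mem_AA(1)]) auto
  have sumAA: "(\<Sum>p\<in>AA. if p = p' then 1 else 0 :: real) = 1" if "p' \<in> AA" for p'
    using that finite_AA by simp
  have vert: "((\<lambda>l. if l = l' then 1 else 0), (\<lambda>_. 0)) \<in> shifted_coefficients (A i) (\<Delta> i)" if "l' \<in> A i" for i l'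
    using pdg.coefficients_subset_shifted[OF pdg] pdg.vertex[OF pdg that] by blast
  show "((\<lambda>k. if k = p' then 1 else 0), (\<lambda>_. 0)) \<in> \<Delta>h" if p': "p' \<in> AA" for p'
  proof -
    have "block i ((\<lambda>k. if k = p' then 1 else 0), (\<lambda>_. 0)) \<in> shifted_coefficients (A i) (\<Delta> i)" for i
    proof (cases "\<exists>l'. p' = Some (i, l')")
      case True
      then obtain l' where l': "p' = Some (i, l')" by blast
      then show ?thesis using vert p' by (simp add: block_def mem_AA)
    next
      case False
      then have "block i ((\<lambda>k. if k = p' then 1 else 0), (\<lambda>_. 0)) = ((\<lambda>_. 0), (\<lambda>_. 0))"
        by (auto simp: block_def fun_eq_iff)
      then show ?thesis using shifted_coefficients_zero by metis
    qed
    then show ?thesis using p' sumAA by (auto simp: \<Delta>h_def)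
  qed
  show "\<exists>(\<alpha>, \<beta>)\<in>\<Delta>h. \<beta> p' \<noteq> 0 \<and> (\<forall>p\<in>BB. p \<noteq> p' \<longrightarrow> \<beta> p = 0)" if p': "p' \<in> BB" for p'
  proof (cases p')
    case (Inl s)
    then obtain i l where s: "p' = Inl (i, l)" "l \<in> A i"
      using p' by (cases s) (auto simp: mem_BB)
    \<comment> \<open>The whole simplex weight rests on \<open>None\<close>, so block
      \<open>i\<close> sees only the vertex of \<open>l\<close> and the other blocks see 0.\<close>
    let ?w = "((\<lambda>k. if k = None then 1 else 0), (\<lambda>p. if p = p' then 1 else 0))"
    have "block k ?w \<in> shifted_coefficients (A k) (\<Delta> k)" for k
    proof (cases "k = i")
      case True
      then show ?thesis using vert[OF s(2)] s by (simp add: block_def)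
    next
      case False
      then show ?thesis using shifted_coefficients_zero s by (simp add: block_def)
    qed
    then have "?w \<in> \<Delta>h" using p' mem_AA(1) sumAA[OF mem_AA(1)] by (auto simp: \<Delta>h_def)
    then show ?thesis by (intro bexI[of _ ?w]) auto
  next
    case (Inr s)
    then obtain i j where s: "p' = Inr (i, j)" "j \<in> B i"
      using p' by (cases s) (auto simp: mem_BB)
    obtain \<alpha> \<beta> where ab: "(\<alpha>, \<beta>) \<in> \<Delta> i" "\<beta> j \<noteq> 0" "\<And>j'. j' \<in> B i \<Longrightarrow> j' \<noteq> j \<Longrightarrow> \<beta> j' = 0"
      using pdg.single[OF pdg s(2)] by blast
    \<comment> \<open>All constraint coefficients except the one at \<open>p'\<close> must vanish,
      those at \<open>Inl\<close> included; the weights \<open>\<alpha>\<close> that accompany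
      \<open>\<beta> j\<close> are therefore placed on \<open>hs (Some (i, l))\<close>.\<close>
    define \<alpha>' where "\<alpha>' = (\<lambda>p. case p of Some (k, l) \<Rightarrow> if k = i then \<alpha> l else 0 | None \<Rightarrow> 0)"
    define \<beta>' where "\<beta>' = (\<lambda>p :: ('k \<times> 'p) + ('k \<times> 'q). if p = p' then \<beta> j else 0)"
    have "\<beta> = (\<lambda>j'. if j' = j then \<beta> j else 0)"
      using ab(3) pdg.zero_outside(2)[OF pdg ab(1)] by (auto simp: fun_eq_iff)
    then have bi: "block i (\<alpha>', \<beta>') = (\<alpha>, \<beta>)"
      by (auto simp: block_def \<alpha>'_def \<beta>'_def s(1) fun_eq_iff)
    have bk: "block k (\<alpha>', \<beta>') = ((\<lambda>_. 0), (\<lambda>_. 0))" if "k \<noteq> i" for k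
      using that by (auto simp: block_def \<alpha>'_def \<beta>'_def s(1) fun_eq_iff)
    have blk: "block k (\<alpha>', \<beta>') \<in> shifted_coefficients (A k) (\<Delta> k)" for k
    proof (cases "k = i")
      case True
      then show ?thesis using bi ab(1) pdg.coefficients_subset_shifted[OF pdg] by auto
    next
      case False
      then show ?thesis unfolding bk[OF False] by (simp add: shifted_coefficients_zero)
    qed
    have "(\<Sum>p\<in>AA. \<alpha>' p) = (\<Sum>s\<in>S1. \<alpha>' (Some s))"
      unfolding sum_AA by (simp add: \<alpha>'_def)
    also have "\<dots> = (\<Sum>k\<in>UNIV. \<Sum>l\<in>A k. \<alpha>' (Some (k, l)))"
      unfolding S1_def using pdg.finite_A[OF pdg] by (subst sum.Sigma) (auto simp: case_prod_beta)
    also have "\<dots> = (\<Sum>k\<in>UNIV. if k = i then (\<Sum>l\<in>A i. \<alpha> l) else 0)"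
      by (intro sum.cong) (auto simp: \<alpha>'_def)
    also have "\<dots> = 1" using pdg.simplex(2)[OF pdg ab(1)] by simp
    finally have sum1: "(\<Sum>p\<in>AA. \<alpha>' p) = 1" .
    have "\<alpha>' p \<ge> 0" if "p \<in> AA" for p
      using that pdg.simplex(1)[OF pdg ab(1)] by (auto simp: \<alpha>'_def mem_AA split: option.splits)
    moreover have "\<alpha>' p = 0" if "p \<notin> AA" for p
      using that pdg.zero_outside(1)[OF pdg ab(1)] by (auto simp: \<alpha>'_def mem_AA split: option.splits)
    ultimately have "(\<alpha>', \<beta>') \<in> \<Delta>h"
      using blk sum1 p' by (auto simp: \<Delta>h_def \<beta>'_def)
    then show ?thesis using ab(2) by (intro bexI[of _ "(\<alpha>', \<beta>')"]) (auto simp: \<beta>'_def)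
  qed
  show "g \<in> subdifferential (separable_sum f) z \<longleftrightarrow>
      (\<exists>(\<alpha>, \<beta>)\<in>\<Delta>h. (\<forall>p\<in>AA. ereal (hs p z) \<noteq> separable_sum f z \<longrightarrow> \<alpha> p = 0) \<and>
         (\<forall>p\<in>BB. h\<phi> p z \<noteq> 0 \<longrightarrow> \<beta> p = 0) \<and>
         g = (\<Sum>p\<in>AA. \<alpha> p *\<^sub>R grad (hs p) z) + (\<Sum>p\<in>BB. \<beta> p *\<^sub>R grad (h\<phi> p) z))"
    (is "_ \<longleftrightarrow> ?rhs") if "z \<in> {z. \<forall>i. z $ i \<in> M i} \<inter> ball x r" for z g
  proof -
    have z: "z \<in> ball x r" and zM: "\<And>i. z $ i \<in> M i" using that by auto
    have z\<delta>: "z $ i \<in> M i \<inter> ball (x $ i) (\<delta> i)" for i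
      using zM in_block_ball_\<delta>[OF z] by blast
    have fz: "f i (z $ i) = ereal (q i (z $ i))" "separable_sum f z = ereal (Qs z)" for i
      using f_block_eq(1)[OF z, of i] f_block_eq(2)[OF z] zM by auto
    \<comment> \<open>On the product manifold \<open>f i\<close> equals \<open>q i\<close>, so
      inactive structure functions are those with nonzero gap.\<close>
    have gap_iff: "gap (i, l) z \<noteq> 0 \<longleftrightarrow> ereal (fs i l (z $ i)) \<noteq> f i (z $ i)" for i l
      by (simp add: fz(1))
    have split: "g \<in> subdifferential (separable_sum f) z \<longleftrightarrow> (\<forall>i. g $ i \<in> subdifferential (f i) (z $ i))"
      by (simp add: subdifferential_separable_sum[OF lsc])
    show ?thesis
    proof
      assume "g \<in> subdifferential (separable_sum f) z"
      then have g: "g $ i \<in> subdifferential (f i) (z $ i)" for i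
        unfolding split by blast
      define R where "R i \<alpha> \<beta> \<longleftrightarrow> (\<alpha>, \<beta>) \<in> \<Delta> i \<and>
          (\<forall>l\<in>A i. ereal (fs i l (z $ i)) \<noteq> f i (z $ i) \<longrightarrow> \<alpha> l = 0) \<and>
          (\<forall>j\<in>B i. \<phi> i j (z $ i) \<noteq> 0 \<longrightarrow> \<beta> j = 0) \<and>
          g $ i = (\<Sum>l\<in>A i. \<alpha> l *\<^sub>R grad (fs i l) (z $ i)) + (\<Sum>j\<in>B i. \<beta> j *\<^sub>R grad (\<phi> i j) (z $ i))"
        for i \<alpha> \<beta>
      have "\<forall>i. \<exists>\<alpha> \<beta>. R i \<alpha> \<beta>"
        using g unfolding R_def pdg.subgradient_iff[OF pdg z\<delta>] by blast
      then obtain \<alpha> \<beta> where "\<And>i. R i (\<alpha> i) (\<beta> i)"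
        by metis
      then have ab: "\<And>i. (\<alpha> i, \<beta> i) \<in> \<Delta> i"
          "\<And>i l. l \<in> A i \<Longrightarrow> ereal (fs i l (z $ i)) \<noteq> f i (z $ i) \<Longrightarrow> \<alpha> i l = 0"
          "\<And>i j. j \<in> B i \<Longrightarrow> \<phi> i j (z $ i) \<noteq> 0 \<Longrightarrow> \<beta> i j = 0"
          "\<And>i. g $ i = (\<Sum>l\<in>A i. \<alpha> i l *\<^sub>R grad (fs i l) (z $ i)) + (\<Sum>j\<in>B i. \<beta> i j *\<^sub>R grad (\<phi> i j) (z $ i))"
        unfolding R_def by blast+
      \<comment> \<open>Every block has total weight 1, too much for one simplex; the weights become
        \<open>Inl\<close> coefficients, and \<open>None\<close> takes the simplex weight.\<close>
      define \<alpha>' :: "('k \<times> 'p) option \<Rightarrow> real" where "\<alpha>' = (\<lambda>p. if p = None then 1 else 0)"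
      define \<beta>' :: "('k \<times> 'p) + ('k \<times> 'q) \<Rightarrow> real"
        where "\<beta>' = (\<lambda>p. case p of Inl (i, l) \<Rightarrow> \<alpha> i l | Inr (i, j) \<Rightarrow> \<beta> i j)"
      have blk: "block i (\<alpha>', \<beta>') = (\<alpha> i, \<beta> i)" for i
        by (simp add: block_def \<alpha>'_def \<beta>'_def)
      have one: "(\<Sum>p\<in>AA. \<alpha>' p) = 1" unfolding \<alpha>'_def by (rule sumAA[OF mem_AA(1)])
      have "\<beta>' p = 0" if "p \<notin> BB" for p
        using that pdg.zero_outside[OF pdg ab(1)]
        by (auto simp: \<beta>'_def mem_BB split: sum.splits)
      then have mem: "(\<alpha>', \<beta>') \<in> \<Delta>h"
        using blk subsetD[OF pdg.coefficients_subset_shifted[OF pdg] ab(1)] one mem_AA(1)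
        by (auto simp: \<Delta>h_def \<alpha>'_def)
      have "g = (\<Sum>p\<in>AA. \<alpha>' p *\<^sub>R grad (hs p) z) + (\<Sum>p\<in>BB. \<beta>' p *\<^sub>R grad (h\<phi> p) z)"
      proof (rule vec_eq_iff[THEN iffD2], rule allI)
        fix k
        have "(\<Sum>l\<in>A k. \<alpha> k l) = 1" by (rule pdg.simplex(2)[OF pdg ab(1)])
        then have "g $ k = grad (q k) (z $ k) + (\<Sum>l\<in>A k. \<alpha> k l *\<^sub>R (grad (fs k l) (z $ k) - grad (q k) (z $ k))) +
            (\<Sum>j\<in>B k. \<beta> k j *\<^sub>R grad (\<phi> k j) (z $ k))"
          unfolding ab(4) by (simp add: scaleR_diff_right sum_subtractf flip: scaleR_sum_left)
        then show "g $ k = ((\<Sum>p\<in>AA. \<alpha>' p *\<^sub>R grad (hs p) z) + (\<Sum>p\<in>BB. \<beta>' p *\<^sub>R grad (h\<phi> p) z)) $ k"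
          unfolding gradient_combination_nth[OF z one] by (simp add: \<alpha>'_def \<beta>'_def)
      qed
      moreover have "\<forall>p\<in>AA. ereal (hs p z) \<noteq> separable_sum f z \<longrightarrow> \<alpha>' p = 0"
        by (auto simp: \<alpha>'_def fz)
      moreover have "\<forall>p\<in>BB. h\<phi> p z \<noteq> 0 \<longrightarrow> \<beta>' p = 0"
        using ab(2,3) gap_iff by (auto simp: BB_def S1_def S2_def \<beta>'_def simp del: gap.simps)
      ultimately show ?rhs using mem by (intro bexI[of _ "(\<alpha>', \<beta>')"]) auto
    next
      assume ?rhs
      then obtain \<alpha> \<beta> where ab: "(\<alpha>, \<beta>) \<in> \<Delta>h" "\<forall>p\<in>AA. ereal (hs p z) \<noteq> separable_sum f z \<longrightarrow> \<alpha> p = 0"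
         "\<forall>p\<in>BB. h\<phi> p z \<noteq> 0 \<longrightarrow> \<beta> p = 0"
         "g = (\<Sum>p\<in>AA. \<alpha> p *\<^sub>R grad (hs p) z) + (\<Sum>p\<in>BB. \<beta> p *\<^sub>R grad (h\<phi> p) z)"
        by blast
      have one: "(\<Sum>p\<in>AA. \<alpha> p) = 1" using ab(1) by (simp add: \<Delta>h_def)
      show "g \<in> subdifferential (separable_sum f) z"
        unfolding split
      proof
        fix i
        have "block i (\<alpha>, \<beta>) \<in> shifted_coefficients (A i) (\<Delta> i)" using ab(1) by (simp add: \<Delta>h_def)
        then have "((\<lambda>l. \<alpha> (Some (i, l)) + \<beta> (Inl (i, l))), (\<lambda>j. \<beta> (Inr (i, j)))) \<in> shifted_coefficients (A i) (\<Delta> i)"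
          by (simp add: block_def)
        then show "g $ i \<in> subdifferential (f i) (z $ i)"
          unfolding ab(4) gradient_combination_nth[OF z one]
        proof (rule subgradient_of_shifted[OF in_block_ball[OF z] zM])
          fix l assume l: "l \<in> A i" "ereal (fs i l (z $ i)) \<noteq> f i (z $ i)"
          then have "gap (i, l) z \<noteq> 0" by (simp add: gap_iff del: gap.simps)
          then have "ereal (hs (Some (i, l)) z) \<noteq> separable_sum f z" "h\<phi> (Inl (i, l)) z \<noteq> 0"
            by (auto simp: fz(2) simp del: gap.simps)
          then have "\<alpha> (Some (i, l)) = 0" "\<beta> (Inl (i, l)) = 0"
            using ab(2,3) l(1) mem_AA(2) mem_BB(1) by blast+
          then show "\<alpha> (Some (i, l)) + \<beta> (Inl (i, l)) = 0" by simp
        next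
          fix j assume "j \<in> B i" "\<phi> i j (z $ i) \<noteq> 0"
          then show "\<beta> (Inr (i, j)) = 0"
            using ab(3) mem_BB(2) by (metis h\<phi>.simps(2))
        qed
      qed
    qed
  qed
  show "((\<lambda>i. (1 - t) * \<alpha> i + t * \<alpha>' i), (\<lambda>j. (1 - t) * \<beta> j + t * \<beta>' j)) \<in> \<Delta>h"
    if "(\<alpha>, \<beta>) \<in> \<Delta>h" "(\<alpha>', \<beta>') \<in> \<Delta>h" "t \<in> {0..1}" for \<alpha> \<beta> \<alpha>' \<beta>' t
    by (rule convex_\<Delta>h[OF that])
  show "\<alpha> i = 0" if "(\<alpha>, \<beta>) \<in> \<Delta>h" "i \<notin> AA" for \<alpha> \<beta> i using that by (simp add: \<Delta>h_def)
  show "\<beta> i = 0" if "(\<alpha>, \<beta>) \<in> \<Delta>h" "i \<notin> BB" for \<alpha> \<beta> i using that by (simp add: \<Delta>h_def)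
  show "\<alpha> i \<ge> 0" if "(\<alpha>, \<beta>) \<in> \<Delta>h" "i \<in> AA" for \<alpha> \<beta> i using that by (simp add: \<Delta>h_def)
  show "(\<Sum>i\<in>AA. \<alpha> i) = 1" if "(\<alpha>, \<beta>) \<in> \<Delta>h" for \<alpha> \<beta> using that by (simp add: \<Delta>h_def)
qed (use r(1) finite_AA finite_BB mem_AA(1) C2_hs C2_h\<phi> closed_\<Delta>h in auto)

end

section \<open>Subgradients of compositions with linear maps\<close>

text \<open>If no minimiser exists, every \<open>x\<close> in \<open>K\<close> has a neighbourhood
  on which \<open>g\<close> exceeds its value at a better point \<open>w x\<close>. Among the
  finitely many \<open>w x\<close> of a subcover the best one lies in the neighbourhood of some
  \<open>x'\<close> and is beaten by \<open>w x'\<close>.\<close>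

lemma compact_attains_inf_of_lower_semicontinuous:
  fixes g :: "'a::topological_space \<Rightarrow> 'b::linorder"
  assumes K: "compact K" "K \<noteq> {}"
    and lower: "\<And>x c. x \<in> K \<Longrightarrow> c < g x \<Longrightarrow> \<forall>\<^sub>F y in nhds x. c < g y"
  shows "\<exists>x\<in>K. \<forall>y\<in>K. g x \<le> g y"
proof (rule ccontr)
  assume "\<not> ?thesis"
  then have "\<forall>x\<in>K. \<exists>y. y \<in> K \<and> g y < g x" by (auto simp: not_le)
  then obtain w where w: "\<And>x. x \<in> K \<Longrightarrow> w x \<in> K" "\<And>x. x \<in> K \<Longrightarrow> g (w x) < g x" by metis
  have "\<forall>x\<in>K. \<exists>S. open S \<and> x \<in> S \<and> (\<forall>y\<in>S. g (w x) < g y)"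
    using lower[OF _ w(2)] unfolding eventually_nhds by blast
  then obtain S where S: "\<And>x. x \<in> K \<Longrightarrow> open (S x)" "\<And>x. x \<in> K \<Longrightarrow> x \<in> S x"
      "\<And>x y. x \<in> K \<Longrightarrow> y \<in> S x \<Longrightarrow> g (w x) < g y"
    by metis
  obtain C where C: "C \<subseteq> K" "finite C" "K \<subseteq> (\<Union>x\<in>C. S x)"
    using compactE_image[OF K(1), of K S] S(1,2) by (metis UN_I subsetI)
  then have "C \<noteq> {}" using K(2) by blast
  define m where "m = Min ((\<lambda>x. g (w x)) ` C)"
  have "m \<in> (\<lambda>x. g (w x)) ` C"
    unfolding m_def using C(2) \<open>C \<noteq> {}\<close> by (intro Min_in) auto
  then obtain x where x: "x \<in> C" "m = g (w x)" by blast
  then have "w x \<in> K" using C(1) w(1) by blast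
  then obtain x' where x': "x' \<in> C" "w x \<in> S x'" using C(3) by blast
  then have "g (w x') < m" using S(3) C(1) x(2) by blast
  moreover have "m \<le> g (w x')"
    unfolding m_def using C(2) x'(1) by (intro Min_le) auto
  ultimately show False by simp
qed

text \<open>A step by a small multiple \<open>t\<close> of \<open>- d\<close> gains
  \<open>t * (norm d)\<^sup>2\<close> to first order and costs \<open>t * b * norm d\<close> plus a
  term of second order.\<close>

lemma norm_le_of_local_minimum:
  fixes d :: "'a::euclidean_space"
  assumes t: "\<tau> > 0" and b: "b \<ge> 0" and min: "\<And>p. norm p < \<tau> \<Longrightarrow> 0 \<le> d \<bullet> p + b * norm p + C * (norm p)\<^sup>2"
  shows "norm d \<le> b"
proof (rule ccontr)
  assume "\<not> norm d \<le> b"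
  then have db: "norm d > b" and d0: "norm d > 0" using b by auto
  define D where "D = \<bar>C\<bar> * norm d + 1"
  have D: "D > 0" by (simp add: D_def add_nonneg_pos)
  \<comment> \<open>The first bound keeps the step in the ball; the second keeps the quadratic term
    below half of the excess \<open>norm d - b\<close>.\<close>
  define t where "t = min (\<tau> / (2 * norm d)) ((norm d - b) / (2 * D))"
  have t0: "t > 0" using assms(1) db d0 D by (simp add: t_def)
  have "t * norm d \<le> \<tau> / (2 * norm d) * norm d"
    using d0 by (intro mult_right_mono) (auto simp: t_def)
  also have "\<dots> < \<tau>" using assms(1) d0 by simp
  finally have t1: "t * norm d < \<tau>" .
  have "t * D \<le> (norm d - b) / (2 * D) * D"
    using D by (intro mult_right_mono) (auto simp: t_def)
  then have t2: "t * D \<le> (norm d - b) / 2" using D by simp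
  have "0 \<le> d \<bullet> (- t *\<^sub>R d) + b * norm (- t *\<^sub>R d) + C * (norm (- t *\<^sub>R d))\<^sup>2"
    using t0 t1 by (intro min) simp
  also have "\<dots> = (t * norm d) * (- norm d + b + C * (t * norm d))"
    using t0 by (simp add: power2_eq_square algebra_simps flip: power2_norm_eq_inner)
  finally have "0 \<le> - norm d + b + C * (t * norm d)"
    using t0 d0 by (metis mult_pos_pos zero_le_mult_iff not_le)
  moreover have "C * (t * norm d) \<le> t * D"
  proof -
    have "C * (t * norm d) \<le> \<bar>C\<bar> * (t * norm d)"
      using t0 d0 by (intro mult_right_mono) auto
    also have "\<dots> \<le> t * D" using t0 by (simp add: D_def algebra_simps)
    finally show ?thesis .
  qed
  ultimately have "norm d - b \<le> (norm d - b) / 2" using t2 by argo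
  then show False using db by simp
qed

text \<open>The inclusion of the chain rule that holds without a qualification condition:
  \<open>\<Phi>\<close> is Lipschitz, and its constant \<open>B\<close> divides the
  tolerance.\<close>

lemma regular_subdifferential_linear_chain:
  fixes \<Phi> :: "'a::euclidean_space \<Rightarrow> 'b::euclidean_space"
  assumes \<Phi>: "linear \<Phi>" and s: "s \<in> regular_subdifferential h (\<Phi> x)"
  shows "adjoint \<Phi> s \<in> regular_subdifferential (h \<circ> \<Phi>) x"
proof -
  interpret linear \<Phi> by fact
  obtain a where a: "h (\<Phi> x) = ereal a" using regular_subdifferential_finite[OF s] by auto
  then have a': "(h \<circ> \<Phi>) x = ereal a" by simp
  obtain B where B: "B > 0" "\<And>p. norm (\<Phi> p) \<le> B * norm p"
    using linear_bounded_pos[OF \<Phi>] by blast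
  show ?thesis
    unfolding regular_subdifferential_real_iff[of "h \<circ> \<Phi>", OF a']
  proof (intro allI impI)
    fix e :: real assume "e > 0"
    then have "e / B > 0" using B(1) by simp
    then obtain d where d: "d > 0" "\<And>z. dist z (\<Phi> x) < d \<Longrightarrow>
        ereal (a + s \<bullet> (z - \<Phi> x) - e / B * norm (z - \<Phi> x)) \<le> h z"
      using s unfolding regular_subdifferential_real_iff[of h, OF a] by blast
    have "ereal (a + adjoint \<Phi> s \<bullet> (y - x) - e * norm (y - x)) \<le> (h \<circ> \<Phi>) y" if y: "dist y x < d / B" for y
    proof -
      have n: "norm (\<Phi> y - \<Phi> x) \<le> B * norm (y - x)" using B(2)[of "y - x"] by (simp add: diff)
      also have "\<dots> < d" using y B(1) by (simp add: dist_norm field_simps)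
      finally have "ereal (a + s \<bullet> (\<Phi> y - \<Phi> x) - e / B * norm (\<Phi> y - \<Phi> x)) \<le> h (\<Phi> y)"
        by (intro d(2)) (simp add: dist_norm)
      moreover have "e / B * norm (\<Phi> y - \<Phi> x) \<le> e * norm (y - x)"
        using mult_left_mono[OF n, of "e / B"] \<open>e > 0\<close> B(1) by simp
      moreover have "s \<bullet> (\<Phi> y - \<Phi> x) = adjoint \<Phi> s \<bullet> (y - x)"
        using adjoint_works[OF \<Phi>, of "y - x" s] by (simp add: diff inner_commute)
      ultimately show ?thesis
        by (auto intro: order_trans[rotated])
    qed
    then show "\<exists>d>0. \<forall>y. dist y x < d \<longrightarrow> ereal (a + adjoint \<Phi> s \<bullet> (y - x) - e * norm (y - x)) \<le> (h \<circ> \<Phi>) y"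
      using d(1) B(1) by (intro exI[of _ "d / B"]) auto
  qed
qed

text \<open>The constraint \<open>z = \<Phi> y\<close> is replaced by a quadratic penalty; the penalised problems have
  minimisers \<open>(Z n, Y n)\<close>, and the gradient of the penalty at \<open>Z n\<close> is the approximate subgradient.\<close>

lemma fuzzy_linear_chain_rule:
  fixes \<Phi> :: "'a::euclidean_space \<Rightarrow> 'b::euclidean_space"
  assumes \<Phi>: "linear \<Phi>" and lsc: "lsc h" and proper: "\<And>z. h z \<noteq> -\<infinity>"
    and W: "W \<in> regular_subdifferential (h \<circ> \<Phi>) X" and e: "e > 0"
  obtains z s where "s \<in> regular_subdifferential h z" "dist z (\<Phi> X) < e"
    "dist (real_of_ereal (h z)) (real_of_ereal (h (\<Phi> X))) < e" "norm (adjoint \<Phi> s - W) \<le> e"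
proof -
  interpret linear \<Phi> by fact
  obtain a where a: "h (\<Phi> X) = ereal a"
    using regular_subdifferential_finite[OF W] by auto
  then have a': "(h \<circ> \<Phi>) X = ereal a" by simp
  define \<epsilon> where "\<epsilon> = e / 2"
  have \<epsilon>: "\<epsilon> > 0" using e by (simp add: \<epsilon>_def)
  obtain d0 where d0: "d0 > 0" "\<And>y. dist y X < d0 \<Longrightarrow>
      ereal (a + W \<bullet> (y - X) - \<epsilon> * norm (y - X)) \<le> h (\<Phi> y)"
    using W \<epsilon> unfolding regular_subdifferential_real_iff[of "h \<circ> \<Phi>", OF a'] by auto
  define d where "d = d0 / 2"
  have d: "d > 0" "d < d0" using d0(1) by (auto simp: d_def)
  define K where "K = cball (\<Phi> X) d \<times> cball X d"
  have K: "compact K" "(\<Phi> X, X) \<in> K" using d by (auto simp: K_def compact_Times)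
  \<comment> \<open>The weight \<open>2 * \<epsilon>\<close> is twice the tolerance behind
    \<open>d0\<close>. The surplus forces limits of the minimisers \<open>Y n\<close> to be
    \<open>X\<close>; the weight itself, which is \<open>e\<close>, becomes the error of the
    approximate subgradient.\<close>
  define pen where "pen = (\<lambda>n (z, y). real n / 2 * (norm (z - \<Phi> y))\<^sup>2 - W \<bullet> (y - X) + 2 * \<epsilon> * norm (y - X))"
  define G where "G = (\<lambda>n p. h (fst p) + ereal (pen n p))"
  have cont: "continuous_on UNIV (pen n)" for n
    unfolding pen_def case_prod_beta
    by (intro continuous_intros linear_continuous_on_compose[OF _ \<Phi>])
  have lsch: "\<forall>\<^sub>F z in nhds z0. c < h z" if "c < h z0" for c z0
    by (rule lsc_eventually_greater[OF lsc that])
  have lscG: "\<forall>\<^sub>F y in nhds p. c < G n y" if c: "c < G n p" for n p c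
  proof (cases c)
    case PInf
    then show ?thesis using c by simp
  next
    case MInf
    have "-\<infinity> < G n y" for y
      using proper[of "fst y"] by (cases "h (fst y)") (auto simp: G_def)
    then show ?thesis by (simp add: MInf)
  next
    case (real \<gamma>)
    have "ereal (\<gamma> - pen n p) < h (fst p)"
      using c real by (cases "h (fst p)") (auto simp: G_def)
    then obtain c' where c': "\<gamma> - pen n p < c'" "ereal c' < h (fst p)"
      using ereal_dense2[of "ereal (\<gamma> - pen n p)" "h (fst p)"] by auto
    have "\<forall>\<^sub>F y in nhds p. ereal c' < h (fst y)"
      using lsch[OF c'(2)] tendsto_fst[OF filterlim_ident, of p] unfolding filterlim_iff by blast
    moreover have "\<forall>\<^sub>F y in nhds p. \<gamma> - c' < pen n y"
    proof (rule order_tendstoD(1))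
      have "isCont (pen n) p"
        using cont continuous_on_eq_continuous_at[OF open_UNIV] by blast
      then show "(pen n \<longlongrightarrow> pen n p) (nhds p)"
        unfolding isCont_def tendsto_at_iff_tendsto_nhds .
      show "\<gamma> - c' < pen n p" using c'(1) by simp
    qed
    ultimately show ?thesis
    proof eventually_elim
      case (elim y)
      then show ?case using real by (cases "h (fst y)") (auto simp: G_def)
    qed
  qed
  have "\<exists>p\<in>K. \<forall>p'\<in>K. G n p \<le> G n p'" for n
    using K lscG by (intro compact_attains_inf_of_lower_semicontinuous) auto
  then have "\<forall>n. \<exists>z y. (z, y) \<in> K \<and> (\<forall>p'\<in>K. G n (z, y) \<le> G n p')"
    by (metis prod.exhaust)
  then obtain Z Y where ZY: "\<And>n. (Z n, Y n) \<in> K" "\<And>n p. p \<in> K \<Longrightarrow> G n (Z n, Y n) \<le> G n p"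
    by metis
  have pen0: "pen n (\<Phi> X, X) = 0" for n by (simp add: pen_def)
  define hz where "hz = (\<lambda>n. real_of_ereal (h (Z n)))"
  have hz: "h (Z n) = ereal (hz n)" for n
  proof -
    have "G n (Z n, Y n) \<le> ereal a"
      using ZY(2)[OF K(2), of n] by (simp add: G_def pen0 a)
    then show ?thesis
      using proper[of "Z n"] unfolding hz_def by (cases "h (Z n)") (auto simp: G_def)
  qed
  have le: "hz n + pen n (Z n, Y n) \<le> a" for n
    using ZY(2)[OF K(2), of n] by (simp add: G_def pen0 a hz)
  \<comment> \<open>A lower bound for \<open>h\<close> near \<open>\<Phi> X\<close> bounds the
    penalty terms, so \<open>Z n - \<Phi> (Y n)\<close> tends to 0.\<close>
  have "\<exists>z0\<in>cball (\<Phi> X) d. \<forall>z\<in>cball (\<Phi> X) d. h z0 \<le> h z"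
    using d lsch by (intro compact_attains_inf_of_lower_semicontinuous) auto
  then obtain z0 where z0: "\<And>z. z \<in> cball (\<Phi> X) d \<Longrightarrow> h z0 \<le> h z" by blast
  then have "h z0 \<le> ereal a" using d a by (metis centre_in_cball less_imp_le)
  then obtain m where m: "h z0 = ereal m"
    using proper[of z0] by (cases "h z0") auto
  have mle: "m \<le> hz n" for n
    using z0[of "Z n"] ZY(1)[of n] by (simp add: K_def hz m)
  define C where "C = a - m + norm W * d"
  have dY: "norm (Y n - X) \<le> d" for n
    using ZY(1)[of n] by (simp add: K_def dist_norm norm_minus_commute)
  have pC: "real n / 2 * (norm (Z n - \<Phi> (Y n)))\<^sup>2 \<le> C" for n
  proof -
    have "W \<bullet> (Y n - X) \<le> norm W * d"
      using norm_cauchy_schwarz[of W "Y n - X"] mult_left_mono[OF dY[of n] norm_ge_zero[of W]] by linarith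
    moreover have "0 \<le> 2 * \<epsilon> * norm (Y n - X)" using \<epsilon> by simp
    ultimately show ?thesis
      using le[of n] mle[of n] unfolding pen_def C_def by simp
  qed
  obtain l r where l: "l \<in> K" and r: "strict_mono r" "((\<lambda>n. (Z n, Y n)) \<circ> r) \<longlonglongrightarrow> l"
    using K(1) ZY(1) unfolding compact_eq_seq_compact_metric seq_compact_def by meson
  have limZ: "(\<lambda>k. Z (r k)) \<longlonglongrightarrow> fst l" and limY: "(\<lambda>k. Y (r k)) \<longlonglongrightarrow> snd l"
    using tendsto_fst[OF r(2)] tendsto_snd[OF r(2)] by (simp_all add: comp_def)
  have lim\<Phi>: "(\<lambda>k. \<Phi> (Y (r k))) \<longlonglongrightarrow> \<Phi> (snd l)"
    using bounded_linear.tendsto[OF _ limY] \<Phi> by (simp add: linear_conv_bounded_linear)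
  have l\<Phi>: "fst l = \<Phi> (snd l)"
  proof -
    have "(norm (fst l - \<Phi> (snd l)))\<^sup>2 \<le> 0"
    proof (rule LIMSEQ_le)
      show "(\<lambda>k. (norm (Z (r k) - \<Phi> (Y (r k))))\<^sup>2) \<longlonglongrightarrow> (norm (fst l - \<Phi> (snd l)))\<^sup>2"
        by (intro tendsto_intros limZ lim\<Phi>)
      show "(\<lambda>k. 2 * C * inverse (real k)) \<longlonglongrightarrow> 0"
        using tendsto_mult[OF tendsto_const[of "2 * C"] lim_inverse_n] by simp
      have "(norm (Z (r k) - \<Phi> (Y (r k))))\<^sup>2 \<le> 2 * C * inverse (real k)" if k: "k \<ge> 1" for k
      proof -
        have "real k / 2 * (norm (Z (r k) - \<Phi> (Y (r k))))\<^sup>2 \<le> real (r k) / 2 * (norm (Z (r k) - \<Phi> (Y (r k))))\<^sup>2"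
          using seq_suble[OF r(1), of k] by (intro mult_right_mono) auto
        also have "\<dots> \<le> C" by (rule pC)
        finally show ?thesis using k by (simp add: field_simps)
      qed
      then show "\<exists>N. \<forall>k\<ge>N. (norm (Z (r k) - \<Phi> (Y (r k))))\<^sup>2 \<le> 2 * C * inverse (real k)" by blast
    qed
    then show ?thesis by simp
  qed
  \<comment> \<open>Bounds the values \<open>hz n\<close> from above with the penalty dropped; in
    the limit this meets the lower estimate from \<open>d0\<close>.\<close>
  define R where "R = (\<lambda>y. a + W \<bullet> (y - X) - 2 * \<epsilon> * norm (y - X))"
  have hzR: "hz n \<le> R (Y n)" for n
    using le[of n] by (simp add: pen_def R_def) (smt (verit) divide_nonneg_nonneg mult_nonneg_nonneg of_nat_0_le_iff zero_le_power2)
  have limR: "(\<lambda>k. R (Y (r k))) \<longlonglongrightarrow> R (snd l)"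
    unfolding R_def by (intro tendsto_intros limY)
  have "h (fst l) \<le> ereal (R (snd l))"
  proof (rule ccontr)
    assume "\<not> ?thesis"
    then obtain c where c: "R (snd l) < c" "ereal c < h (fst l)"
      using ereal_dense2[of "ereal (R (snd l))" "h (fst l)"] by (auto simp: not_le)
    have "\<forall>\<^sub>F k in sequentially. ereal c < h (Z (r k))"
      using lsch[OF c(2)] limZ unfolding filterlim_iff by blast
    moreover have "\<forall>\<^sub>F k in sequentially. R (Y (r k)) < c"
      using limR c(1) by (rule order_tendstoD)
    ultimately have "\<forall>\<^sub>F k in sequentially. False"
    proof eventually_elim
      case (elim k)
      then show False using hzR[of "r k"] by (simp add: hz)
    qed
    then show False by simp
  qed
  moreover have "ereal (a + W \<bullet> (snd l - X) - \<epsilon> * norm (snd l - X)) \<le> h (\<Phi> (snd l))"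
    using l d by (intro d0(2)) (auto simp: K_def dist_commute)
  ultimately have "ereal (a + W \<bullet> (snd l - X) - \<epsilon> * norm (snd l - X)) \<le> ereal (R (snd l))"
    unfolding l\<Phi> by (rule order_trans[rotated])
  \<comment> \<open>The lower estimate with \<epsilon> and the upper bound with
    \<open>2 * \<epsilon>\<close> hold at the same point, which is possible only at
    \<open>X\<close>.\<close>
  then have "\<epsilon> * norm (snd l - X) \<le> 0" by (simp add: R_def)
  then have lX: "snd l = X" "fst l = \<Phi> X"
    using \<epsilon> l\<Phi> by (auto simp: mult_le_0_iff)
  have "\<forall>\<^sub>F k in sequentially. dist (Z (r k)) (\<Phi> X) < min d e"
    using tendstoD[OF limZ, of "min d e"] d(1) e by (simp add: lX)
  moreover have "\<forall>\<^sub>F k in sequentially. dist (Y (r k)) X < d"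
    using tendstoD[OF limY d(1)] by (simp add: lX)
  moreover have "\<forall>\<^sub>F k in sequentially. ereal (a - e) < h (Z (r k))"
  proof -
    have "ereal (a - e) < h (fst l)" using e by (simp add: lX a)
    from lsch[OF this] show ?thesis using limZ unfolding filterlim_iff by blast
  qed
  moreover have "\<forall>\<^sub>F k in sequentially. R (Y (r k)) < a + e"
    using e by (intro order_tendstoD(2)[OF limR]) (simp add: lX R_def)
  ultimately have "\<forall>\<^sub>F k in sequentially. dist (Z (r k)) (\<Phi> X) < min d e \<and> dist (Y (r k)) X < d \<and>
      ereal (a - e) < h (Z (r k)) \<and> R (Y (r k)) < a + e"
    by eventually_elim blast
  then obtain k where "dist (Z (r k)) (\<Phi> X) < min d e \<and> dist (Y (r k)) X < d \<and>
      ereal (a - e) < h (Z (r k)) \<and> R (Y (r k)) < a + e"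
    using eventually_happens sequentially_bot by blast
  then obtain n where n: "dist (Z n) (\<Phi> X) < d" "dist (Z n) (\<Phi> X) < e" "dist (Y n) X < d"
      "a - e < hz n" "R (Y n) < a + e"
    by (auto simp: hz)
  define s where "s = real n *\<^sub>R (\<Phi> (Y n) - Z n)"
  have s: "s \<in> regular_subdifferential h (Z n)"
  proof -
    \<comment> \<open>Minimality in \<open>z\<close> alone, with \<open>Y n\<close> fixed: near
      \<open>Z n\<close> the function \<open>h\<close> lies above this concave quadratic and touches
      it at \<open>Z n\<close>, where its gradient is \<open>s\<close>.\<close>
    define q where "q = (\<lambda>z. hz n + real n / 2 * (norm (Z n - \<Phi> (Y n)))\<^sup>2 - real n / 2 * ((z - \<Phi> (Y n)) \<bullet> (z - \<Phi> (Y n))))"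
    have "h (Z n) = ereal (q (Z n))"
      by (simp add: q_def hz power2_norm_eq_inner)
    moreover have "GDERIV q (Z n) :> s"
      unfolding gderiv_def q_def s_def
      by (auto intro!: derivative_eq_intros ext simp: inner_commute inner_diff_right algebra_simps)
    moreover have "\<forall>\<^sub>F z in nhds (Z n). ereal (q z) \<le> h z"
    proof -
      have "Z n \<in> ball (\<Phi> X) d" using n(1) by (simp add: dist_commute)
      then have "\<forall>\<^sub>F z in nhds (Z n). z \<in> ball (\<Phi> X) d"
        by (intro eventually_nhds_in_open) auto
      then show ?thesis
      proof eventually_elim
        case (elim z)
        then have "(z, Y n) \<in> K" using n(3) by (auto simp: K_def dist_commute)
        from ZY(2)[OF this, of n] show ?case
          by (cases "h z") (auto simp: G_def hz pen_def q_def power2_norm_eq_inner)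
      qed
    qed
    ultimately show ?thesis by (rule grad_in_regular_subdifferential)
  qed
  obtain B where B: "B > 0" "\<And>p. norm (\<Phi> p) \<le> B * norm p"
    using linear_bounded_pos[OF \<Phi>] by blast
  \<comment> \<open>Minimality in \<open>y\<close> alone, with \<open>Z n\<close> fixed: the
    increment of the penalised function has the linear part \<open>adjoint \<Phi> s - W\<close>, at
    most \<open>2 * \<epsilon> * norm p\<close> from the norm term, and a quadratic
    remainder.\<close>
  have "norm (adjoint \<Phi> s - W) \<le> 2 * \<epsilon>"
  proof (rule norm_le_of_local_minimum)
    show "d - dist (Y n) X > 0" "2 * \<epsilon> \<ge> 0" using n(3) \<epsilon> by auto
    fix p :: 'a assume p: "norm p < d - dist (Y n) X"
    have "dist (Y n + p) X \<le> dist (Y n) X + norm p"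
      using norm_triangle_ineq[of "Y n - X" p] by (simp add: dist_norm algebra_simps)
    then have "(Z n, Y n + p) \<in> K"
      using p n(1) by (auto simp: K_def dist_commute)
    from ZY(2)[OF this, of n] have "pen n (Z n, Y n) \<le> pen n (Z n, Y n + p)"
      by (simp add: G_def hz)
    moreover have "(norm (Z n - \<Phi> (Y n + p)))\<^sup>2 =
        (norm (Z n - \<Phi> (Y n)))\<^sup>2 + 2 * ((\<Phi> (Y n) - Z n) \<bullet> \<Phi> p) + (norm (\<Phi> p))\<^sup>2"
      unfolding power2_norm_eq_inner add by (simp add: inner_commute algebra_simps)
    then have "real n / 2 * (norm (Z n - \<Phi> (Y n + p)))\<^sup>2 =
        real n / 2 * (norm (Z n - \<Phi> (Y n)))\<^sup>2 + s \<bullet> \<Phi> p + real n / 2 * (norm (\<Phi> p))\<^sup>2"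
      unfolding s_def inner_scaleR_left by (simp only:) (simp add: distrib_left)
    moreover have "s \<bullet> \<Phi> p = adjoint \<Phi> s \<bullet> p"
      using adjoint_works[OF \<Phi>, of p s] by (simp add: inner_commute)
    moreover have "norm (Y n + p - X) \<le> norm (Y n - X) + norm p"
      using norm_triangle_ineq[of "Y n - X" p] by (simp add: algebra_simps)
    then have "2 * \<epsilon> * norm (Y n + p - X) \<le> 2 * \<epsilon> * norm (Y n - X) + 2 * \<epsilon> * norm p"
      using mult_left_mono[of _ _ "2 * \<epsilon>"] \<epsilon> by (metis distrib_left less_imp_le mult_pos_pos zero_less_numeral)
    moreover have "(norm (\<Phi> p))\<^sup>2 \<le> B\<^sup>2 * (norm p)\<^sup>2"
      using power_mono[OF B(2) norm_ge_zero, of p 2] by (simp add: power_mult_distrib)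
    then have "real n / 2 * (norm (\<Phi> p))\<^sup>2 \<le> real n / 2 * B\<^sup>2 * (norm p)\<^sup>2"
      using mult_left_mono[of "(norm (\<Phi> p))\<^sup>2" "B\<^sup>2 * (norm p)\<^sup>2" "real n / 2"] by simp
    moreover have "W \<bullet> (Y n + p - X) = W \<bullet> (Y n - X) + W \<bullet> p"
      by (simp add: inner_diff_right inner_add_right)
    ultimately show "0 \<le> (adjoint \<Phi> s - W) \<bullet> p + 2 * \<epsilon> * norm p + real n / 2 * B\<^sup>2 * (norm p)\<^sup>2"
      unfolding pen_def case_prod_conv inner_diff_left by linarith
  qed
  moreover have "dist (real_of_ereal (h (Z n))) (real_of_ereal (h (\<Phi> X))) < e"
    using n(4,5) hzR[of n] by (simp add: a hz dist_real_def abs_less_iff)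
  ultimately show ?thesis
    using that[OF s n(2)] by (simp add: \<epsilon>_def)
qed

section \<open>Sums of functions with fast tracks\<close>

definition diagonal :: "'a \<Rightarrow> 'a ^ 'k" where
  "diagonal y = (\<chi> i. y)"

lemma diagonal_nth [simp]: "diagonal y $ i = y"
  by (simp add: diagonal_def)

lemma linear_diagonal: "linear (diagonal :: 'a::real_vector \<Rightarrow> 'a ^ 'k::finite)"
  by (rule linearI) (simp_all add: vec_eq_iff)

lemma adjoint_diagonal:
  "adjoint (diagonal :: 'a::euclidean_space \<Rightarrow> 'a ^ 'k::finite) s = (\<Sum>i\<in>UNIV. s $ i)"
proof -
  have "adjoint (diagonal :: 'a \<Rightarrow> 'a ^ 'k) = (\<lambda>s. \<Sum>i\<in>UNIV. s $ i)"
    by (rule adjoint_unique) (simp add: inner_vec_def inner_sum_right)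
  then show ?thesis by simp
qed

lemma regular_normal_cone_nth:
  fixes M :: "'k::finite \<Rightarrow> 'a::euclidean_space set"
  assumes W: "W \<in> regular_normal_cone {z. \<forall>i. z $ i \<in> M i} Z"
  shows "W $ i \<in> regular_normal_cone (M i) (Z $ i)"
  unfolding regular_normal_cone_iff
proof (intro conjI allI impI)
  have Z: "Z $ j \<in> M j" for j using W by (auto simp: regular_normal_cone_def)
  show "Z $ i \<in> M i" by (rule Z)
  fix e :: real assume "e > 0"
  then obtain d where d: "d > 0" "\<And>z. (\<forall>i. z $ i \<in> M i) \<Longrightarrow> dist z Z < d \<Longrightarrow> W \<bullet> (z - Z) \<le> e * norm (z - Z)"
    using W unfolding regular_normal_cone_iff by blast
  have "W $ i \<bullet> (y - Z $ i) \<le> e * norm (y - Z $ i)" if y: "y \<in> M i" "dist y (Z $ i) < d" for y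
  proof -
    define z where "z = Z + axis i (y - Z $ i)"
    have z: "z - Z = axis i (y - Z $ i)" by (simp add: z_def)
    have "z $ j \<in> M j" for j using y(1) Z by (auto simp: z_def axis_def)
    moreover have "dist z Z < d" using y(2) unfolding dist_norm z by (simp add: norm_axis)
    ultimately show ?thesis using d(2)[of z] unfolding z by (simp add: inner_axis norm_axis)
  qed
  then show "\<exists>d>0. \<forall>y\<in>M i. dist y (Z $ i) < d \<longrightarrow> W $ i \<bullet> (y - Z $ i) \<le> e * norm (y - Z $ i)"
    using d(1) by blast
qed

lemma normal_cone_nth:
  fixes M :: "'k::finite \<Rightarrow> 'a::euclidean_space set"
  assumes "W \<in> normal_cone {z. \<forall>i. z $ i \<in> M i} Z"
  shows "W $ i \<in> normal_cone (M i) (Z $ i)"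
proof -
  obtain X Y where Z: "Z \<in> {z. \<forall>i. z $ i \<in> M i}"
    and Y: "\<And>k::nat. Y k \<in> regular_normal_cone {z. \<forall>i. z $ i \<in> M i} (X k)"
    and lim: "X \<longlonglongrightarrow> Z" "Y \<longlonglongrightarrow> W"
    using assms unfolding normal_cone_def by blast
  show ?thesis
    unfolding normal_cone_def mem_Collect_eq
  proof (intro conjI exI allI)
    show "Z $ i \<in> M i" using Z by simp
    show "Y k $ i \<in> regular_normal_cone (M i) (X k $ i)" for k
      by (rule regular_normal_cone_nth[OF Y])
    show "(\<lambda>k. X k $ i) \<longlonglongrightarrow> Z $ i" "(\<lambda>k. Y k $ i) \<longlonglongrightarrow> W $ i"
      using lim by (intro tendsto_vec_nth; simp)+
  qed
qed

text \<open>The estimate for \<open>\<epsilon> = 1\<close> already yields finiteness near 0 and the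
  value \<open>a\<close> at 0; the remaining ones give the derivative.\<close>

lemma gradient_at_0_onI:
  fixes L :: "'a::euclidean_space \<Rightarrow> ereal"
  assumes p: "p \<in> U" and U: "0 \<in> U"
    and est: "\<And>\<epsilon>. \<epsilon> > 0 \<Longrightarrow> \<exists>r>0. \<forall>u\<in>U. norm u < r \<longrightarrow>
      ereal (a + p \<bullet> u - \<epsilon> * norm u) \<le> L u \<and> L u \<le> ereal (a + p \<bullet> u + \<epsilon> * norm u)"
  shows "gradient_at_0_on U L p"
proof -
  have fin: "\<bar>L u\<bar> \<noteq> \<infinity>" if "ereal b \<le> L u" "L u \<le> ereal c" for u b c
    using that by (cases "L u") auto
  obtain r where r: "r > 0" "\<forall>u\<in>U. norm u < r \<longrightarrow>
      ereal (a + p \<bullet> u - 1 * norm u) \<le> L u \<and> L u \<le> ereal (a + p \<bullet> u + 1 * norm u)"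
    using est[of 1] by auto
  have L0: "real_of_ereal (L 0) = a"
    using r U by (cases "L 0") auto
  have "((\<lambda>u. real_of_ereal (L u)) has_derivative (\<lambda>u. p \<bullet> u)) (at 0 within U)"
    unfolding has_derivative_within_alt
  proof (intro conjI allI impI)
    show "bounded_linear ((\<bullet>) p)" by (rule bounded_linear_inner_right)
    fix \<epsilon> :: real assume "\<epsilon> > 0"
    then obtain d where d: "d > 0" "\<And>u. u \<in> U \<Longrightarrow> norm u < d \<Longrightarrow>
        ereal (a + p \<bullet> u - \<epsilon> * norm u) \<le> L u \<and> L u \<le> ereal (a + p \<bullet> u + \<epsilon> * norm u)"
      using est by blast
    have "norm (real_of_ereal (L u) - real_of_ereal (L 0) - p \<bullet> (u - 0)) \<le> \<epsilon> * norm (u - 0)"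
      if "u \<in> U" "norm (u - 0) < d" for u
      using d(2)[of u] that by (cases "L u") (auto simp: L0 abs_le_iff)
    then show "\<exists>d>0. \<forall>u\<in>U. norm (u - 0) < d \<longrightarrow>
        norm (real_of_ereal (L u) - real_of_ereal (L 0) - p \<bullet> (u - 0)) \<le> \<epsilon> * norm (u - 0)"
      using d(1) by blast
  qed
  moreover have "\<exists>r>0. \<forall>u\<in>U \<inter> ball 0 r. \<bar>L u\<bar> \<noteq> \<infinity>"
    using r fin by (intro exI[of _ r]) auto
  ultimately show ?thesis
    unfolding gradient_at_0_on_def using p by blast
qed

section \<open>Subdifferential and U-space of the sum\<close>

locale fast_track_sum =
  fixes f :: "'k::finite \<Rightarrow> 'a::euclidean_space \<Rightarrow> ereal" and x :: 'a and v :: "'k \<Rightarrow> 'a \<Rightarrow> 'a"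
  assumes proper: "\<And>i y. f i y \<noteq> -\<infinity>"
    and clarke: "\<And>i. clarke_regular (f i) x"
    and tracks: "\<And>i. fast_track (f i) x (v i)"
    and qualification: "\<And>z. (\<Sum>i\<in>UNIV. z i) = 0 \<Longrightarrow>
      (\<And>i. z i \<in> normal_cone (track_manifold (f i) x (v i)) x) \<Longrightarrow> \<forall>i. z i = 0"

sublocale fast_track_sum \<subseteq> tr: regular_fast_track "f i" x "v i" for i
  by unfold_locales (rule clarke_regular_subdifferential[OF clarke], rule tracks)

context fast_track_sum
begin

abbreviation "h \<equiv> separable_sum f"
abbreviation "\<Phi> \<equiv> diagonal :: 'a \<Rightarrow> 'a ^ 'k"
abbreviation "F \<equiv> h \<circ> \<Phi>"
abbreviation "sdF \<equiv> subdifferential F x"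
abbreviation "VF \<equiv> V_space F x"
abbreviation "product_track \<equiv> \<lambda>u. \<chi> i. v i (u $ i)"
abbreviation "sdh \<equiv> subdifferential h (\<Phi> x)"
abbreviation "Uh \<equiv> U_space h (\<Phi> x)"
abbreviation "Vh \<equiv> V_space h (\<Phi> x)"
abbreviation "Mh \<equiv> track_manifold h (\<Phi> x) product_track"

lemma lsc: "lsc (f i)"
  using tracks[of i] by (auto simp: fast_track_def pdg_structure_def)

lemma h_proper: "h z \<noteq> -\<infinity>"
proof -
  have "(\<Sum>i\<in>I. f i (z $ i)) \<noteq> -\<infinity>" for I
    by (induction I rule: infinite_finite_induct) (auto simp: proper)
  then show ?thesis by (simp add: separable_sum_def)
qed

lemma finite_at: "\<bar>f i x\<bar> \<noteq> \<infinity>" "\<bar>h (\<Phi> x)\<bar> \<noteq> \<infinity>"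
proof -
  show *: "\<bar>f i x\<bar> \<noteq> \<infinity>" for i using clarke[of i] by (simp add: clarke_regular_def)
  show "\<bar>h (\<Phi> x)\<bar> \<noteq> \<infinity>" unfolding separable_sum_finite_iff using * by simp
qed

lemma normal_in_track: "z \<in> tr.V i \<Longrightarrow> z \<in> regular_normal_cone (tr.M i) x"
proof -
  assume z: "z \<in> tr.V i"
  obtain g where g: "g \<in> rel_interior (tr.sd i)"
    by (rule tr.ri_subgradient_exists)
  show ?thesis
    unfolding tr.track_manifold_eq
  proof (rule regular_normal_cone_graph[OF tr.subspace_U tr.v_orthogonal tr.v_0 tr.track_derivatives(1)[OF g]])
    show "z \<bullet> u = 0" if "u \<in> tr.U i" for u
      using z that unfolding tr.V_eq by blast
  qed
qed

text \<open>Elements of the V-spaces are normals to the tracks, so the qualification condition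
  applies to them. In this form it bounds approximate subgradients of the sum and produces points
  common to all tracks.\<close>

lemma V_spaces_independent:
  assumes "(\<Sum>i\<in>UNIV. z i) = 0" "\<And>i. z i \<in> tr.V i"
  shows "z i = 0"
  using qualification[OF assms(1)] normal_in_track[OF assms(2)] regular_normal_cone_subset by blast

text \<open>An unbounded sequence of approximate subgradients, normalised, has a limit that violates the
  qualification condition, since its blocks are horizon subgradients and so lie in the V-spaces.\<close>

lemma subdifferential_sum_subset:
  assumes w: "w \<in> sdF"
  shows "\<exists>s. (\<forall>i. s $ i \<in> tr.sd i) \<and> w = (\<Sum>i\<in>UNIV. s $ i)"
proof -
  have fin: "\<bar>h (\<Phi> x)\<bar> \<noteq> \<infinity>" by (rule finite_at)
  obtain a where a: "h (\<Phi> x) = ereal a" using fin by auto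
  obtain X W where W: "\<And>k::nat. W k \<in> regular_subdifferential F (X k)"
    and X: "X \<longlonglongrightarrow> x" and FX: "(\<lambda>k. F (X k)) \<longlonglongrightarrow> F x" and limW: "W \<longlonglongrightarrow> w"
    using w unfolding subdifferential_def mem_Collect_eq by metis
  define e where "e = (\<lambda>k. inverse (real (Suc k)))"
  have e: "e k > 0" for k by (simp add: e_def)
  have lime: "e \<longlonglongrightarrow> 0" unfolding e_def by (rule LIMSEQ_inverse_real_of_nat)
  have "\<exists>z s. s \<in> regular_subdifferential h z \<and> dist z (\<Phi> (X k)) < e k \<and>
      dist (real_of_ereal (h z)) (real_of_ereal (h (\<Phi> (X k)))) < e k \<and> norm (adjoint \<Phi> s - W k) \<le> e k" for k
    using fuzzy_linear_chain_rule[OF linear_diagonal lsc_separable_sum[OF lsc proper] h_proper W e] by metis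
  then obtain Z s where s: "\<And>k. s k \<in> regular_subdifferential h (Z k)"
    and dZ: "\<And>k. dist (Z k) (\<Phi> (X k)) < e k"
    and dh: "\<And>k. dist (real_of_ereal (h (Z k))) (real_of_ereal (h (\<Phi> (X k)))) < e k"
    and ds: "\<And>k. norm ((\<Sum>i\<in>UNIV. s k $ i) - W k) \<le> e k"
    unfolding adjoint_diagonal by metis
  have "(\<lambda>k. \<Phi> (X k)) \<longlonglongrightarrow> \<Phi> x"
    by (rule vec_tendstoI) (simp add: X)
  moreover have "(\<lambda>k. Z k - \<Phi> (X k)) \<longlonglongrightarrow> 0"
    by (rule Lim_null_comparison[OF _ lime]) (use dZ in \<open>auto simp: dist_norm less_imp_le\<close>)
  ultimately have limZ: "Z \<longlonglongrightarrow> \<Phi> x"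
    using tendsto_add by fastforce
  define b where "b = (\<lambda>k. real_of_ereal (h (\<Phi> (X k))))"
  define c where "c = (\<lambda>k. real_of_ereal (h (Z k)))"
  have b: "h (\<Phi> (X k)) = ereal (b k)" for k
    using regular_subdifferential_finite[OF W[of k]] by (simp add: b_def ereal_real')
  have c: "h (Z k) = ereal (c k)" for k
    using regular_subdifferential_finite[OF s[of k]] by (simp add: c_def ereal_real')
  have "b \<longlonglongrightarrow> a" using FX by (simp add: b a)
  moreover have "(\<lambda>k. c k - b k) \<longlonglongrightarrow> 0"
    by (rule Lim_null_comparison[OF _ lime]) (use dh in \<open>auto simp: dist_norm less_imp_le b_def c_def\<close>)
  ultimately have "c \<longlonglongrightarrow> a" using tendsto_add by fastforce
  then have limh: "(\<lambda>k. h (Z k)) \<longlonglongrightarrow> h (\<Phi> x)" by (simp add: a c)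
  have limf: "(\<lambda>k. f i (Z k $ i)) \<longlonglongrightarrow> f i x" for i
    using tendsto_of_tendsto_separable_sum[OF lsc limZ limh fin regular_subdifferential_finite[OF s], of i]
    by simp
  have limZi: "(\<lambda>k. Z k $ i) \<longlonglongrightarrow> x" for i
    using tendsto_vec_nth[OF limZ, of i] by simp
  have si: "s k $ i \<in> regular_subdifferential (f i) (Z k $ i)" for k i
    using s[of k] unfolding regular_subdifferential_separable_sum by blast
  have "(\<lambda>k. (\<Sum>i\<in>UNIV. s k $ i) - W k) \<longlonglongrightarrow> 0"
    by (rule Lim_null_comparison[OF _ lime]) (use ds in auto)
  from tendsto_add[OF this limW] have limS: "(\<lambda>k. \<Sum>i\<in>UNIV. s k $ i) \<longlonglongrightarrow> w" by simp
  \<comment> \<open>Both \<open>t k\<close> and \<open>t k *\<^sub>R s k\<close> are bounded, and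
    \<open>norm (t k *\<^sub>R s k) = 1 - t k\<close>, so if \<open>t\<close> tends to 0, the scaled
    vectors have a limit of norm 1. One compactness argument thus serves bounded and unbounded
    sequences.\<close>
  define t where "t = (\<lambda>k. 1 / (1 + norm (s k)))"
  have t: "0 < t k" "t k \<le> 1" "norm (t k *\<^sub>R s k) = 1 - t k" for k
  proof -
    have p: "1 + norm (s k) > 0" by (simp add: add_pos_nonneg)
    then show "0 < t k" "t k \<le> 1" by (simp_all add: t_def)
    have "t k * (1 + norm (s k)) = 1" using p by (simp add: t_def)
    then show "norm (t k *\<^sub>R s k) = 1 - t k"
      using \<open>0 < t k\<close> by (simp add: algebra_simps)
  qed
  define K where "K = {0..1::real} \<times> cball (0 :: 'a ^ 'k) 1"
  have "compact K" by (simp add: K_def compact_Times)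
  moreover have "(t k, t k *\<^sub>R s k) \<in> K" for k
    using t(1)[of k] t(2)[of k] t(3)[of k] by (simp add: K_def dist_norm)
  ultimately obtain l r where l: "l \<in> K" and r: "strict_mono r" "((\<lambda>k. (t k, t k *\<^sub>R s k)) \<circ> r) \<longlonglongrightarrow> l"
    unfolding compact_eq_seq_compact_metric seq_compact_def by meson
  define \<tau> where "\<tau> = fst l"
  define \<sigma> where "\<sigma> = snd l"
  have lim\<tau>: "(\<lambda>k. t (r k)) \<longlonglongrightarrow> \<tau>" and lim\<sigma>: "(\<lambda>k. t (r k) *\<^sub>R s (r k)) \<longlonglongrightarrow> \<sigma>"
    using tendsto_fst[OF r(2)] tendsto_snd[OF r(2)] by (simp_all add: comp_def \<tau>_def \<sigma>_def)
  have limSr: "(\<lambda>k. \<Sum>i\<in>UNIV. s (r k) $ i) \<longlonglongrightarrow> w"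
    using LIMSEQ_subseq_LIMSEQ[OF limS r(1)] by (simp add: comp_def)
  have limZr: "(\<lambda>k. Z (r k)) \<longlonglongrightarrow> \<Phi> x" "(\<lambda>k. h (Z (r k))) \<longlonglongrightarrow> h (\<Phi> x)"
    "(\<lambda>k. Z (r k) $ i) \<longlonglongrightarrow> x" "(\<lambda>k. f i (Z (r k) $ i)) \<longlonglongrightarrow> f i x" for i
    using LIMSEQ_subseq_LIMSEQ[OF limZ r(1)] LIMSEQ_subseq_LIMSEQ[OF limh r(1)]
      LIMSEQ_subseq_LIMSEQ[OF limZi r(1)] LIMSEQ_subseq_LIMSEQ[OF limf r(1)] by (simp_all add: comp_def)
  show ?thesis
  proof (cases "\<tau> = 0")
    case True
    \<comment> \<open>The block sums of \<open>s\<close> converge to \<open>w\<close>; scaled by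
      factors tending to 0 they vanish in the limit.\<close>
    have "(\<lambda>k. \<Sum>i\<in>UNIV. (t (r k) *\<^sub>R s (r k)) $ i) \<longlonglongrightarrow> (\<Sum>i\<in>UNIV. \<sigma> $ i)"
      by (intro tendsto_sum tendsto_vec_nth lim\<sigma>)
    moreover have "(\<lambda>k. \<Sum>i\<in>UNIV. (t (r k) *\<^sub>R s (r k)) $ i) \<longlonglongrightarrow> 0"
      using tendsto_scaleR[OF lim\<tau> limSr] True by (simp add: scaleR_sum_right)
    ultimately have sum0: "(\<Sum>i\<in>UNIV. \<sigma> $ i) = 0" by (rule LIMSEQ_unique)
    have "\<sigma> $ i \<in> tr.V i" for i
    proof -
      obtain g where g: "g \<in> tr.sd i" using tr.nonempty by blast
      have "g + \<sigma> $ i \<in> tr.sd i"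
      proof (rule clarke_regular_horizon[OF clarke si limZr(3,4)])
        show "t (r k) \<ge> 0" for k using t(1)[of "r k"] by simp
        show "(\<lambda>k. t (r k)) \<longlonglongrightarrow> 0" using lim\<tau> True by simp
        show "(\<lambda>k. t (r k) *\<^sub>R s (r k) $ i) \<longlonglongrightarrow> \<sigma> $ i"
          using tendsto_vec_nth[OF lim\<sigma>, of i] by simp
        show "g \<in> tr.sd i" by (rule g)
      qed
      from diff_in_V_space[OF tr.convex this g] show ?thesis by simp
    qed
    then have "\<sigma> = 0"
      using V_spaces_independent[OF sum0] by (simp add: vec_eq_iff)
    moreover have "(\<lambda>k. norm (t (r k) *\<^sub>R s (r k))) \<longlonglongrightarrow> 1 - \<tau>"
      unfolding t(3) by (intro tendsto_intros lim\<tau>)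
    then have "norm \<sigma> = 1 - \<tau>"
      using tendsto_norm[OF lim\<sigma>] by (rule LIMSEQ_unique[rotated])
    ultimately show ?thesis using True by simp
  next
    case False
    \<comment> \<open>With a positive limit of the factors, the sequence \<open>s\<close> itself
      converges along \<open>r\<close>.\<close>
    define q where "q = (1 / \<tau>) *\<^sub>R \<sigma>"
    have "(\<lambda>k. (1 / t (r k)) *\<^sub>R (t (r k) *\<^sub>R s (r k))) \<longlonglongrightarrow> q"
      unfolding q_def by (intro tendsto_intros lim\<tau> lim\<sigma> False)
    moreover have "(1 / t k) *\<^sub>R (t k *\<^sub>R s k) = s k" for k
      using t(1)[of k] by simp
    ultimately have limq: "(\<lambda>k. s (r k)) \<longlonglongrightarrow> q" by simp
    have "q \<in> sdh"
      unfolding subdifferential_def mem_Collect_eq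
      using fin s limZr(1,2) limq
      by (intro conjI exI[of _ "\<lambda>k. Z (r k)"] exI[of _ "\<lambda>k. s (r k)"] allI)
    then have "\<forall>i. q $ i \<in> tr.sd i"
      by (simp add: subdifferential_separable_sum[OF lsc])
    moreover have "(\<lambda>k. \<Sum>i\<in>UNIV. s (r k) $ i) \<longlonglongrightarrow> (\<Sum>i\<in>UNIV. q $ i)"
      by (intro tendsto_sum tendsto_vec_nth limq)
    then have "w = (\<Sum>i\<in>UNIV. q $ i)"
      using limSr LIMSEQ_unique by blast
    ultimately show ?thesis by blast
  qed
qed

lemma sum_in_regular_subdifferential:
  assumes "\<And>i. s i \<in> tr.sd i"
  shows "(\<Sum>i\<in>UNIV. s i) \<in> regular_subdifferential F x"
proof -
  have "(\<chi> i. s i) \<in> regular_subdifferential h (\<Phi> x)"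
    unfolding regular_subdifferential_separable_sum using assms tr.regular by simp
  from regular_subdifferential_linear_chain[OF linear_diagonal this]
  show ?thesis unfolding adjoint_diagonal by simp
qed

text \<open>Limiting subgradients are sums of subgradients of the summands, and such sums are
  regular by the easy chain rule. Convexity of \<open>sdF\<close> is obtained from this.\<close>

lemma regular_F: "sdF = regular_subdifferential F x"
proof
  show "sdF \<subseteq> regular_subdifferential F x"
  proof
    fix w assume "w \<in> sdF"
    from subdifferential_sum_subset[OF this] sum_in_regular_subdifferential
    show "w \<in> regular_subdifferential F x" by metis
  qed
qed (rule regular_subdifferential_subset)

lemma convex_F: "convex sdF"
  unfolding regular_F by (rule convex_regular_subdifferential)

lemma sum_in_subdifferential:
  "(\<And>i. s i \<in> tr.sd i) \<Longrightarrow> (\<Sum>i\<in>UNIV. s i) \<in> sdF"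
  unfolding regular_F by (rule sum_in_regular_subdifferential)

lemma nonempty_F: "sdF \<noteq> {}"
proof -
  have "\<forall>i. \<exists>s. s \<in> tr.sd i" using tr.nonempty by blast
  then obtain s where "\<And>i. s i \<in> tr.sd i" by metis
  then show ?thesis using sum_in_subdifferential by blast
qed

text \<open>The subgradients of \<open>F\<close> are the sums of subgradients of the
  \<open>f i\<close>, and exchanging one summand at a time isolates the differences within a single
  subdifferential.\<close>

lemma U_space_F: "U_space F x = (\<Inter>i. tr.U i)"
proof (intro set_eqI iffI INT_I)
  fix w i assume w: "w \<in> U_space F x"
  have "\<forall>i. \<exists>s. s \<in> tr.sd i" using tr.nonempty by blast
  then obtain s where s: "\<And>i. s i \<in> tr.sd i" by metis
  show "w \<in> tr.U i"
    unfolding U_space_eq[OF tr.convex tr.nonempty]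
  proof (intro CollectI ballI)
    fix a b assume ab: "a \<in> tr.sd i" "b \<in> tr.sd i"
    have "(\<Sum>j\<in>UNIV. (s(i := a)) j) \<in> sdF" "(\<Sum>j\<in>UNIV. (s(i := b)) j) \<in> sdF"
      using s ab by (intro sum_in_subdifferential; auto)+
    then have "w \<bullet> ((\<Sum>j\<in>UNIV. (s(i := a)) j) - (\<Sum>j\<in>UNIV. (s(i := b)) j)) = 0"
      using w unfolding U_space_eq[OF convex_F nonempty_F] by blast
    then show "w \<bullet> (a - b) = 0"
      by (simp add: sum.remove[of UNIV i])
  qed
next
  fix w assume w: "w \<in> (\<Inter>i. tr.U i)"
  show "w \<in> U_space F x"
    unfolding U_space_eq[OF convex_F nonempty_F]
  proof (intro CollectI ballI)
    fix a b assume ab: "a \<in> sdF" "b \<in> sdF"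
    obtain s where s: "\<And>i. s $ i \<in> tr.sd i" "a = (\<Sum>i\<in>UNIV. s $ i)"
      using subdifferential_sum_subset[OF ab(1)] by blast
    obtain s' where s': "\<And>i. s' $ i \<in> tr.sd i" "b = (\<Sum>i\<in>UNIV. s' $ i)"
      using subdifferential_sum_subset[OF ab(2)] by blast
    have "w \<bullet> (s $ i - s' $ i) = 0" for i
      using w s(1) s'(1) unfolding U_space_eq[OF tr.convex tr.nonempty] by blast
    then show "w \<bullet> (a - b) = 0"
      unfolding s(2) s'(2) by (simp flip: sum_subtractf add: inner_sum_right)
  qed
qed

subsection \<open>The fast track of the separable sum\<close>

lemma subdifferential_h: "sdh = {s. \<forall>i. s $ i \<in> tr.sd i}"
  by (simp add: subdifferential_separable_sum[OF lsc])

lemma convex_h: "convex sdh"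
proof (rule convexI)
  fix s s' and a b :: real
  assume "s \<in> sdh" "s' \<in> sdh" "0 \<le> a" "0 \<le> b" "a + b = 1"
  then show "a *\<^sub>R s + b *\<^sub>R s' \<in> sdh"
    using convexD[OF tr.convex] by (simp add: subdifferential_h)
qed

lemma nonempty_h: "sdh \<noteq> {}"
proof -
  have "\<forall>i. \<exists>s. s \<in> tr.sd i" using tr.nonempty by blast
  then obtain s where "\<And>i. s i \<in> tr.sd i" by metis
  then have "(\<chi> i. s i) \<in> sdh" by (simp add: subdifferential_h)
  then show ?thesis by blast
qed

lemma U_space_h: "Uh = {u. \<forall>i. u $ i \<in> tr.U i}"
proof (intro set_eqI iffI CollectI allI)
  fix u i assume u: "u \<in> Uh"
  obtain s where s: "s \<in> sdh" using nonempty_h by blast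
  show "u $ i \<in> tr.U i"
    unfolding U_space_eq[OF tr.convex tr.nonempty]
  proof (intro CollectI ballI)
    fix a b assume ab: "a \<in> tr.sd i" "b \<in> tr.sd i"
    have "s + axis i (a - s $ i) \<in> sdh" "s + axis i (b - s $ i) \<in> sdh"
      using s ab unfolding subdifferential_h by (auto simp: axis_def)
    then have "u \<bullet> ((s + axis i (a - s $ i)) - (s + axis i (b - s $ i))) = 0"
      using u unfolding U_space_eq[OF convex_h nonempty_h] by blast
    then show "u $ i \<bullet> (a - b) = 0"
      by (simp add: inner_diff_right inner_axis)
  qed
next
  fix u assume u: "u \<in> {u. \<forall>i. u $ i \<in> tr.U i}"
  show "u \<in> Uh"
    unfolding U_space_eq[OF convex_h nonempty_h]
  proof (intro CollectI ballI)
    fix a b assume ab: "a \<in> sdh" "b \<in> sdh"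
    have "u $ i \<bullet> (a $ i - b $ i) = 0" for i
      using u ab unfolding U_space_eq[OF tr.convex tr.nonempty] subdifferential_h by blast
    then show "u \<bullet> (a - b) = 0"
      by (simp add: inner_vec_def)
  qed
qed

lemma V_space_h: "Vh = {p. \<forall>i. p $ i \<in> tr.V i}"
proof (intro set_eqI iffI CollectI allI)
  fix p i assume p: "p \<in> Vh"
  show "p $ i \<in> tr.V i"
    unfolding tr.V_eq
  proof (intro CollectI ballI)
    fix u assume "u \<in> tr.U i"
    then have "axis i u \<in> Uh"
      unfolding U_space_h using subspace_0[OF tr.subspace_U] by (auto simp: axis_def)
    then have "p \<bullet> axis i u = 0"
      using p unfolding V_space_eq[OF convex_h nonempty_h] by blast
    then show "p $ i \<bullet> u = 0" by (simp add: inner_axis)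
  qed
next
  fix p assume p: "p \<in> {p. \<forall>i. p $ i \<in> tr.V i}"
  show "p \<in> Vh"
    unfolding V_space_eq[OF convex_h nonempty_h] U_space_h
  proof (intro CollectI ballI)
    fix u assume "u \<in> {u. \<forall>i. u $ i \<in> tr.U i}"
    then have "p $ i \<bullet> u $ i = 0" for i
      using p unfolding tr.V_eq by blast
    then show "p \<bullet> u = 0" by (simp add: inner_vec_def)
  qed
qed

lemma track_manifold_h:
  "Mh = {z. \<forall>i. z $ i \<in> tr.M i}"
proof (intro set_eqI iffI CollectI)
  fix z assume "z \<in> Mh"
  then show "\<forall>i. z $ i \<in> tr.M i"
    unfolding track_manifold_def U_space_h by auto
next
  fix z assume "z \<in> {z. \<forall>i. z $ i \<in> tr.M i}"
  then have "\<forall>i. \<exists>u. u \<in> tr.U i \<and> z $ i = x + (u + v i u)"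
    unfolding track_manifold_def by blast
  then obtain u where u: "\<And>i. u i \<in> tr.U i" "\<And>i. z $ i = x + (u i + v i (u i))" by metis
  then have "(\<chi> i. u i) \<in> Uh" by (simp add: U_space_h)
  moreover have "z = \<Phi> x + ((\<chi> i. u i) + product_track (\<chi> i. u i))"
    by (simp add: vec_eq_iff u(2))
  ultimately show "z \<in> Mh"
    unfolding track_manifold_def by blast
qed

lemma support_functions:
  obtains q r where "r > 0" "\<And>i. C2_on (ball x r) (q i)"
    "\<And>i y. y \<in> ball x r \<Longrightarrow> ereal (q i y) \<le> f i y"
    "\<And>i y. y \<in> ball x r \<Longrightarrow> ereal (q i y) = f i y \<longleftrightarrow> y \<in> tr.M i"
proof -
  have "\<exists>q r. r > 0 \<and> C2_on (ball x r) q \<and> (\<forall>y\<in>ball x r. ereal (q y) \<le> f i y) \<and>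
      (\<forall>y\<in>ball x r. ereal (q y) = f i y \<longleftrightarrow> y \<in> tr.M i)" for i
  proof -
    obtain g where g: "g \<in> rel_interior (tr.sd i)"
      by (rule tr.ri_subgradient_exists)
    show ?thesis
      by (rule tr.support_minorant[OF g]) blast
  qed
  then obtain q r where q: "\<And>i. r i > 0" "\<And>i. C2_on (ball x (r i)) (q i)"
      "\<And>i y. y \<in> ball x (r i) \<Longrightarrow> ereal (q i y) \<le> f i y"
      "\<And>i y. y \<in> ball x (r i) \<Longrightarrow> ereal (q i y) = f i y \<longleftrightarrow> y \<in> tr.M i"
    by metis
  define \<rho> where "\<rho> = Min (range r)"
  have \<rho>: "\<rho> > 0" "\<And>i. \<rho> \<le> r i" unfolding \<rho>_def using q(1) by auto
  have sub: "ball x \<rho> \<subseteq> ball x (r i)" for i using \<rho>(2) by (rule subset_ball)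
  show ?thesis
  proof (rule that[OF \<rho>(1)])
    show "C2_on (ball x \<rho>) (q i)" for i by (rule C2_on_subset[OF q(2) sub])
    show "ereal (q i y) \<le> f i y" "ereal (q i y) = f i y \<longleftrightarrow> y \<in> tr.M i" if "y \<in> ball x \<rho>" for i y
      using q(3,4) subsetD[OF sub that] by blast+
  qed
qed

lemma pdg_structure_h: "pdg_structure h (\<Phi> x) Mh"
proof -
  have "\<forall>i. \<exists>m1 m2 fs \<phi> \<Delta> \<delta>. pdg (f i) x (tr.M i) {0..m1::nat} {1..m2::nat} fs \<phi> \<Delta> \<delta>"
    using tracks unfolding fast_track_def by (metis pdg_structureD)
  then obtain m1 m2 fs \<phi> \<Delta> \<delta>
    where pdg: "\<And>i. pdg (f i) x (tr.M i) {0..m1 i::nat} {1..m2 i::nat} (fs i) (\<phi> i) (\<Delta> i) (\<delta> i)"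
    by metis
  obtain q r where r: "r > 0" and q: "\<And>i. C2_on (ball x r) (q i)"
      "\<And>i y. y \<in> ball x r \<Longrightarrow> ereal (q i y) \<le> f i y"
      "\<And>i y. y \<in> ball x r \<Longrightarrow> ereal (q i y) = f i y \<longleftrightarrow> y \<in> tr.M i"
    using support_functions by metis
  define \<rho> where "\<rho> = min r (Min (range \<delta>))"
  have "Min (range \<delta>) > 0" "Min (range \<delta>) \<le> \<delta> i" for i
    using pdg.\<delta>[OF pdg] by auto
  then have \<rho>: "\<rho> > 0" "\<And>i. \<rho> \<le> \<delta> i" and sub: "ball x \<rho> \<subseteq> ball x r"
    using r by (auto simp: \<rho>_def min_le_iff_disj)
  interpret separable_pdg f "\<Phi> x" "\<lambda>i. tr.M i" "\<lambda>i. {0..m1 i}" "\<lambda>i. {1..m2 i}" fs \<phi> \<Delta> \<delta> q \<rho>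
  proof (rule separable_pdg.intro)
    show "C2_on (ball (\<Phi> x $ i) \<rho>) (q i)" for i
      using C2_on_subset[OF q(1) sub] by simp
    show "ereal (q i y) \<le> f i y" "ereal (q i y) = f i y \<longleftrightarrow> y \<in> tr.M i"
      if "y \<in> ball (\<Phi> x $ i) \<rho>" for i y
      using q(2,3) subsetD[OF sub] that by simp_all
  qed (use pdg lsc \<rho> in simp_all)
  show ?thesis
    unfolding track_manifold_h
    by (rule pdg.pdg_structure[OF pdg_separable_sum lsc_separable_sum[OF lsc proper]])
qed

lemma C2_on_product_track:
  assumes "\<And>i. C2_on (tr.U i \<inter> ball 0 r) (v i)"
  shows "C2_on (Uh \<inter> ball 0 r) product_track"
proof (rule C2_on_cong)
  \<comment> \<open>The term \<open>+ 0\<close> brings the coordinate map into the affine form of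
    \<open>C2_on_compose_affine\<close>.\<close>
  show "C2_on (Uh \<inter> ball 0 r) (\<lambda>u. \<Sum>i\<in>UNIV. axis i (v i (u $ i + 0)))"
  proof (intro C2_on_sum)
    fix i
    show "C2_on (Uh \<inter> ball 0 r) (\<lambda>u. axis i (v i (u $ i + 0)))"
    proof (rule C2_on_linear_compose[OF C2_on_compose_affine[OF assms]])
      show "linear (\<lambda>u :: 'a ^ 'k. u $ i)" by (rule linearI) auto
      show "linear (axis i :: 'a \<Rightarrow> 'a ^ 'k)" by (rule linearI) (auto simp: vec_eq_iff axis_def)
      show "u $ i + 0 \<in> tr.U i \<inter> ball 0 r" if "u \<in> Uh \<inter> ball 0 r" for u
        using that Finite_Cartesian_Product.norm_nth_le[of u i] unfolding U_space_h by auto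
    qed
  qed
  show "(\<Sum>i\<in>UNIV. axis i (v i (u $ i + 0))) = product_track u" for u
    by (simp add: vec_eq_iff axis_def if_distrib cong: if_cong)
qed

text \<open>The minimisation decouples: the spaces and the subdifferential of \<open>h\<close> are
  products over the blocks, so minimising over \<open>Vh\<close> means minimising in each block, and
  the Lagrangian of \<open>h\<close> is the sum of the Lagrangians of the
  \<open>f i\<close>.\<close>

lemma fast_track_h: "fast_track h (\<Phi> x) product_track"
proof -
  let ?U = "Uh"
  have props: "\<exists>r>0. C2_on (?U \<inter> ball 0 r) product_track \<and>
        (\<forall>u \<in> ?U \<inter> ball 0 r. product_track u \<in> U_minimizers h (\<Phi> x) g u) \<and>
        (\<forall>u \<in> ?U \<inter> ball 0 r. \<bar>U_lagrangian h (\<Phi> x) g u\<bar> \<noteq> \<infinity>) \<and>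
        C2_on (?U \<inter> ball 0 r) (\<lambda>u. real_of_ereal (U_lagrangian h (\<Phi> x) g u))"
    if g: "g \<in> rel_interior sdh" for g
  proof -
    \<comment> \<open>Relative interiors commute with linear images of convex sets, and the
      subdifferential of \<open>f i\<close> is the image of \<open>sdh\<close> under the coordinate
      map.\<close>
    have gi: "g $ i \<in> rel_interior (tr.sd i)" for i
    proof -
      have lin: "linear (\<lambda>u :: 'a ^ 'k. u $ i)" by (rule linearI) auto
      have "(\<lambda>s. s $ i) ` sdh = tr.sd i"
      proof (intro set_eqI iffI)
        fix a assume a: "a \<in> tr.sd i"
        obtain s where s: "s \<in> sdh" using nonempty_h by blast
        have "s + axis i (a - s $ i) \<in> sdh"
          using s a unfolding subdifferential_h by (auto simp: axis_def)
        then show "a \<in> (\<lambda>s. s $ i) ` sdh"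
          by (intro image_eqI[of _ _ "s + axis i (a - s $ i)"]) (auto simp: axis_def)
      qed (auto simp: subdifferential_h)
      then show ?thesis
        using rel_interior_convex_linear_image[OF lin convex_h] imageI[OF g, of "\<lambda>u. u $ i"] by simp
    qed
    define L where "L = (\<lambda>i u. real_of_ereal (U_lagrangian (f i) x (g $ i) u))"
    have "\<exists>r. r > 0 \<and> C2_on (tr.U i \<inter> ball 0 r) (v i) \<and> C2_on (tr.U i \<inter> ball 0 r) (L i) \<and>
      (\<forall>u\<in>tr.U i \<inter> ball 0 r. f i (x + u + v i u) = ereal (L i u + g $ i \<bullet> v i u)) \<and>
      (\<forall>u\<in>tr.U i \<inter> ball 0 r. \<forall>w\<in>tr.V i. ereal (L i u + g $ i \<bullet> w) \<le> f i (x + u + w))" for i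
      unfolding L_def by (rule tr.lagrangian_near_0[OF gi[of i]]) blast
    then obtain r where r: "\<And>i. r i > 0" "\<And>i. C2_on (tr.U i \<inter> ball 0 (r i)) (v i)"
      "\<And>i. C2_on (tr.U i \<inter> ball 0 (r i)) (L i)"
      "\<And>i u. u \<in> tr.U i \<inter> ball 0 (r i) \<Longrightarrow> f i (x + u + v i u) = ereal (L i u + g $ i \<bullet> v i u)"
      "\<And>i u w. u \<in> tr.U i \<inter> ball 0 (r i) \<Longrightarrow> w \<in> tr.V i \<Longrightarrow>
        ereal (L i u + g $ i \<bullet> w) \<le> f i (x + u + w)"
      by metis
    define \<rho> where "\<rho> = Min (range r)"
    have \<rho>: "\<rho> > 0" "\<And>i. \<rho> \<le> r i" unfolding \<rho>_def using r(1) by auto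
    have sub: "tr.U i \<inter> ball 0 \<rho> \<subseteq> tr.U i \<inter> ball 0 (r i)" for i
      using subset_ball[OF \<rho>(2)] by blast
    have ui: "u $ i \<in> tr.U i \<inter> ball 0 \<rho>" if "u \<in> ?U \<inter> ball 0 \<rho>" for u i
      using that Finite_Cartesian_Product.norm_nth_le[of u i] unfolding U_space_h by auto
    have attained: "h (\<Phi> x + u + product_track u) - ereal (g \<bullet> product_track u) = ereal (\<Sum>i\<in>UNIV. L i (u $ i))"
      if u: "u \<in> ?U \<inter> ball 0 \<rho>" for u
    proof -
      have "f i ((\<Phi> x + u + product_track u) $ i) = ereal (L i (u $ i) + g $ i \<bullet> v i (u $ i))" for i
        using r(4)[OF subsetD[OF sub ui[OF u]]] by simp
      from separable_sum_real[of f, OF this] show ?thesis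
        by (simp add: sum.distrib inner_vec_def)
    qed
    have lower: "ereal (\<Sum>i\<in>UNIV. L i (u $ i)) \<le> h (\<Phi> x + u + w) - ereal (g \<bullet> w)"
      if u: "u \<in> ?U \<inter> ball 0 \<rho>" and w: "w \<in> Vh" for u w
    proof -
      have "ereal (L i (u $ i) + g $ i \<bullet> w $ i) \<le> f i ((\<Phi> x + u + w) $ i)" for i
        using r(5)[OF subsetD[OF sub ui[OF u]]] w unfolding V_space_h by simp
      then have "(\<Sum>i\<in>UNIV. ereal (L i (u $ i) + g $ i \<bullet> w $ i)) \<le> h (\<Phi> x + u + w)"
        unfolding separable_sum_def by (intro sum_mono)
      then have "ereal ((\<Sum>i\<in>UNIV. L i (u $ i)) + g \<bullet> w) \<le> h (\<Phi> x + u + w)"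
        by (simp add: sum.distrib inner_vec_def)
      then show ?thesis by (cases "h (\<Phi> x + u + w)") auto
    qed
    have wV: "product_track u \<in> Vh" if "u \<in> ?U \<inter> ball 0 \<rho>" for u
      using that tr.v_in_V unfolding U_space_h V_space_h by simp
    have lag: "U_lagrangian h (\<Phi> x) g u = ereal (\<Sum>i\<in>UNIV. L i (u $ i))" if u: "u \<in> ?U \<inter> ball 0 \<rho>" for u
      unfolding U_lagrangian_def lagrangian_over_def
    proof (rule antisym)
      show "(INF w\<in>Vh. h (\<Phi> x + u + w) - ereal (g \<bullet> w)) \<le> ereal (\<Sum>i\<in>UNIV. L i (u $ i))"
        by (rule INF_lower2[OF wV[OF u]]) (simp add: attained[OF u])
      show "ereal (\<Sum>i\<in>UNIV. L i (u $ i)) \<le> (INF w\<in>Vh. h (\<Phi> x + u + w) - ereal (g \<bullet> w))"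
        by (rule INF_greatest) (rule lower[OF u])
    qed
    have "C2_on (?U \<inter> ball 0 \<rho>) (\<lambda>u. real_of_ereal (U_lagrangian h (\<Phi> x) g u))"
    proof (rule C2_on_cong)
      show "C2_on (?U \<inter> ball 0 \<rho>) (\<lambda>u. \<Sum>i\<in>UNIV. L i (u $ i + 0))"
      proof (intro C2_on_sum C2_on_compose_affine)
        show "C2_on (tr.U i \<inter> ball 0 (r i)) (L i)" for i by (rule r(3))
        show "linear (\<lambda>u :: 'a ^ 'k. u $ i)" for i by (rule linearI) auto
        show "u $ i + 0 \<in> tr.U i \<inter> ball 0 (r i)" if "u \<in> ?U \<inter> ball 0 \<rho>" for u i
          using subsetD[OF sub ui[OF that]] by simp
      qed
      show "(\<Sum>i\<in>UNIV. L i (u $ i + 0)) = real_of_ereal (U_lagrangian h (\<Phi> x) g u)"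
        if "u \<in> ?U \<inter> ball 0 \<rho>" for u
        by (simp add: lag[OF that])
    qed
    moreover have "product_track u \<in> U_minimizers h (\<Phi> x) g u" "\<bar>U_lagrangian h (\<Phi> x) g u\<bar> \<noteq> \<infinity>"
      if "u \<in> ?U \<inter> ball 0 \<rho>" for u
      using wV[OF that] attained[OF that] lag[OF that] by (simp_all add: U_minimizers_def)
    moreover have "C2_on (?U \<inter> ball 0 \<rho>) product_track"
      by (rule C2_on_product_track) (rule C2_on_subset[OF r(2) sub])
    ultimately show ?thesis
      by (intro exI[of _ \<rho>] conjI ballI \<rho>(1))
  qed
  have V: "product_track ` ?U \<subseteq> Vh"
    using tr.v_in_V unfolding U_space_h V_space_h by auto
  obtain g where "g \<in> rel_interior sdh"
    using rel_interior_eq_empty[OF convex_h] nonempty_h by blast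
  from props[OF this] obtain r where r: "r > 0" "C2_on (?U \<inter> ball 0 r) product_track" by blast
  have "manifold_about (dim ?U) Mh (\<Phi> x)"
    unfolding track_manifold_def
    by (rule manifold_about_graph[OF subspace_U_space[OF convex_h nonempty_h] V_space_eq[OF convex_h nonempty_h] r V])
      (simp add: tr.v_0 vec_eq_iff)
  moreover have "dim Vh + dim ?U = DIM('a ^ 'k)"
    by (rule dim_V_space_add_dim_U_space[OF convex_h nonempty_h])
  ultimately show ?thesis
    unfolding fast_track_def using nonempty_h pdg_structure_h V props by blast
qed

text \<open>The adjoint of the diagonal map adds up the blocks, and the blocks of a normal to the
  product are normals to the factors; the kernel condition thus follows from the qualification
  condition.\<close>

lemma transversal_h: "transversal \<Phi> Mh x"
proof -
  let ?M = "Mh"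
  have man: "\<exists>d. manifold_about d ?M (\<Phi> x)"
    using fast_track_h unfolding fast_track_def by blast
  have D: "frechet_derivative \<Phi> (at x) = \<Phi>"
    by (intro frechet_derivative_at[symmetric] bounded_linear_imp_has_derivative
        linear_conv_bounded_linear[THEN iffD1, OF linear_diagonal])
  have "z = 0" if z: "z \<in> normal_cone ?M (\<Phi> x)" "adjoint \<Phi> z = 0" for z
  proof -
    have "z $ i \<in> normal_cone (tr.M i) x" for i
      using normal_cone_nth[OF z(1)[unfolded track_manifold_h], of i] by simp
    moreover have "(\<Sum>i\<in>UNIV. z $ i) = 0" using z(2) by (simp add: adjoint_diagonal)
    ultimately have "\<forall>i. z $ i = 0" by (intro qualification)
    then show ?thesis by (simp add: vec_eq_iff)
  qed
  moreover have "0 \<in> normal_cone ?M (\<Phi> x)"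
  proof -
    have "\<Phi> x \<in> ?M" using man by (auto simp: manifold_about_def)
    then have "0 \<in> regular_normal_cone ?M (\<Phi> x)"
      unfolding regular_normal_cone_iff by (auto intro!: exI[of _ 1])
    then show ?thesis using regular_normal_cone_subset by blast
  qed
  moreover have "adjoint \<Phi> 0 = 0" by (simp add: adjoint_diagonal)
  ultimately have "{z \<in> normal_cone ?M (\<Phi> x). adjoint \<Phi> z = 0} = {0}" by blast
  then show ?thesis
    unfolding transversal_def D using man C2_on_linear[OF linear_diagonal] by blast
qed

subsection \<open>Points common to all tracks\<close>

abbreviation "UF \<equiv> \<Inter>i. tr.U i"
abbreviation "PF \<equiv> closest_point UF"

lemma subspace_UF: "subspace UF"
  using subspace_U_space[OF convex_F nonempty_F] unfolding U_space_F .

lemma V_space_F: "VF = {p. \<forall>u\<in>UF. p \<bullet> u = 0}"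
  using V_space_eq[OF convex_F nonempty_F] unfolding U_space_F .

text \<open>A point \<open>y\<close> with \<open>\<Psi> y = u \<in> UF\<close> lies on all tracks: the components of \<open>\<Psi> y - u\<close>
  in \<open>UF\<close> and in the independent V-spaces vanish.  The derivative of \<open>\<Psi>\<close> at \<open>x\<close> is the positive
  definite map \<open>PF + (\<Sum>i. id - P i)\<close>, which is the identity on \<open>UF\<close>.\<close>

lemma common_track_points:
  assumes "\<epsilon> > 0"
  obtains \<rho> where "\<rho> > 0" "\<And>u. u \<in> UF \<Longrightarrow> norm u < \<rho> \<Longrightarrow>
    \<exists>w. w \<in> VF \<and> norm w \<le> \<epsilon> * norm u \<and> (\<forall>i. x + u + w \<in> tr.M i)"
proof -
  define G where "G = (\<lambda>i. graph_defect (tr.U i) x (v i))"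
  define \<Psi> where "\<Psi> = (\<lambda>y. PF (y - x) + (\<Sum>i\<in>UNIV. G i y))"
  define A where "A = (\<lambda>p. PF p + (\<Sum>i\<in>UNIV. p - tr.P i p))"
  note linP = linear_closest_point[OF subspace_UF]
  note linPi = linear_closest_point[OF tr.subspace_U]
  have linA: "linear A"
    unfolding A_def
    by (intro linear_compose_add linP linear_compose_sum ballI linear_compose_sub linPi linear_id[unfolded id_def])
  interpret P: linear PF by (rule linP)
  interpret A: linear A by (rule linA)
  have "\<exists>r. r > 0 \<and> C2_on (tr.U i \<inter> ball 0 r) (v i) \<and>
      (v i has_derivative (\<lambda>_. 0)) (at 0 within tr.U i)" for i
  proof -
    obtain g where g: "g \<in> rel_interior (tr.sd i)"
      by (rule tr.ri_subgradient_exists)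
    show ?thesis
      by (rule tr.lagrangian_near_0[OF g]) (use tr.track_derivatives(1)[OF g] in blast)
  qed
  then obtain r where r: "\<And>i. r i > 0" "\<And>i. C2_on (tr.U i \<inter> ball 0 (r i)) (v i)"
    and Dv: "\<And>i. (v i has_derivative (\<lambda>_. 0)) (at 0 within tr.U i)"
    by metis
  define \<rho>0 where "\<rho>0 = Min (range r)"
  have \<rho>0: "\<rho>0 > 0" "\<And>i. \<rho>0 \<le> r i" unfolding \<rho>0_def using r(1) by auto
  have contG: "continuous_on (ball x \<rho>0) (G i)" for i
    unfolding G_def
    by (rule C2_on_continuous_on[OF C2_on_subset[OF C2_on_graph_defect[OF tr.subspace_U r(2)] subset_ball[OF \<rho>0(2)]]])
  have cont: "continuous_on (ball x \<rho>0) \<Psi>"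
    unfolding \<Psi>_def
    by (intro continuous_intros contG linear_continuous_on_compose[OF _ linP])
  have shift: "((\<lambda>y. y - x) has_derivative (\<lambda>h. h)) (at x)"
    by (auto intro!: derivative_eq_intros)
  have DG: "(G i has_derivative (\<lambda>p. p - tr.P i p)) (at x)" for i
  proof -
    let ?Pi = "tr.P i"
    interpret Pi: linear ?Pi by (rule linPi)
    have dP: "((\<lambda>y. ?Pi (y - x)) has_derivative ?Pi) (at x)"
      using linPi[of i] by (intro bounded_linear.has_derivative[OF _ shift]) (simp add: linear_conv_bounded_linear)
    \<comment> \<open>The derivative of \<open>v i\<close> is known along \<open>tr.U i\<close>
      only; this suffices because the projection takes its values there.\<close>
    have "((\<lambda>y. v i (?Pi (y - x))) has_derivative (\<lambda>h. 0)) (at x)"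
    proof (rule has_derivative_in_compose[OF dP])
      show "(v i has_derivative (\<lambda>_. 0)) (at (?Pi (x - x)) within range (\<lambda>y. ?Pi (y - x)))"
        using has_derivative_subset[OF Dv, of "range (\<lambda>y. ?Pi (y - x))" i]
          closest_point_in_subspace[OF tr.subspace_U] by (auto simp: Pi.zero)
    qed
    then have "((\<lambda>y. y - x - ?Pi (y - x) - v i (?Pi (y - x))) has_derivative (\<lambda>p. p - ?Pi p)) (at x)"
      using dP by (auto intro!: derivative_eq_intros)
    then show ?thesis by (simp add: G_def graph_defect_def[abs_def])
  qed
  have DP: "((\<lambda>y. PF (y - x)) has_derivative PF) (at x)"
    using linP by (intro bounded_linear.has_derivative[OF _ shift]) (simp add: linear_conv_bounded_linear)
  have D: "(\<Psi> has_derivative A) (at x)"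
    unfolding \<Psi>_def A_def by (intro has_derivative_add DP has_derivative_sum DG)
  have Gx: "G i x = 0" for i
    by (simp add: G_def graph_defect_def closest_point_subspace_self[OF tr.subspace_U subspace_0[OF tr.subspace_U]] tr.v_0)
  have \<Psi>x: "\<Psi> x = 0" by (simp add: \<Psi>_def Gx P.zero)
  have UFi: "u \<in> tr.U i" if "u \<in> UF" for u i using that by blast
  have Au: "A u = u" if "u \<in> UF" for u
    using closest_point_subspace_self[OF subspace_UF that]
      closest_point_subspace_self[OF tr.subspace_U UFi[OF that]] by (simp add: A_def)
  \<comment> \<open>\<open>p \<bullet> A p\<close> is a sum of squares. If it vanishes,
    \<open>p\<close> equals each \<open>tr.P i p\<close> and so lies in \<open>UF\<close>, while
    \<open>PF p = 0\<close>.\<close>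
  have injA: "inj A"
    unfolding A.inj_iff_eq_0
  proof (intro allI impI)
    fix p assume "A p = 0"
    have po: "p \<bullet> (p - tr.P i p) =
        (p - tr.P i p) \<bullet> (p - tr.P i p)" for i
    proof -
      have "(p - tr.P i p) \<bullet> tr.P i p = 0"
        by (rule closest_point_orthogonal[OF tr.subspace_U closest_point_in_subspace[OF tr.subspace_U]])
      then show ?thesis by (simp add: inner_diff_left inner_diff_right inner_commute)
    qed
    have "0 = p \<bullet> A p" using \<open>A p = 0\<close> by simp
    also have "\<dots> = p \<bullet> PF p + (\<Sum>i\<in>UNIV. p \<bullet> (p - tr.P i p))"
      by (simp add: A_def inner_add_right inner_sum_right)
    also have "p \<bullet> PF p = PF p \<bullet> PF p"
      using closest_point_inner_left[OF subspace_UF closest_point_in_subspace[OF subspace_UF]] by metis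
    finally have *: "PF p \<bullet> PF p + (\<Sum>i\<in>UNIV. (p - tr.P i p) \<bullet>
        (p - tr.P i p)) = 0" unfolding po by simp
    have nn: "0 \<le> (\<Sum>i\<in>UNIV. (p - tr.P i p) \<bullet> (p - tr.P i p))"
      by (intro sum_nonneg) simp
    have "PF p \<bullet> PF p = 0" using * nn inner_ge_zero[of "PF p"] by linarith
    moreover from * this have "(\<Sum>i\<in>UNIV. (p - tr.P i p) \<bullet> (p - tr.P i p)) = 0"
      by linarith
    then have "\<forall>i. p - tr.P i p = 0"
      by (subst (asm) sum_nonneg_eq_0_iff) auto
    then have "p \<in> UF"
      using closest_point_in_subspace[OF tr.subspace_U, where y = p] by (metis INT_I eq_iff_diff_eq_0)
    ultimately show "p = 0"
      using closest_point_subspace_self[OF subspace_UF] by simp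
  qed
  obtain c where c: "c > 0" "\<And>p. c * norm p \<le> norm (A p)"
    using linear_inj_bounded_below_pos[OF linA injA] by metis
  obtain A' where A': "linear A'" "A \<circ> A' = id"
    using linear_surjective_right_inverse[OF linA linear_injective_imp_surjective[OF linA injA]] by blast
  \<comment> \<open>The bound \<open>1 / 2\<close> allows the term with \<open>norm w\<close> to be
    absorbed on the left, at the cost of a factor 2; hence \<open>\<epsilon> / 2\<close>.\<close>
  define \<epsilon>' where "\<epsilon>' = min (1 / 2) (\<epsilon> / 2)"
  have \<epsilon>': "\<epsilon>' > 0" "\<epsilon>' \<le> 1 / 2" "2 * \<epsilon>' \<le> \<epsilon>" using assms by (auto simp: \<epsilon>'_def)
  have "c * \<epsilon>' > 0" using c(1) \<epsilon>'(1) by simp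
  then obtain d where d: "d > 0" "\<And>y. norm (y - x) < d \<Longrightarrow> norm (\<Psi> y - A (y - x)) \<le> c * \<epsilon>' * norm (y - x)"
    using D unfolding has_derivative_at_alt \<Psi>x by (metis diff_zero)
  define \<tau> where "\<tau> = min d \<rho>0"
  have \<tau>: "\<tau> > 0" "\<tau> \<le> d" "\<tau> \<le> \<rho>0" using d(1) \<rho>0(1) by (auto simp: \<tau>_def)
  \<comment> \<open>Open mapping from the derivative at the single point \<open>x\<close> and
    continuity nearby: since \<open>A\<close> has a right inverse, the image of a small ball is a
    neighbourhood of 0.\<close>
  have "\<Psi> x \<in> interior (\<Psi> ` ball x \<tau>)"
    by (rule sussmann_open_mapping[OF open_ball cont _ D _ A'(2)])
      (use A'(1) \<tau> \<rho>0(1) subset_ball[OF \<tau>(3)] in \<open>auto simp: linear_conv_bounded_linear\<close>)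
  then obtain \<rho> where \<rho>: "\<rho> > 0" "ball 0 \<rho> \<subseteq> \<Psi> ` ball x \<tau>"
    unfolding \<Psi>x mem_interior by blast
  have "\<exists>w. w \<in> VF \<and> norm w \<le> \<epsilon> * norm u \<and> (\<forall>i. x + u + w \<in> tr.M i)"
    if u: "u \<in> UF" "norm u < \<rho>" for u
  proof -
    have "u \<in> ball 0 \<rho>" using u(2) by simp
    then obtain y where y: "y \<in> ball x \<tau>" "\<Psi> y = u" using \<rho>(2) by (metis imageE subsetD)
    have GV: "G i y \<in> tr.V i" for i
      unfolding G_def graph_defect_def
      by (rule subspace_diff[OF subspace_V_space diff_closest_point_in_V_space[OF tr.convex tr.nonempty]
            tr.v_in_V[OF closest_point_in_subspace[OF tr.subspace_U]]])
    have Gorth: "G i y \<bullet> u' = 0" if "u' \<in> UF" for i u'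
      using GV[of i] UFi[OF that, of i] unfolding tr.V_eq by blast
    \<comment> \<open>This vector lies in \<open>UF\<close> and is minus the sum of the defects,
      which are orthogonal to \<open>UF\<close>; so it is orthogonal to itself.\<close>
    define q where "q = PF (y - x) - u"
    have qU: "q \<in> UF"
      unfolding q_def by (rule subspace_diff[OF subspace_UF closest_point_in_subspace[OF subspace_UF] u(1)])
    have qG: "q = - (\<Sum>i\<in>UNIV. G i y)"
      using y(2) by (simp add: q_def \<Psi>_def algebra_simps eq_neg_iff_add_eq_0)
    have "q \<bullet> q = 0"
      by (subst (1) qG) (simp add: inner_sum_left Gorth[OF qU])
    then have q0: "q = 0" by simp
    then have "(\<Sum>i\<in>UNIV. G i y) = 0" using qG by simp
    then have "G i y = 0" for i using V_spaces_independent[of "\<lambda>i. G i y"] GV by blast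
    then have M: "y \<in> tr.M i" for i
      unfolding tr.mem_track_manifold_iff G_def .
    define w where "w = y - x - u"
    have "w = (y - x) - PF (y - x)" using q0 by (simp add: w_def q_def)
    then have "w \<in> VF"
      unfolding V_space_F using closest_point_orthogonal[OF subspace_UF] by auto
    moreover have "norm w \<le> \<epsilon> * norm u"
    proof -
      \<comment> \<open>\<open>A\<close> fixes \<open>u = \<Psi> y\<close>, so \<open>A w\<close> is
        up to sign the linearisation error of \<Psi> at \<open>y\<close>; the lower bound
        \<open>c\<close> of \<open>A\<close> turns this into a bound for \<open>w\<close>.\<close>
      have "A w = A (y - x) - u" by (simp add: w_def A.diff Au[OF u(1)])
      then have "c * norm w \<le> norm (\<Psi> y - A (y - x))"
        using c(2)[of w] y(2) by (simp add: norm_minus_commute)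
      also have "\<dots> \<le> c * \<epsilon>' * norm (y - x)"
        using y(1) \<tau>(2) by (intro d(2)) (simp add: dist_norm norm_minus_commute)
      finally have "norm w \<le> \<epsilon>' * norm (y - x)"
        using c(1) by (simp add: mult.assoc)
      also have "\<dots> \<le> \<epsilon>' * (norm u + norm w)"
        using norm_triangle_ineq[of u w] \<epsilon>'(1) by (intro mult_left_mono) (auto simp: w_def)
      finally have "(1 - \<epsilon>') * norm w \<le> \<epsilon>' * norm u" by (simp add: algebra_simps)
      moreover have "1 / 2 * norm w \<le> (1 - \<epsilon>') * norm w"
        using \<epsilon>'(2) by (intro mult_right_mono) auto
      ultimately have "norm w \<le> 2 * \<epsilon>' * norm u" by linarith
      also have "\<dots> \<le> \<epsilon> * norm u" using \<epsilon>'(3) by (rule mult_right_mono) simp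
      finally show ?thesis .
    qed
    moreover have "x + u + w = y" by (simp add: w_def)
    ultimately show ?thesis using M by metis
  qed
  then show ?thesis using that \<rho>(1) by blast
qed

subsection \<open>The U-gradient of the sum\<close>

text \<open>For every \<open>w\<close> in \<open>VF\<close> one of the subgradients in
  \<open>C\<close> exceeds \<open>g\<close> at \<open>w\<close> by \<open>\<kappa> * norm w\<close>,
  and all of them agree with \<open>g\<close> on \<open>UF\<close>. Being finitely many, they share
  a neighbourhood in which their estimates hold.\<close>

lemma regular_lower_estimate:
  assumes g: "g \<in> rel_interior sdF" and a: "F x = ereal a"
  obtains \<kappa> where "\<kappa> > 0" "\<And>\<epsilon>. \<epsilon> > 0 \<Longrightarrow> \<exists>\<delta>>0. \<forall>u\<in>UF. \<forall>w\<in>VF. norm (u + w) < \<delta> \<longrightarrow>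
    ereal (a + g \<bullet> u + g \<bullet> w + \<kappa> * norm w - \<epsilon> * norm (u + w)) \<le> F (x + u + w)"
proof -
  obtain \<rho> where \<rho>: "\<rho> > 0" "\<And>w. w \<in> VF \<Longrightarrow> norm w \<le> \<rho> \<Longrightarrow> g + w \<in> sdF"
    using rel_interior_add_V_space[OF convex_F g] by metis
  define z where "z = (\<lambda>b. b - PF b)"
  have zV: "z b \<in> VF" for b
    unfolding z_def V_space_F using closest_point_orthogonal[OF subspace_UF] by blast
  \<comment> \<open>\<open>g\<close> is moved by at most \<rho> along the
    \<open>VF\<close>-components of the basis vectors; the two directions account for the sign of
    \<open>b \<bullet> w\<close>.\<close>
  define C where "C = (\<lambda>b. g + \<rho> *\<^sub>R z b) ` Basis \<union> (\<lambda>b. g - \<rho> *\<^sub>R z b) ` Basis"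
  have CF: "C \<subseteq> regular_subdifferential F x"
  proof -
    have "g + \<rho> *\<^sub>R z b \<in> sdF" "g + (- \<rho>) *\<^sub>R z b \<in> sdF" if "b \<in> Basis" for b
    proof -
      have "norm (z b) \<le> 1"
        using norm_diff_closest_point_subspace_le[OF subspace_UF, of b] that by (simp add: z_def)
      then have "norm (\<rho> *\<^sub>R z b) \<le> \<rho>" "norm ((- \<rho>) *\<^sub>R z b) \<le> \<rho>"
        using \<rho>(1) by (simp_all add: mult_left_le)
      then show "g + \<rho> *\<^sub>R z b \<in> sdF" "g + (- \<rho>) *\<^sub>R z b \<in> sdF"
        using \<rho>(2)[OF subspace_scale[OF subspace_V_space zV]] by blast+
    qed
    then show ?thesis unfolding regular_F[symmetric] C_def by auto
  qed
  define n where "n = real DIM('a)"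
  have n: "n > 0" by (simp add: n_def)
  define \<kappa> where "\<kappa> = \<rho> / n"
  have \<kappa>: "\<kappa> > 0" using \<rho>(1) n by (simp add: \<kappa>_def)
  have big: "\<exists>q\<in>C. q \<bullet> u = g \<bullet> u \<and> g \<bullet> w + \<kappa> * norm w \<le> q \<bullet> w" if u: "u \<in> UF" and w: "w \<in> VF" for u w
  proof -
    have zw: "z b \<bullet> w = b \<bullet> w" for b
    proof -
      have "w \<bullet> PF b = 0"
        using w closest_point_in_subspace[OF subspace_UF, of b] unfolding V_space_F by blast
      then show ?thesis by (simp add: z_def inner_diff_left inner_commute[of _ w] inner_diff_right)
    qed
    have zu: "z b \<bullet> u = 0" for b
      using zV[of b] u unfolding V_space_F by blast
    \<comment> \<open>The norm is at most the sum of the absolute coordinates, so one of the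
      \<open>n\<close> coordinates is at least \<open>norm w / n\<close>; this is the origin of
      \<open>\<kappa> = \<rho> / n\<close>.\<close>
    have "\<exists>b\<in>Basis. norm w \<le> n * \<bar>b \<bullet> w\<bar>"
    proof (rule ccontr)
      assume "\<not> ?thesis"
      then have "\<bar>w \<bullet> b\<bar> < norm w / n" if "b \<in> Basis" for b
        using that n by (auto simp: not_le field_simps inner_commute)
      then have "(\<Sum>b\<in>Basis. \<bar>w \<bullet> b\<bar>) < (\<Sum>b\<in>(Basis :: 'a set). norm w / n)"
        by (intro sum_strict_mono) auto
      also have "\<dots> = norm w" using n by (simp add: n_def)
      finally show False using norm_le_l1[of w] by simp
    qed
    then obtain b where b: "b \<in> Basis" "norm w \<le> n * \<bar>b \<bullet> w\<bar>" by blast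
    have "\<kappa> * norm w \<le> \<kappa> * (n * \<bar>b \<bullet> w\<bar>)"
      using b(2) \<kappa> by (intro mult_left_mono) auto
    then have kb: "\<kappa> * norm w \<le> \<rho> * \<bar>b \<bullet> w\<bar>" using n by (simp add: \<kappa>_def)
    show ?thesis
    proof (cases "b \<bullet> w \<ge> 0")
      case True
      then show ?thesis using b(1) kb
        by (intro bexI[of _ "g + \<rho> *\<^sub>R z b"]) (auto simp: C_def inner_add_left zu zw)
    next
      case False
      then show ?thesis using b(1) kb
        by (intro bexI[of _ "g - \<rho> *\<^sub>R z b"]) (auto simp: C_def inner_diff_left zu zw)
    qed
  qed
  have "\<exists>\<delta>>0. \<forall>u\<in>UF. \<forall>w\<in>VF. norm (u + w) < \<delta> \<longrightarrow>
    ereal (a + g \<bullet> u + g \<bullet> w + \<kappa> * norm w - \<epsilon> * norm (u + w)) \<le> F (x + u + w)" if \<epsilon>: "\<epsilon> > 0" for \<epsilon>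
  proof -
    have "\<forall>\<^sub>F y in nhds x. ereal (a + q \<bullet> (y - x) - \<epsilon> * norm (y - x)) \<le> F y" if "q \<in> C" for q
    proof -
      have "q \<in> regular_subdifferential F x" using CF that by blast
      then show ?thesis
        using \<epsilon> unfolding regular_subdifferential_real_iff[of F, OF a] eventually_nhds_metric by blast
    qed
    moreover have "finite C" by (simp add: C_def)
    ultimately have "\<forall>\<^sub>F y in nhds x. \<forall>q\<in>C. ereal (a + q \<bullet> (y - x) - \<epsilon> * norm (y - x)) \<le> F y"
      by (simp add: eventually_ball_finite)
    then obtain \<delta> where \<delta>: "\<delta> > 0" "\<And>y q. dist y x < \<delta> \<Longrightarrow> q \<in> C \<Longrightarrow>
        ereal (a + q \<bullet> (y - x) - \<epsilon> * norm (y - x)) \<le> F y"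
      unfolding eventually_nhds_metric by blast
    have "ereal (a + g \<bullet> u + g \<bullet> w + \<kappa> * norm w - \<epsilon> * norm (u + w)) \<le> F (x + u + w)"
      if uw: "u \<in> UF" "w \<in> VF" "norm (u + w) < \<delta>" for u w
    proof -
      obtain q where q: "q \<in> C" "q \<bullet> u = g \<bullet> u" "g \<bullet> w + \<kappa> * norm w \<le> q \<bullet> w"
        using big[OF uw(1,2)] by blast
      have "ereal (a + g \<bullet> u + g \<bullet> w + \<kappa> * norm w - \<epsilon> * norm (u + w)) \<le>
          ereal (a + q \<bullet> (u + w) - \<epsilon> * norm (u + w))"
        using q(2,3) by (simp add: inner_add_right)
      also have "\<dots> \<le> F (x + u + w)"
        using \<delta>(2)[OF _ q(1), of "x + u + w"] uw(3) by (simp add: dist_norm add.assoc)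
      finally show ?thesis .
    qed
    then show ?thesis using \<delta>(1) by blast
  qed
  then show ?thesis using that \<kappa> by blast
qed

text \<open>At points common to all tracks \<open>F\<close> equals the smooth function
  \<open>Q\<close>. Its gradient \<open>s\<close> at \<open>x\<close> is a subgradient of
  \<open>F\<close>, so it agrees with \<open>g\<close> on \<open>UF\<close>; the discrepancy on
  \<open>w\<close> is small because the common points have \<open>w\<close> small relative to
  \<open>u\<close>.\<close>

lemma common_track_upper_estimate:
  assumes g: "g \<in> sdF" and a: "F x = ereal a" and \<epsilon>: "\<epsilon> > 0"
  obtains r where "r > 0" "\<And>u. u \<in> UF \<Longrightarrow> norm u < r \<Longrightarrow>
    \<exists>w. w \<in> VF \<and> norm w \<le> \<epsilon> * norm u \<and> F (x + u + w) \<le> ereal (a + g \<bullet> u + g \<bullet> w + \<epsilon> * norm u)"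
proof -
  obtain q r1 where r1: "r1 > 0" and q: "\<And>i. C2_on (ball x r1) (q i)"
      "\<And>i y. y \<in> ball x r1 \<Longrightarrow> ereal (q i y) \<le> f i y"
      "\<And>i y. y \<in> ball x r1 \<Longrightarrow> ereal (q i y) = f i y \<longleftrightarrow> y \<in> tr.M i"
    using support_functions by metis
  have xM: "x \<in> tr.M i" for i
    using tr.manifold_about_track by (auto simp: manifold_about_def)
  have fq: "f i x = ereal (q i x)" for i
    using q(3)[of x i] r1 xM[of i] by simp
  have Dq: "GDERIV (q i) x :> grad (q i) x" for i
    using C2_on_GDERIV[OF q(1) open_ball] r1 by simp
  have gq: "grad (q i) x \<in> tr.sd i" for i
  proof -
    have "\<forall>\<^sub>F y in nhds x. y \<in> ball x r1"
      using r1 by (intro eventually_nhds_in_open) auto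
    then have "\<forall>\<^sub>F y in nhds x. ereal (q i y) \<le> f i y"
      by (rule eventually_mono) (rule q(2))
    then show ?thesis
      unfolding tr.regular by (rule grad_in_regular_subdifferential[of "f i" x "q i", OF fq Dq])
  qed
  define s where "s = (\<Sum>i\<in>UNIV. grad (q i) x)"
  have s: "s \<in> sdF" unfolding s_def by (rule sum_in_subdifferential[OF gq])
  define Q where "Q = (\<lambda>y. \<Sum>i\<in>UNIV. q i y)"
  have DQ: "GDERIV Q x :> s" unfolding Q_def s_def by (rule GDERIV_sum[OF Dq])
  have Qx: "Q x = a"
    using separable_sum_real[of f "\<Phi> x" "\<lambda>i. q i x"] fq a by (simp add: Q_def)
  have FQ: "F y = ereal (Q y)" if "dist y x < r1" "\<And>i. y \<in> tr.M i" for y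
  proof -
    have "f i (\<Phi> y $ i) = ereal (q i y)" for i
      using q(3)[of y i] that by (simp add: dist_commute)
    from separable_sum_real[of f, OF this] show ?thesis by (simp add: Q_def)
  qed
  have "\<epsilon> / 4 > 0" using \<epsilon> by simp
  then obtain d where d: "d > 0" "\<And>y. norm (y - x) < d \<Longrightarrow> norm (Q y - Q x - (y - x) \<bullet> s) \<le> \<epsilon> / 4 * norm (y - x)"
    using DQ unfolding gderiv_def has_derivative_at_alt by blast
  define \<epsilon>1 where "\<epsilon>1 = \<epsilon> / 2 / (norm (s - g) + 1)"
  have "\<epsilon> / 2 > 0" using \<epsilon> by simp
  note \<epsilon>1 = divide_add_one_mult_le[OF this norm_ge_zero, of "s - g", folded \<epsilon>1_def]
  \<comment> \<open>The bound 1 gives \<open>norm (u + w) \<le> 2 * norm u\<close>, \<epsilon> the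
    claimed bound on \<open>w\<close>, and \<open>\<epsilon>1\<close> makes
    \<open>(s - g) \<bullet> w\<close> at most \<open>\<epsilon> / 2 * norm u\<close>. The other
    half of the error is the linearisation error of \<open>Q\<close>.\<close>
  define \<epsilon>2 where "\<epsilon>2 = min (min 1 \<epsilon>) \<epsilon>1"
  have \<epsilon>2: "\<epsilon>2 > 0" "\<epsilon>2 \<le> 1" "\<epsilon>2 \<le> \<epsilon>" "\<epsilon>2 \<le> \<epsilon>1" using \<epsilon> \<epsilon>1(1) by (auto simp: \<epsilon>2_def)
  obtain \<rho> where \<rho>: "\<rho> > 0" "\<And>u. u \<in> UF \<Longrightarrow> norm u < \<rho> \<Longrightarrow>
    \<exists>w. w \<in> VF \<and> norm w \<le> \<epsilon>2 * norm u \<and> (\<forall>i. x + u + w \<in> tr.M i)"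
    using common_track_points[OF \<epsilon>2(1)] by metis
  define r where "r = min \<rho> (min d r1 / 2)"
  have r: "r > 0" "r \<le> \<rho>" "2 * r \<le> d" "2 * r \<le> r1" using \<rho>(1) d(1) r1 by (auto simp: r_def)
  have "\<exists>w. w \<in> VF \<and> norm w \<le> \<epsilon> * norm u \<and> F (x + u + w) \<le> ereal (a + g \<bullet> u + g \<bullet> w + \<epsilon> * norm u)"
    if u: "u \<in> UF" "norm u < r" for u
  proof -
    obtain w where w: "w \<in> VF" "norm w \<le> \<epsilon>2 * norm u" "\<And>i. x + u + w \<in> tr.M i"
      using \<rho>(2)[OF u(1)] u(2) r(2) by force
    have wu: "norm w \<le> c * norm u" if "\<epsilon>2 \<le> c" for c
      using w(2) mult_right_mono[OF that norm_ge_zero[of u]] by linarith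
    have uw: "norm (u + w) \<le> 2 * norm u"
      using norm_triangle_ineq[of u w] wu[OF \<epsilon>2(2)] by simp
    then have small: "norm (u + w) < d" "norm (u + w) < r1" using u(2) r by linarith+
    have "F (x + u + w) = ereal (Q (x + u + w))"
      using small(2) w(3) by (intro FQ) (simp_all add: dist_norm add.assoc)
    moreover have "Q (x + u + w) \<le> a + g \<bullet> u + g \<bullet> w + \<epsilon> * norm u"
    proof -
      have "norm (Q (x + u + w) - a - (u + w) \<bullet> s) \<le> \<epsilon> / 4 * norm (u + w)"
        using d(2)[of "x + u + w"] small(1) by (simp add: Qx add.assoc)
      then have "Q (x + u + w) \<le> a + (u + w) \<bullet> s + \<epsilon> / 4 * norm (u + w)"
        unfolding real_norm_def by linarith
      moreover have "\<epsilon> / 4 * norm (u + w) \<le> \<epsilon> / 2 * norm u"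
        using mult_left_mono[OF uw, of "\<epsilon> / 4"] \<epsilon> by simp
      moreover have "u \<bullet> s = g \<bullet> u"
        using inner_U_space_eq[OF convex_F, unfolded U_space_F, OF u(1) s g] inner_commute[of u s] by simp
      moreover have "w \<bullet> s \<le> g \<bullet> w + \<epsilon> / 2 * norm u"
      proof -
        have "w \<bullet> s - g \<bullet> w = (s - g) \<bullet> w" by (simp add: inner_diff_left inner_commute[of w])
        also have "\<dots> \<le> norm (s - g) * norm w" by (rule norm_cauchy_schwarz)
        also have "\<dots> \<le> norm (s - g) * (\<epsilon>1 * norm u)"
          using wu[OF \<epsilon>2(4)] by (rule mult_left_mono) simp
        also have "\<dots> \<le> \<epsilon> / 2 * norm u"
          using mult_right_mono[OF \<epsilon>1(2) norm_ge_zero[of u]] by (simp add: mult_ac)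
        finally show ?thesis by simp
      qed
      ultimately show ?thesis by (simp add: inner_add_left)
    qed
    ultimately show ?thesis using w(1) wu[OF \<epsilon>2(3)] by auto
  qed
  then show ?thesis using that r(1) by blast
qed

text \<open>Subgradients of \<open>F\<close> agree on \<open>UF\<close>, so \<open>PF s\<close> is
  the same for all of them. The admissible radii \<open>e\<close> come from the tolerance
  \<open>\<kappa> / 2\<close> alone and are therefore fixed before \<epsilon>.\<close>

lemma has_local_U_gradient_F:
  assumes s: "s \<in> sdF"
  shows "has_local_U_gradient F x (PF s)"
  unfolding has_local_U_gradient_def U_space_F
proof
  fix g assume g: "g \<in> rel_interior sdF"
  then have gF: "g \<in> sdF" using rel_interior_subset by blast
  have gu: "g \<bullet> u = PF s \<bullet> u" if "u \<in> UF" for u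
    using inner_U_space_eq[OF convex_F _ gF s, unfolded U_space_F, OF that]
      closest_point_inner_left[OF subspace_UF that] by simp
  obtain a where a: "F x = ereal a" using finite_at(2) by auto
  obtain \<kappa> where \<kappa>: "\<kappa> > 0" "\<And>\<epsilon>. \<epsilon> > 0 \<Longrightarrow> \<exists>\<delta>>0. \<forall>u\<in>UF. \<forall>w\<in>VF. norm (u + w) < \<delta> \<longrightarrow>
    ereal (a + g \<bullet> u + g \<bullet> w + \<kappa> * norm w - \<epsilon> * norm (u + w)) \<le> F (x + u + w)"
    using regular_lower_estimate[OF g a] by metis
  have "\<kappa> / 2 > 0" using \<kappa>(1) by simp
  from \<kappa>(2)[OF this] obtain \<delta>0 where \<delta>0: "\<delta>0 > 0" "\<And>u w. u \<in> UF \<Longrightarrow> w \<in> VF \<Longrightarrow> norm (u + w) < \<delta>0 \<Longrightarrow>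
    ereal (a + g \<bullet> u + g \<bullet> w + \<kappa> * norm w - \<kappa> / 2 * norm (u + w)) \<le> F (x + u + w)"
    by blast
  have "gradient_at_0_on UF (lagrangian_over (VF \<inter> cball 0 e) F x g) (PF s)"
    if e: "0 < e" "e < \<delta>0 / 2" for e
  proof (rule gradient_at_0_onI)
    show "PF s \<in> UF" by (rule closest_point_in_subspace[OF subspace_UF])
    show "0 \<in> UF" by (rule subspace_0[OF subspace_UF])
    fix \<epsilon> :: real assume \<epsilon>: "\<epsilon> > 0"
    then have "\<epsilon> / 2 > 0" by simp
    from \<kappa>(2)[OF this] obtain \<delta>1 where \<delta>1: "\<delta>1 > 0" "\<And>u w. u \<in> UF \<Longrightarrow> w \<in> VF \<Longrightarrow> norm (u + w) < \<delta>1 \<Longrightarrow>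
      ereal (a + g \<bullet> u + g \<bullet> w + \<kappa> * norm w - \<epsilon> / 2 * norm (u + w)) \<le> F (x + u + w)"
      by blast
    define \<epsilon>' where "\<epsilon>' = min 1 \<epsilon>"
    have \<epsilon>': "\<epsilon>' > 0" "\<epsilon>' \<le> 1" "\<epsilon>' \<le> \<epsilon>" using \<epsilon> by (auto simp: \<epsilon>'_def)
    obtain r1 where r1: "r1 > 0" "\<And>u. u \<in> UF \<Longrightarrow> norm u < r1 \<Longrightarrow>
      \<exists>w. w \<in> VF \<and> norm w \<le> \<epsilon>' * norm u \<and> F (x + u + w) \<le> ereal (a + g \<bullet> u + g \<bullet> w + \<epsilon>' * norm u)"
      using common_track_upper_estimate[OF gF a \<epsilon>'(1)] by metis
    define r where "r = min (min r1 e) (min (\<delta>0 / 2) (\<delta>1 / 2))"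
    have r: "r > 0" "r \<le> r1" "r \<le> e" "2 * r \<le> \<delta>0" "2 * r \<le> \<delta>1"
      using r1(1) e \<delta>0(1) \<delta>1(1) by (auto simp: r_def)
    have "ereal (a + PF s \<bullet> u - \<epsilon> * norm u) \<le> lagrangian_over (VF \<inter> cball 0 e) F x g u \<and>
        lagrangian_over (VF \<inter> cball 0 e) F x g u \<le> ereal (a + PF s \<bullet> u + \<epsilon> * norm u)"
      if u: "u \<in> UF" "norm u < r" for u
    proof
      show "ereal (a + PF s \<bullet> u - \<epsilon> * norm u) \<le> lagrangian_over (VF \<inter> cball 0 e) F x g u"
        unfolding lagrangian_over_def
      proof (rule INF_greatest)
        fix w assume w: "w \<in> VF \<inter> cball 0 e"
        have uw: "norm (u + w) \<le> norm u + norm w" by (rule norm_triangle_ineq)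
        have "ereal (a + g \<bullet> u + g \<bullet> w - \<epsilon> * norm u) \<le> F (x + u + w)"
        \<comment> \<open>If \<open>w\<close> dominates, the error at tolerance
          \<open>\<kappa> / 2\<close> is at most \<open>\<kappa> * norm w\<close>, which the gain
          covers, and \<open>\<delta>0\<close> is large enough for all \<open>w\<close> in the ball.
          Otherwise \<open>norm (u + w) \<le> 2 * norm u\<close> and the tolerance
          \<open>\<epsilon> / 2\<close> applies.\<close>
        proof (cases "norm u \<le> norm w")
          case True
          have "norm (u + w) < \<delta>0" using uw u(2) w e(2) r(4) by simp
          with u(1) w have "ereal (a + g \<bullet> u + g \<bullet> w + \<kappa> * norm w - \<kappa> / 2 * norm (u + w)) \<le> F (x + u + w)"
            by (intro \<delta>0(2)) auto
          moreover have "\<kappa> / 2 * norm (u + w) \<le> \<kappa> / 2 * (2 * norm w)"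
            using uw True \<kappa>(1) by (intro mult_left_mono) auto
          moreover have "0 \<le> \<epsilon> * norm u" using \<epsilon> by simp
          ultimately show ?thesis by (auto elim!: order_trans[rotated])
        next
          case False
          then have uw2: "norm (u + w) \<le> 2 * norm u" using uw by simp
          then have "norm (u + w) < \<delta>1" using u(2) r(5) by simp
          with u(1) w have "ereal (a + g \<bullet> u + g \<bullet> w + \<kappa> * norm w - \<epsilon> / 2 * norm (u + w)) \<le> F (x + u + w)"
            by (intro \<delta>1(2)) auto
          moreover have "\<epsilon> / 2 * norm (u + w) \<le> \<epsilon> * norm u"
            using mult_left_mono[OF uw2, of "\<epsilon> / 2"] \<epsilon> by simp
          moreover have "0 \<le> \<kappa> * norm w" using \<kappa>(1) by simp
          ultimately show ?thesis by (auto elim!: order_trans[rotated])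
        qed
        then show "ereal (a + PF s \<bullet> u - \<epsilon> * norm u) \<le> F (x + u + w) - ereal (g \<bullet> w)"
          unfolding gu[OF u(1)] by (cases "F (x + u + w)") auto
      qed
      obtain w where w: "w \<in> VF" "norm w \<le> \<epsilon>' * norm u"
          "F (x + u + w) \<le> ereal (a + g \<bullet> u + g \<bullet> w + \<epsilon>' * norm u)"
        using r1(2)[OF u(1)] u(2) r(2) by force
      have "norm w \<le> e"
        using w(2) mult_right_mono[OF \<epsilon>'(2) norm_ge_zero[of u]] u(2) r(3) by simp
      then have "lagrangian_over (VF \<inter> cball 0 e) F x g u \<le> F (x + u + w) - ereal (g \<bullet> w)"
        unfolding lagrangian_over_def using w(1) by (intro INF_lower) auto
      also have "\<dots> \<le> ereal (a + g \<bullet> u + \<epsilon>' * norm u)"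
        using w(3) by (cases "F (x + u + w)") auto
      also have "\<dots> \<le> ereal (a + PF s \<bullet> u + \<epsilon> * norm u)"
        using mult_right_mono[OF \<epsilon>'(3) norm_ge_zero[of u]] by (simp add: gu[OF u(1)])
      finally show "lagrangian_over (VF \<inter> cball 0 e) F x g u \<le> ereal (a + PF s \<bullet> u + \<epsilon> * norm u)" .
    qed
    then show "\<exists>r>0. \<forall>u\<in>UF. norm u < r \<longrightarrow>
        ereal (a + PF s \<bullet> u - \<epsilon> * norm u) \<le> lagrangian_over (VF \<inter> cball 0 e) F x g u \<and>
        lagrangian_over (VF \<inter> cball 0 e) F x g u \<le> ereal (a + PF s \<bullet> u + \<epsilon> * norm u)"
      using r(1) by blast
  qed
  then show "\<forall>\<^sub>F e in at_right 0. gradient_at_0_on UF (lagrangian_over (VF \<inter> cball 0 e) F x g) (PF s)"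
    unfolding eventually_at_right_field using \<delta>0(1) by (intro exI[of _ "\<delta>0 / 2"]) auto
qed

text \<open>A fast track of \<open>F\<close> makes the results on a single regular function
  applicable to \<open>F\<close> itself, which gives the derivative of its Lagrangian;
  \<open>g\<close> and \<open>s\<close> have the same projection because they agree on
  \<open>UF\<close>.\<close>

lemma has_U_gradient_F:
  assumes s: "s \<in> sdF" and w: "fast_track F x w"
  shows "has_U_gradient F x (PF s)"
proof -
  interpret FT: regular_fast_track F x w
    by unfold_locales (rule regular_F, rule w)
  show ?thesis
    unfolding has_U_gradient_def
  proof
    fix g assume g: "g \<in> rel_interior sdF"
    then have gF: "g \<in> sdF" using rel_interior_subset by blast
    have "PF g = PF s"
    proof (rule closest_point_subspace_eqI[OF subspace_UF closest_point_in_subspace[OF subspace_UF]])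
      fix u assume u: "u \<in> UF"
      show "(g - PF s) \<bullet> u = 0"
        using inner_U_space_eq[OF convex_F _ gF s, unfolded U_space_F, OF u]
          closest_point_inner_left[OF subspace_UF u, of s] by (simp add: inner_diff_left)
    qed
    then have "((\<lambda>u. real_of_ereal (U_lagrangian F x g u)) has_derivative (\<lambda>p. PF s \<bullet> p)) (at 0 within U_space F x)"
      using FT.track_derivatives(2)[OF g] by (simp only: U_space_F)
    moreover obtain r where "r > 0" "\<And>u. u \<in> U_space F x \<inter> ball 0 r \<Longrightarrow> \<bar>U_lagrangian F x g u\<bar> \<noteq> \<infinity>"
      by (rule FT.lagrangian_near_0[OF g]) blast
    moreover have "PF s \<in> U_space F x"
      unfolding U_space_F by (rule closest_point_in_subspace[OF subspace_UF])
    ultimately show "gradient_at_0_on (U_space F x) (U_lagrangian F x g) (PF s)"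
      unfolding gradient_at_0_on_def by metis
  qed
qed

end

theorem theorem5p3:
  fixes f :: "'k::finite \<Rightarrow> real ^ 'n \<Rightarrow> ereal"
    and x :: "real ^ 'n"
    and v :: "'k \<Rightarrow> real ^ 'n \<Rightarrow> real ^ 'n"
    and \<Phi> :: "real ^ 'n \<Rightarrow> (real ^ 'n) ^ 'k"
    and h :: "(real ^ 'n) ^ 'k \<Rightarrow> ereal"
    and F :: "real ^ 'n \<Rightarrow> ereal"
    and Ub :: "real ^ 'd ^ 'n"
  assumes "\<And>i y. f i y \<noteq> -\<infinity>"
    and "\<And>i. f i x < \<infinity>"
    and "\<And>i. clarke_regular (f i) x"
    and "\<And>i. fast_track (f i) x (v i)"
    and "\<And>z :: 'k \<Rightarrow> real ^ 'n.
           (\<Sum>i\<in>UNIV. z i) = 0 \<Longrightarrow>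
           (\<And>i. z i \<in> normal_cone (track_manifold (f i) x (v i)) x) \<Longrightarrow>
           (\<forall>i. z i = 0)"
    and "\<Phi> = (\<lambda>y. \<chi> i. y)"
    and "h = (\<lambda>z. \<Sum>i\<in>UNIV. f i (z $ i))"
    and "F = h \<circ> \<Phi>"
  shows "(\<exists>w. fast_track h (\<Phi> x) w \<and> transversal \<Phi> (track_manifold h (\<Phi> x) w) x) \<and>
         subdifferential F x \<noteq> {} \<and>
         U_space F x = (\<Inter>i. U_space (f i) x) \<and>
         (\<forall>g. (\<forall>i. g i \<in> rel_interior (subdifferential (f i) x)) \<longrightarrow>
            has_local_U_gradient F x (closest_point (U_space F x) (\<Sum>i\<in>UNIV. g i)) \<and>
            ((\<exists>w. fast_track F x w) \<longrightarrow>
               has_U_gradient F x (closest_point (U_space F x) (\<Sum>i\<in>UNIV. g i))) \<and>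
            (orthonormal_basis_matrix Ub (U_space F x) \<longrightarrow>
               (Ub ** transpose Ub) *v (\<Sum>i\<in>UNIV. g i) =
                 closest_point (U_space F x) (\<Sum>i\<in>UNIV. g i)))"
proof -
  interpret S: fast_track_sum f x v
    by unfold_locales (use assms(1,3,4,5) in blast)+
  have h: "h = separable_sum f" and \<Phi>: "\<Phi> = diagonal"
    using assms(6,7) by (simp_all add: fun_eq_iff separable_sum_def diagonal_def)
  have F: "F = separable_sum f \<circ> diagonal"
    using assms(8) h \<Phi> by simp
  have sum: "(\<Sum>i\<in>UNIV. g i) \<in> subdifferential F x" if "\<forall>i. g i \<in> rel_interior (subdifferential (f i) x)" for g
    unfolding F using that rel_interior_subset by (intro S.sum_in_subdifferential) blast
  have U: "U_space F x = (\<Inter>i. U_space (f i) x)"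
    unfolding F by (rule S.U_space_F)
  show ?thesis
  proof (intro conjI allI impI)
    show "\<exists>w. fast_track h (\<Phi> x) w \<and> transversal \<Phi> (track_manifold h (\<Phi> x) w) x"
      unfolding h \<Phi> using S.fast_track_h S.transversal_h by blast
    show "subdifferential F x \<noteq> {}"
      unfolding F by (rule S.nonempty_F)
    show "U_space F x = (\<Inter>i. U_space (f i) x)" by (rule U)
    fix g assume "\<forall>i. g i \<in> rel_interior (subdifferential (f i) x)"
    note g = sum[OF this]
    show "has_local_U_gradient F x (closest_point (U_space F x) (\<Sum>i\<in>UNIV. g i))"
      using S.has_local_U_gradient_F[OF g[unfolded F]] unfolding U unfolding F .
    show "has_U_gradient F x (closest_point (U_space F x) (\<Sum>i\<in>UNIV. g i))" if "\<exists>w. fast_track F x w"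
      using S.has_U_gradient_F[OF g[unfolded F]] that unfolding U unfolding F by (elim exE)
    show "(Ub ** transpose Ub) *v (\<Sum>i\<in>UNIV. g i) = closest_point (U_space F x) (\<Sum>i\<in>UNIV. g i)"
      if "orthonormal_basis_matrix Ub (U_space F x)"
      by (rule matrix_projection_eq_closest_point[OF that])
  qed
qed

end
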